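(* For every real $\alpha>-1$, there exist a non-extreme point $b$ of the closed unit ball of $H^\infty$ and a function $f\in\mathcal{H}(b)$ such that $A_r^\alpha[f]\not\to f$ in $\mathcal{H}(b)$ as $r\to1^-$.
   Context: $\mathbb{D}$ is the open unit disk, $\mathbb{T}$ the unit circle, $H^2$ and $H^\infty$ the usual Hardy spaces on $\mathbb{D}$ (identified with their boundary functions on $\mathbb{T}$), and $P_+:L^2(\mathbb{T})\to H^2$ the orthogonal projection. For $\phi\in L^\infty(\mathbb{T})$, the Toeplitz operator is $T_\phi:H^2\to H^2$, $T_\phi f:=P_+(\phi f)$. For $b\in H^\infty$ with $\|b\|_\infty\le1$, the de Branges--Rovnyak space $\mathcal{H}(b)$ is the range $(I-T_bT_{\overline b})^{1/2}H^2$ with inner product $$\langle (I-T_bT_{\overline b})^{1/2}f,(I-T_bT_{\overline b})^{1/2}g\rangle_b:=\langle f,g\rangle_{H^2}\quad (f,g\in H^2\ominus\ker(I-T_bT_{\overline b})^{1/2}),$$ and norm denoted $\|\cdot\|_b$. The function $b$ is called non-extreme if it is not an extreme point of the closed unit ball of $H^\infty$. For $f(z)=\sum_{n\ge0}a_nz^n$ holomorphic on $\mathbb{D}$, let $s_n[f](z):=\sum_{k=0}^na_kz^k$. For $\alpha>-1$ the generalized Abel means of order $\alpha$ of $f$ are $$A_r^\alpha[f](z):=(1-r)^{1+\alpha}\sum_{n\ge0}\binom{n+\alpha}{\alpha}s_n[f](z)\,r^n\quad(0\le r<1,\ z\in\mathbb{D}),$$ where $\binom{n+\alpha}{\alpha}=\frac{\Gamma(n+\alpha+1)}{\Gamma(\alpha+1)\,n!}$,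 so that $\sum_{n\ge0}\binom{n+\alpha}{\alpha}r^n=(1-r)^{-1-\alpha}$. If $b$ is non-extreme and $f\in\mathcal{H}(b)$, then $A_r^\alpha[f]\in\mathcal{H}(b)$ for every $r\in[0,1)$. *)

theory Defs
  imports "HOL-Complex_Analysis.Complex_Analysis"
begin

section \<open>The Lebesgue space on the circle\<close>

definition circle_measure :: "complex measure" where
  "circle_measure = distr (uniform_measure lborel {0..2 * pi}) borel cis"

text \<open>Elements are functions, not classes modulo null sets; all constructions below depend on
  them only through integrals. Values off the unit circle are irrelevant.\<close>

definition L2_circle :: "(complex \<Rightarrow> complex) set" where
  "L2_circle = {g \<in> borel_measurable circle_measure.
     integrable circle_measure (\<lambda>\<zeta>. (norm (g \<zeta>))\<^sup>2)}"

definition L2_inner :: "(complex \<Rightarrow> complex) \<Rightarrow> (complex \<Rightarrow> complex) \<Rightarrow> complex" where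
  "L2_inner g h = (\<integral>\<zeta>. g \<zeta> * cnj (h \<zeta>) \<partial>circle_measure)"


section \<open>Hardy spaces\<close>

text \<open>A function on the open unit disk is represented by its extension by zero to the whole
  plane, so that equality of functions is equality on the disk.\<close>

definition H2 :: "(complex \<Rightarrow> complex) set" where
  "H2 = {f. f holomorphic_on ball 0 1 \<and> (\<forall>z. z \<notin> ball 0 1 \<longrightarrow> f z = 0) \<and>
     (\<exists>C. \<forall>r\<in>{0..<1}. (\<integral>\<zeta>. (norm (f (of_real r * \<zeta>)))\<^sup>2 \<partial>circle_measure) \<le> C)}"

definition H_infty :: "(complex \<Rightarrow> complex) set" where
  "H_infty = {f. f holomorphic_on ball 0 1 \<and> (\<forall>z. z \<notin> ball 0 1 \<longrightarrow> f z = 0) \<and>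
     bounded (f ` ball 0 1)}"

definition H_infty_norm :: "(complex \<Rightarrow> complex) \<Rightarrow> real" where
  "H_infty_norm f = (SUP z\<in>ball 0 1. norm (f z))"

definition H_infty_unit_ball :: "(complex \<Rightarrow> complex) set" where
  "H_infty_unit_ball = {f \<in> H_infty. H_infty_norm f \<le> 1}"

text \<open>This spells out the library's \<open>extreme_point_of\<close>, which needs a vector space type.\<close>

definition extreme :: "(complex \<Rightarrow> complex) \<Rightarrow> bool" where
  "extreme b \<longleftrightarrow> b \<in> H_infty_unit_ball \<and>
     (\<forall>f\<in>H_infty_unit_ball. \<forall>g\<in>H_infty_unit_ball. \<forall>u::real.
        f \<noteq> g \<and> 0 < u \<and> u < 1 \<longrightarrow>
        b \<noteq> (\<lambda>z. of_real (1 - u) * f z + of_real u * g z))"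

text \<open>The boundary function of \<open>f\<close>: a representative of the limit of the dilates of \<open>f\<close> in the
  Lebesgue space of the circle. It is unique up to a null set, and coincides almost everywhere
  with the radial limit of \<open>f\<close>.\<close>

definition bdry :: "(complex \<Rightarrow> complex) \<Rightarrow> complex \<Rightarrow> complex" where
  "bdry f = (SOME g. g \<in> L2_circle \<and>
     ((\<lambda>r. \<integral>\<zeta>. (norm (f (of_real r * \<zeta>) - g \<zeta>))\<^sup>2 \<partial>circle_measure) \<longlongrightarrow> 0) (at_left (1::real)))"

definition H2_inner :: "(complex \<Rightarrow> complex) \<Rightarrow> (complex \<Rightarrow> complex) \<Rightarrow> complex" where
  "H2_inner f g = L2_inner (bdry f) (bdry g)"

definition H2_norm :: "(complex \<Rightarrow> complex) \<Rightarrow> real" where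
  "H2_norm f = sqrt (Re (H2_inner f f))"


section \<open>Toeplitz operators\<close>

definition P_plus :: "(complex \<Rightarrow> complex) \<Rightarrow> complex \<Rightarrow> complex" where
  "P_plus g = (THE h. h \<in> H2 \<and> (\<forall>k\<in>H2. L2_inner (\<lambda>\<zeta>. g \<zeta> - bdry h \<zeta>) (bdry k) = 0))"

definition toeplitz :: "(complex \<Rightarrow> complex) \<Rightarrow> (complex \<Rightarrow> complex) \<Rightarrow> complex \<Rightarrow> complex" where
  "toeplitz \<phi> f = P_plus (\<lambda>\<zeta>. \<phi> \<zeta> * bdry f \<zeta>)"


section \<open>De Branges--Rovnyak spaces\<close>

definition bounded_linear_H2 ::
  "((complex \<Rightarrow> complex) \<Rightarrow> (complex \<Rightarrow> complex)) \<Rightarrow> bool" where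
  "bounded_linear_H2 S \<longleftrightarrow> S ` H2 \<subseteq> H2 \<and>
     (\<forall>f\<in>H2. \<forall>g\<in>H2. \<forall>c d. S (\<lambda>z. c * f z + d * g z) = (\<lambda>z. c * S f z + d * S g z)) \<and>
     (\<exists>C. \<forall>f\<in>H2. H2_norm (S f) \<le> C * H2_norm f)"

definition positive_H2 ::
  "((complex \<Rightarrow> complex) \<Rightarrow> (complex \<Rightarrow> complex)) \<Rightarrow> bool" where
  "positive_H2 S \<longleftrightarrow> bounded_linear_H2 S \<and>
     (\<forall>f\<in>H2. Im (H2_inner (S f) f) = 0 \<and> 0 \<le> Re (H2_inner (S f) f))"

text \<open>The positive square root of a positive operator; extensionality makes it unique as a
  function on the whole type.\<close>

definition sqrt_H2 ::
  "((complex \<Rightarrow> complex) \<Rightarrow> (complex \<Rightarrow> complex)) \<Rightarrow> (complex \<Rightarrow> complex) \<Rightarrow> (complex \<Rightarrow> complex)"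
  where
  "sqrt_H2 A = (THE S. S \<in> extensional H2 \<and> positive_H2 S \<and> (\<forall>f\<in>H2. S (S f) = A f))"

definition defect_op ::
  "(complex \<Rightarrow> complex) \<Rightarrow> (complex \<Rightarrow> complex) \<Rightarrow> (complex \<Rightarrow> complex)" where
  "defect_op b = sqrt_H2
     (\<lambda>f z. f z - toeplitz (bdry b) (toeplitz (\<lambda>\<zeta>. cnj (bdry b \<zeta>)) f) z)"

definition dBR :: "(complex \<Rightarrow> complex) \<Rightarrow> (complex \<Rightarrow> complex) set" where
  "dBR b = defect_op b ` H2"

definition defect_ker_perp :: "(complex \<Rightarrow> complex) \<Rightarrow> (complex \<Rightarrow> complex) set" where
  "defect_ker_perp b = {f \<in> H2. \<forall>k\<in>H2. defect_op b k = (\<lambda>z. 0) \<longrightarrow> H2_inner f k = 0}"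

definition dBR_inner ::
  "(complex \<Rightarrow> complex) \<Rightarrow> (complex \<Rightarrow> complex) \<Rightarrow> (complex \<Rightarrow> complex) \<Rightarrow> complex" where
  "dBR_inner b u v = (THE c. \<exists>f\<in>defect_ker_perp b. \<exists>g\<in>defect_ker_perp b.
     u = defect_op b f \<and> v = defect_op b g \<and> c = H2_inner f g)"

definition dBR_norm :: "(complex \<Rightarrow> complex) \<Rightarrow> (complex \<Rightarrow> complex) \<Rightarrow> real" where
  "dBR_norm b u = sqrt (Re (dBR_inner b u u))"


section \<open>Generalized Abel means\<close>

definition taylor_sum :: "nat \<Rightarrow> (complex \<Rightarrow> complex) \<Rightarrow> complex \<Rightarrow> complex" where
  "taylor_sum n f z = (\<Sum>k\<le>n. (deriv ^^ k) f 0 / fact k * z ^ k)"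

definition abel_binom :: "real \<Rightarrow> nat \<Rightarrow> real" where
  "abel_binom \<alpha> n = Gamma (real n + \<alpha> + 1) / (Gamma (\<alpha> + 1) * fact n)"

definition abel_mean :: "real \<Rightarrow> real \<Rightarrow> (complex \<Rightarrow> complex) \<Rightarrow> complex \<Rightarrow> complex" where
  "abel_mean \<alpha> r f z = (if z \<in> ball 0 1
     then of_real ((1 - r) powr (1 + \<alpha>)) *
       (\<Sum>n. of_real (abel_binom \<alpha> n) * taylor_sum n f z * of_real (r ^ n))
     else 0)"

end

(* For non-extreme b = B b0 with B inner and b0, a outer of squared moduli summing to 1 on the circle,
   every test function k gives a functional u |-> <u, b k> of norm at most |a k| on H(b), while the
   kernel of the adjoint of multiplication by b lies isometrically in H(b).  Take a = (1 - z)/2,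
   b0 = (1 + z)/2 and the Frostman shift B = (2E - 1)/(2 - E) of E = exp(-(1 + z)/(1 - z)).  For
   k = (2 - E)/(1 - rz) and f = (1 - E(r)E)/((2 - E)(1 - rz)), which lies in that kernel, both b k and f are
   non-zero multiples of 1/(1 - rz), up to the factor 1 + z, plus terms carrying a factor E.  E is tiny near 1 on
   circles at distance comparable to 1 - r from the unit circle, and the multipliers of the Abel means of order
   alpha decay on this scale, so these terms are negligible and the pairing of the Abel mean of f with b k is of
   size 1/(1 - r).  But |f| is only of size (1 - r)^(-1/2) and |a k| is bounded: the Abel means are not uniformly
   bounded from that kernel to H(b), and the uniform boundedness principle provides f. *)

theory Submission
  imports Defs "HOL-Probability.Probability_Measure"
begin

section \<open>Operators on real Hilbert spaces\<close>

text \<open>The shift from E to B is forced. With B = E the function b k would itself carry the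
  factor E, and its pairing with a damped function would be as small as the error terms. B is -1/2
  where E is 0, so b k keeps a kernel as its main part, and the factor 2 - E in k cancels the
  denominator of B. The same factor divides f because division by 2 - E carries the orthogonal
  complement of E H^2 into that of B H^2; f is the image of the reproducing kernel at r of the
  former. The zero of a at 1 keeps a k bounded although k has size 1/(1 - r) near that point. On the
  kernel of the adjoint the norms of H(b) and H^2 agree, so uniform boundedness is applied to a
  closed subspace of H^2, and all pairings are computed there: if S is the square root of the defect
  operator and u = S g, then <u, b k> = <g, S (b k)>, where |g| is the norm of u in H(b). That Abel
  means lie in H(b) comes from the geometric decay of their coefficients, which puts them in the
  range of the coanalytic Toeplitz operator with symbol conj a. One and the same b serves every
  \<alpha>; only f depends on it.\<close>

lemma plus_minus_norm_ge:
  fixes u v :: "'a::real_normed_vector"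
  shows "norm v \<le> norm (u + v) \<or> norm v \<le> norm (u - v)"
proof (rule ccontr)
  assume "\<not> ?thesis"
  then have "norm (u + v) + norm (u - v) < 2 * norm v" by linarith
  moreover have "2 * norm v = norm ((u + v) - (u - v))"
    by (simp add: scaleR_2[symmetric] algebra_simps)
  ultimately show False using norm_triangle_ineq4[of "u + v" "u - v"] by linarith
qed

text \<open>Sokal's gliding hump: each step moves by \<open>\<plusminus>\<close> a vector of length \<open>1/4^n\<close> that nearly attains
  the norm of the \<open>n\<close>-th operator, with the sign chosen so that the value does not decrease.\<close>

theorem uniform_boundedness:
  fixes T :: "'i \<Rightarrow> 'a::banach \<Rightarrow> 'b::real_normed_vector"
  assumes lin: "\<And>i. bounded_linear (T i)" and K: "subspace K" "closed K"
    and bdd: "\<And>x. x \<in> K \<Longrightarrow> \<exists>B. \<forall>i. norm (T i x) \<le> B"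
  shows "\<exists>C. \<forall>i. \<forall>x\<in>K. norm (T i x) \<le> C * norm x"
proof (rule ccontr)
  assume neg: "\<not> ?thesis"
  define M where "M i = Sup ((\<lambda>x. norm (T i x)) ` {x\<in>K. norm x \<le> 1})" for i
  have zK: "0 \<in> K" using K by (simp add: subspace_0)
  have bddM: "bdd_above ((\<lambda>x. norm (T i x)) ` {x\<in>K. norm x \<le> 1})" for i
  proof -
    obtain B where B: "\<And>x. norm (T i x) \<le> norm x * B" "0 \<le> B"
      using bounded_linear.nonneg_bounded[OF lin[of i]] by blast
    show ?thesis
    proof (rule bdd_aboveI2[where M=B])
      fix x assume "x \<in> {x\<in>K. norm x \<le> 1}"
      then show "norm (T i x) \<le> B" using B mult_left_le_one_le[of B "norm x"] order_trans by fastforce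
    qed
  qed
  have M1: "norm (T i x) \<le> M i" if "x \<in> K" "norm x \<le> 1" for i x
    unfolding M_def by (rule cSUP_upper) (use that bddM in auto)
  have M0: "0 \<le> M i" for i by (rule order_trans[OF norm_ge_zero M1[OF zK]]) simp
  have M2: "norm (T i x) \<le> M i * norm x" if "x \<in> K" for i x
  proof (cases "x = 0")
    case True then show ?thesis using lin[of i] by (simp add: linear_0 bounded_linear.linear)
  next
    case False
    have "norm (T i (x /\<^sub>R norm x)) \<le> M i"
      by (rule M1) (use that K False in \<open>auto simp: subspace_scale\<close>)
    then have "norm (T i x) / norm x \<le> M i"
      by (simp only: linear_scale[OF bounded_linear.linear[OF lin]]) (simp add: divide_inverse_commute)
    then show ?thesis using False by (simp add: pos_divide_le_eq)
  qed
  have big: "\<exists>i. M i > B" for B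
    using neg M2 by (meson mult_right_mono norm_ge_zero not_le order_trans)
  have att: "\<exists>y\<in>K. norm y \<le> 1 \<and> norm (T i y) \<ge> (3/4) * M i" for i
  proof (cases "M i = 0")
    case True then show ?thesis using zK by (intro bexI[of _ 0]) auto
  next
    case False
    then have "(3/4) * M i < Sup ((\<lambda>x. norm (T i x)) ` {x\<in>K. norm x \<le> 1})"
      using M0[of i] unfolding M_def[symmetric] by simp
    moreover have "(\<lambda>x. norm (T i x)) ` {x\<in>K. norm x \<le> 1} \<noteq> {}" using zK by force
    ultimately have "\<exists>w\<in>(\<lambda>x. norm (T i x)) ` {x\<in>K. norm x \<le> 1}. (3/4) * M i < w"
      by (rule less_cSupD[rotated])
    then show ?thesis by (auto intro: less_imp_le)
  qed
  \<comment> \<open>The factor \<open>4 ^ n\<close> pays for the length \<open>(1/4) ^ n\<close> of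
    the n-th step; what remains grows like n.\<close>
  have "\<forall>n::nat. \<exists>i. M i > real n * 4 ^ n" using big by blast
  then obtain i where i: "\<And>n::nat. M (i n) > real n * 4 ^ n" by metis
  obtain y where y: "\<And>j. y j \<in> K" "\<And>j. norm (y j) \<le> 1" "\<And>j. norm (T j (y j)) \<ge> (3/4) * M j"
    using att by metis
  define v where "v n = (1/4)^n *\<^sub>R y (i n)" for n
  define x where "x = rec_nat 0 (\<lambda>n u. if norm (T (i n) (v n)) \<le> norm (T (i n) (u + v n)) then u + v n else u - v n)"
  have xS: "x (Suc n) = x n + v n \<or> x (Suc n) = x n - v n" for n by (simp add: x_def)
  have xT: "norm (T (i n) (x (Suc n))) \<ge> norm (T (i n) (v n))" for n
  proof -
    have "norm (T (i n) (v n)) \<le> norm (T (i n) (x n + v n)) \<or> norm (T (i n) (v n)) \<le> norm (T (i n) (x n - v n))"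
      using plus_minus_norm_ge[of "T (i n) (v n)" "T (i n) (x n)"] lin[of "i n"]
      by (simp add: linear_add linear_diff bounded_linear.linear)
    then show ?thesis unfolding x_def by auto
  qed
  have vK: "v n \<in> K" for n using y K by (simp add: v_def subspace_scale)
  have xK: "x n \<in> K" for n
  proof (induction n)
    case 0 show ?case using zK by (simp add: x_def)
  next
    case (Suc n) then show ?case using xS[of n] vK[of n] K by (auto simp: subspace_add subspace_diff)
  qed
  have nd: "norm (x (Suc n) - x n) \<le> (1/4)^n" for n
  proof -
    have "norm (x (Suc n) - x n) = norm (v n)" using xS[of n] by auto
    also have "\<dots> \<le> (1/4)^n" using y(2)[of "i n"] by (simp add: v_def)
    finally show ?thesis .
  qed
  have tel: "norm (x (n + k) - x n) \<le> (1/4)^n * (4/3)" for n k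
  proof -
    have "norm (x (n + k) - x n) \<le> (1/4)^n * (4/3) - (1/4)^(n+k) * (4/3)"
    proof (induction k)
      case (Suc k)
      have "norm (x (n + Suc k) - x n) \<le> norm (x (Suc (n + k)) - x (n+k)) + norm (x (n + k) - x n)"
        using norm_triangle_ineq[of "x (Suc (n + k)) - x (n+k)" "x (n + k) - x n"] by simp
      then show ?case using Suc nd[of "n+k"] by simp
    qed simp
    also have "\<dots> \<le> (1/4)^n * (4/3)" by simp
    finally show ?thesis .
  qed
  have "Cauchy x"
  proof (rule metric_CauchyI)
    fix e :: real assume e: "e > 0"
    obtain N where N: "(1/4)^N < e / 4" using real_arch_pow_inv[of "e/4" "1/4::real"] e by auto
    have "dist (x m) (x n) < e" if "m \<ge> N" "n \<ge> N" for m n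
    proof -
      have "dist (x m) (x N) \<le> (1/4)^N * (4/3)" "dist (x n) (x N) \<le> (1/4)^N * (4/3)"
        using tel[of N "m - N"] tel[of N "n - N"] that by (auto simp: dist_norm)
      then show ?thesis using N e dist_triangle2[of "x m" "x n" "x N"] by argo
    qed
    then show "\<exists>M. \<forall>m\<ge>M. \<forall>n\<ge>M. dist (x m) (x n) < e" by blast
  qed
  then obtain l where l: "x \<longlonglongrightarrow> l" using Cauchy_convergent convergent_def by blast
  have lK: "l \<in> K" using closed_sequentially[OF K(2)] xK l by blast
  have ln: "norm (l - x n) \<le> (1/4)^n * (4/3)" for n
  proof (rule Lim_norm_ubound[OF sequentially_bot])
    show "(\<lambda>k. x (n + k) - x n) \<longlonglongrightarrow> l - x n"
      using LIMSEQ_ignore_initial_segment[OF l, of n] by (intro tendsto_intros) (simp add: add.commute)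
    show "\<forall>\<^sub>F k in sequentially. norm (x (n + k) - x n) \<le> (1 / 4) ^ n * (4 / 3)" using tel by simp
  qed
  \<comment> \<open>The step contributes 3/4 and all later steps remove at most 1/4 times 4/3, both
    in units of \<open>(1/4) ^ n * M (i n)\<close>: 3/4 - 1/3 = 5/12.\<close>
  have low: "norm (T (i n) l) \<ge> real n * (5/12)" for n
  proof -
    have a: "norm (T (i n) (v n)) \<ge> (1/4)^n * ((3/4) * M (i n))"
      unfolding v_def linear_scale[OF bounded_linear.linear[OF lin]] norm_scaleR
      using y(3)[of "i n"] by (simp add: mult_left_mono)
    have b: "norm (T (i n) (l - x (Suc n))) \<le> M (i n) * ((1/4)^Suc n * (4/3))"
      using M2[of "l - x (Suc n)" "i n"] ln[of "Suc n"] K lK xK[of "Suc n"] M0[of "i n"]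
      by (meson mult_left_mono order_trans subspace_diff)
    have "T (i n) l = T (i n) (x (Suc n)) + T (i n) (l - x (Suc n))"
      using lin[of "i n"] by (simp add: linear_diff bounded_linear.linear)
    then have "norm (T (i n) l) \<ge> norm (T (i n) (x (Suc n))) - norm (T (i n) (l - x (Suc n)))"
      using norm_triangle_ineq4[of "T (i n) l" "T (i n) (l - x (Suc n))"] by simp
    then have "norm (T (i n) l) \<ge> (1/4)^n * M (i n) * (5/12)" using a b xT[of n] by (simp add: mult.commute[of "M (i n)"])
    moreover have "(1/4)^n * M (i n) \<ge> real n" using i[of n] by (simp add: field_simps power_divide)
    ultimately show ?thesis by linarith
  qed
  obtain B where B: "\<And>j. norm (T j l) \<le> B" using bdd[OF lK] by blast
  obtain n :: nat where "real n > B * (12/5)" using reals_Archimedean2 by blast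
  then show False using low[of n] B[of "i n"] by linarith
qed

text \<open>The vector is the limit of a minimizing sequence for \<open>\<parallel>S x\<parallel>\<^sup>2 - 2 L x\<close>. For \<open>S\<close> the identity this
  is the Riesz representation theorem, in general it is Douglas' range inclusion lemma.\<close>

theorem bounded_functional_range:
  fixes S :: "'c::real_vector \<Rightarrow> 'a::{real_inner, banach}" and L :: "'c \<Rightarrow> real"
  assumes S: "linear S" and L: "linear L" and bd: "\<And>x. \<bar>L x\<bar> \<le> C * norm (S x)"
  shows "\<exists>g. \<forall>x. L x = inner (S x) g"
proof -
  define F where "F x = (norm (S x))\<^sup>2 - 2 * L x" for x
  have lowb: "F x \<ge> - C\<^sup>2" for x
  proof -
    have "F x \<ge> (norm (S x))\<^sup>2 - 2 * (C * norm (S x))" using bd[of x] unfolding F_def by linarith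
    moreover have "(norm (S x) - C)\<^sup>2 \<ge> 0" by simp
    ultimately show ?thesis by (simp add: power2_eq_square algebra_simps)
  qed
  define m where "m = Inf (range F)"
  have bb: "bdd_below (range F)" using lowb by (auto intro!: bdd_belowI2)
  have mF: "m \<le> F x" for x unfolding m_def by (rule cINF_lower[OF bb]) simp
  have "\<exists>x. F x < m + 1 / real (Suc n)" for n
    using cInf_less_iff[OF _ bb, of "m + 1 / real (Suc n)"] unfolding m_def by auto
  then obtain x where x: "\<And>n. F (x n) < m + 1 / real (Suc n)" by metis
  note Sl = linear_add[OF S] linear_diff[OF S] linear_scale[OF S]
  note Ll = linear_add[OF L] linear_diff[OF L] linear_scale[OF L]
  \<comment> \<open>Parallelogram law: the linear terms cancel, so two values of F close to the
    infimum force \<open>S u\<close> and \<open>S v\<close> to be close, whether or not u and v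
    are.\<close>
  have par: "(norm (S u - S v))\<^sup>2 = 2 * F u + 2 * F v - 4 * F ((1/2) *\<^sub>R (u + v))" for u v
    unfolding F_def by (simp add: Sl Ll power2_norm_eq_inner inner_add_left inner_add_right inner_diff_left
        inner_diff_right inner_commute algebra_simps)
  have "Cauchy (\<lambda>n. S (x n))"
  proof (rule metric_CauchyI)
    fix e :: real assume e: "e > 0"
    obtain N :: nat where N: "N > 4 / e\<^sup>2" using reals_Archimedean2 by blast
    have N0: "real N > 0" using N e by (smt (verit) divide_pos_pos zero_less_power)
    have "dist (S (x p)) (S (x q)) < e" if "p \<ge> N" "q \<ge> N" for p q
    proof -
      have "(norm (S (x p) - S (x q)))\<^sup>2 < 2 * (1 / real (Suc p)) + 2 * (1 / real (Suc q))"
        using par[of "x p" "x q"] x[of p] x[of q] mF[of "(1/2) *\<^sub>R (x p + x q)"] by linarith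
      also have "1 / real (Suc p) \<le> 1 / real N" using that N0 by (intro divide_left_mono) auto
      also have "1 / real (Suc q) \<le> 1 / real N" using that N0 by (intro divide_left_mono) auto
      also have "2 * (1 / real N) + 2 * (1 / real N) < e\<^sup>2" using N N0 e by (simp add: field_simps)
      finally show ?thesis using e by (simp add: dist_norm power2_less_imp_less)
    qed
    then show "\<exists>M. \<forall>m\<ge>M. \<forall>n\<ge>M. dist (S (x m)) (S (x n)) < e" by blast
  qed
  then obtain g where g: "(\<lambda>n. S (x n)) \<longlonglongrightarrow> g" using Cauchy_convergent convergent_def by blast
  have "L z = inner (S z) g" for z
  proof -
    \<comment> \<open>First variation at the limit: a quadratic in t that is nonnegative for all t
      and has no constant term has no linear term either.\<close>
    have q: "2 * t * (inner (S z) g - L z) + t\<^sup>2 * (norm (S z))\<^sup>2 \<ge> 0" for t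
    proof (rule LIMSEQ_le_const)
      show "(\<lambda>n. 1 / real (Suc n) + 2 * t * (inner (S z) (S (x n)) - L z) + t\<^sup>2 * (norm (S z))\<^sup>2)
          \<longlonglongrightarrow> 2 * t * (inner (S z) g - L z) + t\<^sup>2 * (norm (S z))\<^sup>2"
      proof -
        have "(\<lambda>n. 1 / real (Suc n) + 2 * t * (inner (S z) (S (x n)) - L z) + t\<^sup>2 * (norm (S z))\<^sup>2)
          \<longlonglongrightarrow> 0 + 2 * t * (inner (S z) g - L z) + t\<^sup>2 * (norm (S z))\<^sup>2"
          by (intro tendsto_intros g LIMSEQ_Suc[OF lim_1_over_n])
        then show ?thesis by simp
      qed
      have "0 \<le> 1 / real (Suc n) + 2 * t * (inner (S z) (S (x n)) - L z) + t\<^sup>2 * (norm (S z))\<^sup>2" for n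
      proof -
        have "F (x n + t *\<^sub>R z) = F (x n) + 2 * t * (inner (S z) (S (x n)) - L z) + t\<^sup>2 * (norm (S z))\<^sup>2"
          unfolding F_def power2_norm_eq_inner power2_eq_square[of t]
          by (simp add: Sl Ll inner_add_left inner_add_right inner_commute algebra_simps)
        then show ?thesis using mF[of "x n + t *\<^sub>R z"] x[of n] by linarith
      qed
      then show "\<exists>N. \<forall>n\<ge>N. 0 \<le> 1 / real (Suc n) + 2 * t * (inner (S z) (S (x n)) - L z) + t\<^sup>2 * (norm (S z))\<^sup>2"
        by blast
    qed
    show ?thesis
    proof (rule ccontr)
      assume ne: "L z \<noteq> inner (S z) g"
      define d where "d = inner (S z) g - L z"
      define c where "c = (norm (S z))\<^sup>2 + 1"
      have c: "c \<ge> 1" and d: "d \<noteq> 0" using ne by (auto simp: c_def d_def)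
      have "2 * (-d/c) * d + (-d/c)\<^sup>2 * (c - 1) \<ge> 0" using q[of "-d/c"] by (simp add: c_def d_def)
      moreover have "2 * (-d/c) * d + (-d/c)\<^sup>2 * (c - 1) = - (d\<^sup>2 / c) - d\<^sup>2 / c\<^sup>2"
        using c by (simp add: field_simps power2_eq_square)
      moreover have "d\<^sup>2 / c > 0" "d\<^sup>2 / c\<^sup>2 > 0" using c d by auto
      ultimately show False by linarith
    qed
  qed
  then show ?thesis by blast
qed

section \<open>Positive operators and their square roots over the reals\<close>

definition symm :: "('a::real_inner \<Rightarrow> 'a) \<Rightarrow> bool" where
  "symm S \<longleftrightarrow> (\<forall>x y. inner (S x) y = inner x (S y))"

definition psd :: "('a::real_inner \<Rightarrow> 'a) \<Rightarrow> bool" where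
  "psd S \<longleftrightarrow> symm S \<and> (\<forall>x. 0 \<le> inner (S x) x)"

text \<open>The quadratic form of S at y + t S y is a nonnegative polynomial in t without constant
  term, and its linear coefficient is 2 |S y|^2.\<close>

lemma psd_inner_eq_0:
  assumes "psd S" "linear S" "inner (S y) y = 0"
  shows "S y = 0"
proof -
  define a where "a = inner (S y) (S y)"
  define c where "c = inner (S (S y)) (S y)"
  have sy: "inner (S (S y)) y = a" using assms(1) by (simp add: psd_def symm_def a_def)
  have "0 \<le> 2 * t * a + t\<^sup>2 * c" for t
  proof -
    have "0 \<le> inner (S (y + t *\<^sub>R S y)) (y + t *\<^sub>R S y)" using assms(1) by (simp add: psd_def)
    also have "\<dots> = 2 * t * a + t\<^sup>2 * c"
      using assms(3) sy by (simp add: linear_add[OF assms(2)] linear_scale[OF assms(2)] inner_add_left inner_add_right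
          a_def c_def power2_eq_square algebra_simps)
    finally show ?thesis .
  qed
  \<comment> \<open>The natural choice \<open>- a / c\<close> fails for \<open>c = 0\<close>; with
    \<open>c + 1\<close> the value is still negative unless \<open>a = 0\<close>.\<close>
  from this[of "- a / (c + 1)"] have h: "0 \<le> 2 * (- a / (c + 1)) * a + (- a / (c + 1))\<^sup>2 * c" .
  have c: "c \<ge> 0" using assms(1) by (simp add: psd_def c_def)
  have "2 * (- a / (c + 1)) * a + (- a / (c + 1))\<^sup>2 * c = - (a\<^sup>2 / (c+1)) - a\<^sup>2 / (c+1)\<^sup>2"
  proof -
    have "(- a / (c + 1))\<^sup>2 * c = (a\<^sup>2 / (c+1)\<^sup>2) * ((c + 1) - 1)" by (simp add: power_divide)
    also have "\<dots> = a\<^sup>2 / (c+1) - a\<^sup>2 / (c+1)\<^sup>2"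
      using c by (subst right_diff_distrib) (simp add: power2_eq_square)
    finally show ?thesis by (simp add: power2_eq_square)
  qed
  moreover have "a\<^sup>2 / (c+1) \<ge> 0" "a\<^sup>2 / (c+1)\<^sup>2 \<ge> 0" using c by auto
  ultimately have "a\<^sup>2 / (c+1) = 0" using h by linarith
  then have "a = 0" using c by simp
  then show ?thesis by (simp add: a_def)
qed

text \<open>The iteration \<open>X \<leftarrow> (T + X\<^sup>2)/2\<close> is dominated in norm by its scalar version with \<open>T = 1\<close>, and its limit
  solves \<open>(1 - X)\<^sup>2 = 1 - T\<close>.\<close>

theorem psd_sqrt_exists:
  fixes T :: "'a::{real_inner, banach} \<Rightarrow>\<^sub>L 'a"
  assumes sym: "symm T" and nT: "norm T \<le> 1"
  shows "\<exists>S :: 'a \<Rightarrow>\<^sub>L 'a. psd S \<and> (\<forall>x. S (S x) = x - T x) \<and>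
    (\<forall>R :: 'a \<Rightarrow> 'a. bounded_linear R \<longrightarrow> (\<forall>x. R (T x) = T (R x)) \<longrightarrow> (\<forall>x. R (S x) = S (R x)))"
proof -
  define X where "X = rec_nat (0 :: 'a \<Rightarrow>\<^sub>L 'a) (\<lambda>n Y. (1/2) *\<^sub>R (T + (Y o\<^sub>L Y)))"
  have X0: "X 0 = 0" and XS: "X (Suc n) = (1/2) *\<^sub>R (T + (X n o\<^sub>L X n))" for n by (simp_all add: X_def)
  define p where "p = rec_nat (0::real) (\<lambda>n y. (1 + y\<^sup>2) / 2)"
  have p0: "p 0 = 0" and pS: "p (Suc n) = (1 + (p n)\<^sup>2) / 2" for n by (simp_all add: p_def)
  have p01: "0 \<le> p n \<and> p n \<le> 1" for n
    by (induction n) (auto simp: p0 pS power_le_one)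
  have XP: "norm (X n) \<le> p n" for n
  proof (induction n)
    case (Suc n)
    have "norm (X (Suc n)) \<le> (norm T + norm (X n o\<^sub>L X n)) / 2"
      unfolding XS using norm_triangle_ineq[of T "X n o\<^sub>L X n"] by simp
    also have "norm (X n o\<^sub>L X n) \<le> p n * p n"
      by (rule order_trans[OF norm_blinfun_compose mult_mono]) (use Suc p01[of n] in simp_all)
    finally show ?case using nT by (simp add: pS power2_eq_square)
  qed (simp add: X0 p0)
  \<comment> \<open>The scalar sequence is increasing and bounded, so its increments are summable;
    domination of the increments, not only of the iterates, makes X converge in operator
    norm.\<close>
  have Xd: "norm (X (Suc n) - X n) \<le> p (Suc n) - p n" for n
  proof (induction n)
    case 0 show ?case using XP[of 1] by (simp add: X0 p0)
  next
    case (Suc n)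
    define D where "D = X (Suc n) - X n"
    \<comment> \<open>A difference of squares factored without commutation: U^2 - V^2 = U (U - V) +
      (U - V) V.\<close>
    have "X (Suc (Suc n)) - X (Suc n) = (1/2) *\<^sub>R ((X (Suc n) o\<^sub>L D) + (D o\<^sub>L X n))"
      unfolding XS[of "Suc n"] XS[of n] D_def
      by (rule blinfun_eqI) (simp add: XS blinfun.bilinear_simps algebra_simps)
    then have "norm (X (Suc (Suc n)) - X (Suc n)) \<le> (norm (X (Suc n) o\<^sub>L D) + norm (D o\<^sub>L X n)) / 2"
      using norm_triangle_ineq[of "X (Suc n) o\<^sub>L D" "D o\<^sub>L X n"] by simp
    also have "norm (X (Suc n) o\<^sub>L D) \<le> p (Suc n) * (p (Suc n) - p n)"
      by (rule order_trans[OF norm_blinfun_compose mult_mono]) (use Suc XP[of "Suc n"] p01[of "Suc n"] in \<open>simp_all add: D_def\<close>)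
    also have "norm (D o\<^sub>L X n) \<le> (p (Suc n) - p n) * p n"
    proof (rule order_trans[OF norm_blinfun_compose mult_mono])
      show "norm D \<le> p (Suc n) - p n" using Suc by (simp add: D_def)
      then show "0 \<le> p (Suc n) - p n" using norm_ge_zero[of D] by linarith
    qed (use XP in auto)
    also have "(p (Suc n) * (p (Suc n) - p n) + (p (Suc n) - p n) * p n) / 2 = p (Suc (Suc n)) - p (Suc n)"
      unfolding pS[of "Suc n"] pS[of n] by (simp add: pS power2_eq_square field_simps)
    finally show ?case by simp
  qed
  have pm: "p n \<le> p (Suc n)" for n using Xd[of n] norm_ge_zero[of "X (Suc n) - X n"] by linarith
  have "convergent p"
    using Bseq_monoseq_convergent[of p] p01 pm
    by (metis BseqI' abs_le_iff abs_of_nonneg incseq_SucI incseq_def monoI1 real_norm_def)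
  then have "summable (\<lambda>n. p (Suc n) - p n)"
    using telescope_summable convergent_def by blast
  then have "summable (\<lambda>n. X (Suc n) - X n)"
    by (rule summable_comparison_test'[where N=0]) (use Xd in auto)
  then obtain s where "(\<lambda>n. X (Suc n) - X n) sums s" by (auto simp: summable_def)
  then have "(\<lambda>n. \<Sum>k<n. X (Suc k) - X k) \<longlonglongrightarrow> s" by (simp add: sums_def)
  then have Xl: "X \<longlonglongrightarrow> s" by (simp add: sum_lessThan_telescope X0)
  have fp: "s = (1/2) *\<^sub>R (T + (s o\<^sub>L s))"
  proof (rule LIMSEQ_unique)
    show "(\<lambda>n. X (Suc n)) \<longlonglongrightarrow> s" using Xl by (rule LIMSEQ_Suc)
    show "(\<lambda>n. X (Suc n)) \<longlonglongrightarrow> (1/2) *\<^sub>R (T + (s o\<^sub>L s))"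
      unfolding XS by (intro tendsto_intros bounded_bilinear.tendsto[OF bounded_bilinear_blinfun_compose] Xl)
  qed
  have Xa: "(\<lambda>n. X n x) \<longlonglongrightarrow> s x" for x by (intro blinfun.tendsto Xl tendsto_const)
  have ns: "norm s \<le> 1"
    by (rule LIMSEQ_le_const2[OF tendsto_norm[OF Xl]]) (use XP p01 order_trans in blast)
  have symX: "symm (X n)" for n
  proof (induction n)
    case (Suc n) then show ?case using sym
      by (simp add: symm_def XS blinfun.bilinear_simps inner_add_left inner_add_right)
  qed (simp add: X0 symm_def)
  have syms: "symm s" unfolding symm_def
  proof (intro allI)
    fix x y
    have "(\<lambda>n. inner (X n x) y) \<longlonglongrightarrow> inner (s x) y" by (intro tendsto_intros Xa)
    moreover have "(\<lambda>n. inner (X n x) y) \<longlonglongrightarrow> inner x (s y)"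
      using symX by (simp add: symm_def) (intro tendsto_intros Xa)
    ultimately show "inner (s x) y = inner x (s y)" by (rule LIMSEQ_unique)
  qed
  define S where "S = id_blinfun - s"
  have Sx: "S x = x - s x" for x by (simp add: S_def blinfun.bilinear_simps)
  have "psd S"
  proof -
    have "inner (s x) x \<le> inner x x" for x
    proof -
      have "inner (s x) x \<le> norm (s x) * norm x" by (rule norm_cauchy_schwarz)
      also have "\<dots> \<le> 1 * norm x * norm x"
        by (intro mult_right_mono order_trans[OF norm_blinfun]) (use ns in auto)
      finally show ?thesis by (simp add: power2_norm_eq_inner[symmetric] power2_eq_square)
    qed
    then show ?thesis using syms by (auto simp: psd_def symm_def Sx inner_diff_left inner_diff_right)
  qed
  moreover have "S (S x) = x - T x" for x
  proof -
    have "s x = (1/2) *\<^sub>R (T x + s (s x))"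
      using arg_cong[OF fp, of "\<lambda>f. blinfun_apply f x"] by (simp add: blinfun.bilinear_simps)
    then have "2 *\<^sub>R s x = 2 *\<^sub>R ((1/2) *\<^sub>R (T x + s (s x)))" by (rule arg_cong)
    then have "s x + s x = T x + s (s x)" by (simp add: scaleR_2)
    then show ?thesis by (simp add: Sx blinfun.bilinear_simps algebra_simps)
  qed
  \<comment> \<open>Every iterate is a polynomial in T. With R the multiplication by i this makes
    the root complex linear; with R a second root it gives uniqueness.\<close>
  moreover have "R (S x) = S (R x)" if R: "bounded_linear R" and c: "\<And>x. R (T x) = T (R x)" for R :: "'a \<Rightarrow> 'a" and x
  proof -
    note Rl = linear_add[OF bounded_linear.linear[OF R]] linear_diff[OF bounded_linear.linear[OF R]] linear_scale[OF bounded_linear.linear[OF R]]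
    have cX: "R (X n x) = X n (R x)" for n x
    proof (induction n arbitrary: x)
      case 0 show ?case by (simp add: X0 linear_0[OF bounded_linear.linear[OF R]])
    next
      case (Suc n) then show ?case by (simp add: XS blinfun.bilinear_simps Rl c)
    qed
    have "R (s x) = s (R x)"
    proof (rule LIMSEQ_unique)
      show "(\<lambda>n. R (X n x)) \<longlonglongrightarrow> R (s x)" by (intro bounded_linear.tendsto[OF R] Xa)
      show "(\<lambda>n. R (X n x)) \<longlonglongrightarrow> s (R x)" unfolding cX by (rule Xa)
    qed
    then show ?thesis by (simp add: Sx Rl)
  qed
  ultimately show ?thesis by blast
qed

text \<open>For y = S x - S' x the difference of squares gives (S + S') y = 0. Positivity splits
  this into S y = S' y = 0, and then |y|^2 = <x, S y - S' y> = 0.\<close>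

lemma psd_sqrt_unique:
  assumes S: "psd S" "linear S" and S': "psd S'" "linear S'"
    and sq: "\<And>x. S (S x) = S' (S' x)" and comm: "\<And>x. S (S' x) = S' (S x)"
  shows "S = S'"
proof
  fix x
  note l = linear_diff[OF S(2)] linear_diff[OF S'(2)]
  define y where "y = S x - S' x"
  have "S y + S' y = 0" by (simp add: y_def l sq comm)
  then have "inner (S y) y + inner (S' y) y = 0" by (metis inner_add_left inner_zero_left)
  moreover have "inner (S y) y \<ge> 0" "inner (S' y) y \<ge> 0" using S S' by (auto simp: psd_def)
  ultimately have z: "inner (S y) y = 0" "inner (S' y) y = 0" by linarith+
  have "S y = 0" "S' y = 0" using psd_inner_eq_0 S S' z by blast+
  then have "inner y y = 0"
    using S(1) S'(1) unfolding y_def psd_def symm_def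
    by (metis inner_diff_left inner_zero_right diff_self)
  then show "S x = S' x" by (simp add: y_def)
qed

section \<open>Square integrable functions on the circle\<close>

abbreviation sqint :: "(complex \<Rightarrow> complex) \<Rightarrow> real" where
  "sqint f \<equiv> \<integral>\<zeta>. (norm (f \<zeta>))\<^sup>2 \<partial>circle_measure"

lemma circle_measure_measurable [measurable_cong, simp]: "sets circle_measure = sets borel"
  by (simp add: circle_measure_def)

lemma space_circle_measure [simp]: "space circle_measure = UNIV"
  by (simp add: circle_measure_def)

lemma borel_measurable_cis [measurable]: "cis \<in> borel_measurable borel"
  by (intro borel_measurable_continuous_onI continuous_intros)

lemma borel_measurable_cnj [measurable]: "cnj \<in> borel_measurable borel"
  by (intro borel_measurable_continuous_onI continuous_intros)

lemma emeasure_Icc_2pi: "emeasure lborel {0..2 * pi} = ennreal (2 * pi)"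
  by simp

interpretation uniform_2pi: prob_space "uniform_measure lborel {0..2 * pi}"
  by (rule prob_space_uniform_measure) (auto simp: emeasure_Icc_2pi)

interpretation circle: prob_space circle_measure
  unfolding circle_measure_def by (rule uniform_2pi.prob_space_distr) simp

lemma AE_circle_measure:
  assumes "Measurable.pred borel P" "AE t in lborel. t \<in> {0..2 * pi} \<longrightarrow> P (cis t)"
  shows "AE \<zeta> in circle_measure. P \<zeta>"
proof -
  have "AE t in uniform_measure lborel {0..2 * pi}. P (cis t)"
    by (rule AE_uniform_measureI) (use assms in auto)
  then show ?thesis
    unfolding circle_measure_def by (subst AE_distr_iff) (use assms in auto)
qed

lemma AE_circle_norm: "AE \<zeta> in circle_measure. norm \<zeta> = 1"
  by (rule AE_circle_measure) auto

text \<open>The preimage of a point under \<open>cis\<close> is countable. The case w = 1 discards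
  the only singularity of \<open>Ei\<close> on the circle.\<close>

lemma AE_circle_ne: "AE \<zeta> in circle_measure. \<zeta> \<noteq> w"
proof (rule AE_circle_measure)
  have "countable {t. cis t = w}"
  proof (cases "{t. cis t = w} = {}")
    case False
    then obtain t0 where t0: "cis t0 = w" by blast
    have "{t. cis t = w} \<subseteq> (\<Union>k::int. {t0 + of_int k * (2 * pi)})"
    proof
      fix t assume "t \<in> {t. cis t = w}"
      then have "exp (\<i> * of_real t) = exp (\<i> * of_real t0)" using t0 by (simp add: cis_conv_exp)
      then obtain k :: int where "\<i> * of_real t = \<i> * of_real t0 + (of_int (2 * k) * pi) * \<i>"
        by (auto simp: exp_eq)
      then have "Im (\<i> * of_real t) = Im (\<i> * of_real t0 + (of_int (2 * k) * pi) * \<i>)" by simp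
      then show "t \<in> (\<Union>k::int. {t0 + of_int k * (2 * pi)})" by (auto simp: mult_ac)
    qed
    then show ?thesis by (rule countable_subset) auto
  qed simp
  then have "AE t in lborel. t \<notin> {t. cis t = w}"
    by (intro AE_not_in countable_imp_null_set_lborel)
  then show "AE t in lborel. t \<in> {0..2 * pi} \<longrightarrow> cis t \<noteq> w" by eventually_elim auto
qed simp

lemma integral_circle_eq:
  fixes f :: "complex \<Rightarrow> complex"
  assumes [measurable]: "f \<in> borel_measurable borel"
  shows "integral\<^sup>L circle_measure f = (LINT t|uniform_measure lborel {0..2 * pi}. f (cis t))"
  unfolding circle_measure_def by (subst integral_distr) auto

lemma integral_uniform_2pi:
  fixes f :: "real \<Rightarrow> complex"
  assumes [measurable]: "f \<in> borel_measurable borel"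
  shows "integral\<^sup>L (uniform_measure lborel {0..2 * pi}) f = (LINT t:{0..2*pi}|lborel. f t) / (2 * pi)"
proof -
  have "uniform_measure lborel {0..2 * pi} = density lborel (\<lambda>x. ennreal (indicator {0..2 * pi} x / (2 * pi)))"
    unfolding uniform_measure_def
    by (rule arg_cong[where f="density lborel"]) (auto simp: indicator_def divide_ennreal emeasure_Icc_2pi ennreal_divide_numeral intro!: ext simp flip: ennreal_1)
  then show ?thesis
    by (simp add: integral_density set_lebesgue_integral_def mult.commute flip: integral_divide_zero)
       (rule Bochner_Integration.integral_cong, auto simp: indicator_def scaleR_conv_of_real)
qed

lemma integral_circle_power:
  "(\<integral>\<zeta>. \<zeta> ^ n * cnj (\<zeta> ^ m) \<partial>circle_measure) = (if n = m then 1 else 0)"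
proof -
  define k where "k = real n - real m"
  have c: "cis t ^ n * cnj (cis t ^ m) = cis (k * t)" for t
    by (simp only: k_def Complex.DeMoivre cis_mult cis_cnj left_diff_distrib add_uminus_conv_diff)
  have "(\<integral>\<zeta>. \<zeta> ^ n * cnj (\<zeta> ^ m) \<partial>circle_measure) = (LINT t:{0..2*pi}|lborel. cis (k * t)) / (2 * pi)"
  proof -
    have "(\<integral>\<zeta>. \<zeta> ^ n * cnj (\<zeta> ^ m) \<partial>circle_measure) = (LINT t|uniform_measure lborel {0..2 * pi}. cis t ^ n * cnj (cis t ^ m))"
      by (rule integral_circle_eq) (intro borel_measurable_continuous_onI continuous_intros)
    also have "\<dots> = (LINT t|uniform_measure lborel {0..2 * pi}. cis (k * t))" by (simp only: c)
    also have "\<dots> = (LINT t:{0..2*pi}|lborel. cis (k * t)) / (2 * pi)"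
      by (rule integral_uniform_2pi) (intro borel_measurable_continuous_onI continuous_intros)
    finally show ?thesis .
  qed
  also have "\<dots> = (if n = m then 1 else 0)"
  proof (cases "n = m")
    case True
    then show ?thesis by (simp add: k_def set_lebesgue_integral_def scaleR_conv_of_real)
  next
    case False
    then have k: "k \<noteq> 0" by (simp add: k_def)
    have "((\<lambda>t. cis (k * t) / (\<i> * k)) has_vector_derivative cis (k * t)) (at t within {0..2*pi})" for t
    proof -
      have "((\<lambda>z. exp (\<i> * (of_real k * z)) / (\<i> * of_real k)) has_field_derivative exp (\<i> * (of_real k * of_real t))) (at (of_real t))"
        using k by (auto intro!: derivative_eq_intros simp: algebra_simps)
      then have "((\<lambda>t. exp (\<i> * (of_real k * of_real t)) / (\<i> * of_real k)) has_vector_derivative exp (\<i> * (of_real k * of_real t))) (at t within {0..2*pi})"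
        by (rule has_vector_derivative_real_field)
      then show ?thesis by (simp add: cis_conv_exp)
    qed
    then have "(LINT t:{0..2*pi}|lborel. cis (k * t)) = cis (k * (2*pi)) / (\<i> * k) - cis (k * 0) / (\<i> * k)"
      unfolding set_lebesgue_integral_def
      by (intro integral_FTC_Icc[where F="\<lambda>t. cis (k * t) / (\<i> * k)"]) (auto intro!: continuous_intros)
    also have "cis (k * (2 * pi)) = 1"
      using cis_multiple_2pi[of k] by (simp add: k_def mult.commute)
    finally show ?thesis using False by simp
  qed
  finally show ?thesis .
qed


section \<open>Power series on the unit disk\<close>

definition coef :: "(complex \<Rightarrow> complex) \<Rightarrow> nat \<Rightarrow> complex" where
  "coef f n = (deriv ^^ n) f 0 / fact n"

definition disk_holo :: "(complex \<Rightarrow> complex) \<Rightarrow> bool" where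
  "disk_holo f \<longleftrightarrow> f holomorphic_on ball 0 1 \<and> (\<forall>z. z \<notin> ball 0 1 \<longrightarrow> f z = 0)"

lemma coef_sums: "f holomorphic_on ball 0 1 \<Longrightarrow> norm z < 1 \<Longrightarrow> (\<lambda>n. coef f n * z ^ n) sums f z"
  using holomorphic_power_series[of f 0 1 z] by (simp add: coef_def)

lemma measurable_disk [measurable (raw)]:
  assumes "disk_holo f" shows "f \<in> borel_measurable borel"
proof -
  have "(\<lambda>x. indicator (ball 0 1) x *\<^sub>R f x) \<in> borel_measurable borel"
    using assms by (intro borel_measurable_continuous_on_indicator) (auto simp: disk_holo_def holomorphic_on_imp_continuous_on)
  also have "(\<lambda>x. indicator (ball 0 1) x *\<^sub>R f x) = f"
    using assms by (auto simp: disk_holo_def indicator_def fun_eq_iff)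
  finally show ?thesis .
qed

lemma powser_norm_summable:
  fixes a :: "nat \<Rightarrow> complex" and z :: complex
  assumes "\<And>z. norm z < 1 \<Longrightarrow> (\<lambda>n. a n * z ^ n) sums f z" "norm z < 1"
  shows "summable (\<lambda>n. norm (a n) * norm z ^ n)"
proof -
  \<comment> \<open>A point of modulus strictly between that of z and 1: convergence there gives
    absolute convergence at z.\<close>
  define w where "w = complex_of_real ((1 + norm z) / 2)"
  have "norm w = (1 + norm z) / 2" unfolding w_def norm_of_real by (rule abs_of_nonneg) simp
  then have w: "norm w < 1" "norm z < norm w" using assms(2) by auto
  show ?thesis
    using powser_insidea[OF sums_summable[OF assms(1)[OF w(1)]] w(2)] by (simp add: norm_mult norm_power)
qed

lemma integral_cnj_powser:
  fixes b :: "nat \<Rightarrow> complex"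
  assumes h: "integrable circle_measure h"
    and g: "\<And>z. norm z < 1 \<Longrightarrow> (\<lambda>n. b n * z ^ n) sums g z" and [measurable]: "g \<in> borel_measurable borel"
    and s: "0 \<le> s" "s < 1"
  shows "(\<lambda>n. cnj (b n) * s ^ n * (\<integral>\<zeta>. h \<zeta> * cnj (\<zeta> ^ n) \<partial>circle_measure)) sums
     (\<integral>\<zeta>. h \<zeta> * cnj (g (of_real s * \<zeta>)) \<partial>circle_measure)"
proof -
  have hm [measurable]: "h \<in> borel_measurable borel"
    using borel_measurable_integrable[OF h] by (simp add: measurable_cong_sets[OF circle_measure_measurable refl])
  \<comment> \<open>Normalizing \<zeta> changes nothing almost everywhere on the circle and makes
    the bound by \<open>s ^ n\<close> hold at every point; at 0 the quotient is 0.\<close>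
  define u where "u n \<zeta> = h \<zeta> * cnj (b n * (of_real s * (\<zeta> / norm \<zeta>)) ^ n)" for n \<zeta>
  have ub: "norm (u n \<zeta>) \<le> norm (h \<zeta>) * (norm (b n) * s ^ n)" for n \<zeta>
  proof (cases "\<zeta> = 0")
    case True then show ?thesis using s by (cases n) (auto simp: u_def norm_mult norm_power)
  next
    case False then show ?thesis using s by (simp add: u_def norm_mult norm_power norm_divide)
  qed
  have bs: "summable (\<lambda>n. norm (b n) * s ^ n)"
    using powser_norm_summable[of b g "of_real s", OF g] s by (simp only: norm_of_real abs_of_nonneg)
  have [measurable]: "u n \<in> borel_measurable borel" for n unfolding u_def by measurable
  have ui: "integrable circle_measure (u n)" for n
    by (rule Bochner_Integration.integrable_bound[of _ "\<lambda>\<zeta>. norm (h \<zeta>) * (norm (b n) * s ^ n)"])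
       (use ub h s in \<open>auto simp: u_def[abs_def]\<close>)
  have S: "(\<lambda>n. integral\<^sup>L circle_measure (u n)) sums (\<integral>x. (\<Sum>n. u n x) \<partial>circle_measure)"
  proof (rule sums_integral[OF ui])
    show "AE x in circle_measure. summable (\<lambda>i. norm (u i x))"
      using ub by (intro AE_I2 summable_comparison_test'[OF summable_mult[OF bs], of 0]) auto
    have "(\<integral>x. norm (u n x) \<partial>circle_measure) \<le> (\<integral>x. norm (h x) * (norm (b n) * s ^ n) \<partial>circle_measure)" for n
      by (intro integral_mono) (use ui ub h in auto)
    then show "summable (\<lambda>i. (\<integral>x. norm (u i x) \<partial>circle_measure))"
      by (intro summable_comparison_test'[OF summable_mult[OF bs, of "\<integral>x. norm (h x) \<partial>circle_measure"], of 0]) (auto simp: )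
  qed
  have "(\<integral>x. (\<Sum>n. u n x) \<partial>circle_measure) = (\<integral>\<zeta>. h \<zeta> * cnj (g (of_real s * \<zeta>)) \<partial>circle_measure)"
  proof (rule integral_cong_AE)
    show "AE \<zeta> in circle_measure. (\<Sum>n. u n \<zeta>) = h \<zeta> * cnj (g (of_real s * \<zeta>))"
      using AE_circle_norm
    proof eventually_elim
      case (elim \<zeta>)
      have "(\<lambda>n. h \<zeta> * cnj (b n * (of_real s * \<zeta>) ^ n)) sums (h \<zeta> * cnj (g (of_real s * \<zeta>)))"
        by (intro sums_mult sums_cnj[THEN iffD2] g) (use elim s in \<open>auto simp: norm_mult\<close>)
      then show ?case using elim by (simp add: u_def sums_iff)
    qed
  qed (auto simp: u_def[abs_def] intro: borel_measurable_suminf)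
  moreover have "integral\<^sup>L circle_measure (u n) = cnj (b n) * s ^ n * (\<integral>\<zeta>. h \<zeta> * cnj (\<zeta> ^ n) \<partial>circle_measure)" for n
  proof -
    have "integral\<^sup>L circle_measure (u n) = (\<integral>\<zeta>. (cnj (b n) * s ^ n) * (h \<zeta> * cnj (\<zeta> ^ n)) \<partial>circle_measure)"
      by (rule integral_cong_AE) (use AE_circle_norm in \<open>auto simp: u_def[abs_def] power_mult_distrib mult_ac elim!: eventually_mono\<close>)
    then show ?thesis by simp
  qed
  ultimately show ?thesis using S by simp
qed

lemma integrable_circle_bounded:
  fixes h :: "complex \<Rightarrow> 'b::{banach, second_countable_topology}"
  assumes "h \<in> borel_measurable borel" "\<And>\<zeta>. norm \<zeta> = 1 \<Longrightarrow> norm (h \<zeta>) \<le> B"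
  shows "integrable circle_measure h"
  by (rule circle.integrable_const_bound[of _ B])
     (use assms AE_circle_norm in \<open>auto elim!: eventually_mono simp: measurable_cong_sets[OF circle_measure_measurable refl]\<close>)

lemma powser_dilate_bound:
  fixes a :: "nat \<Rightarrow> complex"
  assumes "\<And>z. norm z < 1 \<Longrightarrow> (\<lambda>n. a n * z ^ n) sums f z" "0 \<le> r" "r < 1"
  shows "\<exists>B. \<forall>\<zeta>. norm \<zeta> = 1 \<longrightarrow> norm (f (of_real r * \<zeta>)) \<le> B"
proof (intro exI allI impI)
  fix \<zeta> :: complex assume z: "norm \<zeta> = 1"
  have n: "norm (of_real r * \<zeta>) = r" using assms z by (simp add: norm_mult)
  have "summable (\<lambda>n. norm (a n * (of_real r * \<zeta>) ^ n))"
    using powser_norm_summable[of a f "of_real r * \<zeta>", OF assms(1)] n assms by (simp only: norm_mult norm_power)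
  moreover have "f (of_real r * \<zeta>) = (\<Sum>n. a n * (of_real r * \<zeta>) ^ n)"
    using assms(1)[of "of_real r * \<zeta>"] n assms by (simp add: sums_iff)
  ultimately show "norm (f (of_real r * \<zeta>)) \<le> (\<Sum>n. norm (a n) * r ^ n)"
    using summable_norm[of "\<lambda>n. a n * (of_real r * \<zeta>) ^ n"] assms z by (simp add: norm_mult norm_power)
qed

lemma integral_powser_power:
  fixes a :: "nat \<Rightarrow> complex"
  assumes f: "\<And>z. norm z < 1 \<Longrightarrow> (\<lambda>n. a n * z ^ n) sums f z" and m: "f \<in> borel_measurable borel"
    and r: "0 \<le> r" "r < 1"
  shows "(\<integral>\<zeta>. f (of_real r * \<zeta>) * cnj (\<zeta> ^ n) \<partial>circle_measure) = a n * r ^ n"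
proof -
  have "(\<lambda>k. cnj (a k) * r ^ k * (\<integral>\<zeta>. \<zeta> ^ n * cnj (\<zeta> ^ k) \<partial>circle_measure)) sums
     (\<integral>\<zeta>. \<zeta> ^ n * cnj (f (of_real r * \<zeta>)) \<partial>circle_measure)"
  proof -
    have i: "integrable circle_measure (\<lambda>\<zeta>::complex. \<zeta> ^ n)"
      by (rule integrable_circle_bounded[of _ 1]) (auto simp: norm_power)
    show ?thesis using integral_cnj_powser[OF i f m r] by simp
  qed
  moreover have "(\<lambda>k. cnj (a k) * r ^ k * (\<integral>\<zeta>. \<zeta> ^ n * cnj (\<zeta> ^ k) \<partial>circle_measure)) =
     (\<lambda>k. if k = n then cnj (a k) * r ^ k else 0)"
    by (auto simp: integral_circle_power simp del: complex_cnj_power)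
  ultimately have "(\<lambda>k. if k = n then cnj (a k) * r ^ k else 0) sums (\<integral>\<zeta>. \<zeta> ^ n * cnj (f (of_real r * \<zeta>)) \<partial>circle_measure)"
    by simp
  then have "(\<integral>\<zeta>. \<zeta> ^ n * cnj (f (of_real r * \<zeta>)) \<partial>circle_measure) = cnj (a n) * r ^ n"
    using sums_single[of n "\<lambda>k. cnj (a k) * r ^ k"] sums_unique2 by blast
  note e = this
  have "(\<integral>\<zeta>. f (of_real r * \<zeta>) * cnj (\<zeta> ^ n) \<partial>circle_measure) =
      (\<integral>\<zeta>. cnj (\<zeta> ^ n * cnj (f (of_real r * \<zeta>))) \<partial>circle_measure)"
    by (simp add: mult.commute)
  also have "\<dots> = cnj (\<integral>\<zeta>. \<zeta> ^ n * cnj (f (of_real r * \<zeta>)) \<partial>circle_measure)"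
    by (rule Bochner_Integration.integral_cnj)
  finally show ?thesis unfolding e by simp
qed

text \<open>Both coefficient sequences are read off from the same integrals over the circle of
  radius 1/2.\<close>

lemma coef_eqI:
  assumes "\<And>z. norm z < 1 \<Longrightarrow> (\<lambda>n. a n * z ^ n) sums f z"
  shows "coef f = a"
proof
  fix n
  define g where "g z = (if norm z < 1 then f z else 0)" for z
  have hol: "f holomorphic_on ball 0 1"
    by (rule power_series_holomorphic[of 0 1 a]) (use assms in auto)
  then have "disk_holo g"
    unfolding disk_holo_def g_def by (auto simp: intro: holomorphic_transform)
  then have m: "g \<in> borel_measurable borel" by (rule measurable_disk)
  have 1: "(\<lambda>n. a n * z ^ n) sums g z" if "norm z < 1" for z using assms that by (simp add: g_def)
  have 2: "(\<lambda>n. coef f n * z ^ n) sums g z" if "norm z < 1" for z using coef_sums[OF hol] that by (simp add: g_def)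
  have "coef f n * of_real (1/2) ^ n = a n * of_real (1/2) ^ n"
    using integral_powser_power[OF 1 m, of "1/2" n] integral_powser_power[OF 2 m, of "1/2" n] by simp
  then show "coef f n = a n" by simp
qed

text \<open>Two independent radii are kept because the distance between two dilates of one function
  is computed from this.\<close>

lemma parseval_dilate:
  assumes f: "disk_holo f" and g: "disk_holo g" and r: "0 \<le> r" "r < 1" and s: "0 \<le> s" "s < 1"
  shows "(\<lambda>n. coef f n * cnj (coef g n) * (r * s) ^ n) sums
    (\<integral>\<zeta>. f (of_real r * \<zeta>) * cnj (g (of_real s * \<zeta>)) \<partial>circle_measure)"
proof -
  note [measurable] = measurable_disk[OF f] measurable_disk[OF g]
  have fs: "(\<lambda>n. coef f n * z ^ n) sums f z" if "norm z < 1" for z using coef_sums f that by (simp add: disk_holo_def)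
  have gs: "(\<lambda>n. coef g n * z ^ n) sums g z" if "norm z < 1" for z using coef_sums g that by (simp add: disk_holo_def)
  obtain B where B: "\<And>\<zeta>. norm \<zeta> = 1 \<Longrightarrow> norm (f (of_real r * \<zeta>)) \<le> B" using powser_dilate_bound[OF fs r] by blast
  have i: "integrable circle_measure (\<lambda>\<zeta>. f (of_real r * \<zeta>))"
    by (rule integrable_circle_bounded[OF _ B]) auto
  have "(\<lambda>n. cnj (coef g n) * of_real s ^ n * (coef f n * of_real r ^ n)) sums (\<integral>\<zeta>. f (of_real r * \<zeta>) * cnj (g (of_real s * \<zeta>)) \<partial>circle_measure)"
    using integral_cnj_powser[OF i gs _ s] integral_powser_power[OF fs _ r] by simp
  then show ?thesis by (simp add: power_mult_distrib mult_ac)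
qed

lemma norm_dilate_sums:
  assumes f: "disk_holo f" and r: "0 \<le> r" "r < 1"
  shows "(\<lambda>n. (norm (coef f n))\<^sup>2 * (r\<^sup>2) ^ n) sums (sqint (\<lambda>\<zeta>. f (of_real r * \<zeta>)))"
proof -
  have "(\<lambda>n. of_real ((norm (coef f n))\<^sup>2 * (r\<^sup>2) ^ n) :: complex) sums of_real (sqint (\<lambda>\<zeta>. f (of_real r * \<zeta>)))"
    using parseval_dilate[OF f f r r] unfolding integral_complex_of_real[symmetric]
    unfolding complex_norm_square[symmetric] mult.assoc[symmetric] by (simp add: power2_eq_square[of r])
  then show ?thesis unfolding sums_of_real_iff .
qed

section \<open>The Hardy space as a Hilbert space\<close>

lemma suminf_bounded_partial:
  fixes a :: "nat \<Rightarrow> real"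
  assumes "\<And>n. 0 \<le> a n" "\<And>N. (\<Sum>n<N. a n) \<le> B"
  shows "summable a" "suminf a \<le> B"
proof -
  show s: "summable a"
    by (rule summableI_nonneg_bounded[where x=B]) (use assms in auto)
  show "suminf a \<le> B" by (rule suminf_le_const[OF s]) (use assms in auto)
qed

text \<open>The shift by 2 makes the sequence start at 1/2, the lower bound on r under which the
  kernel estimate is proved, and gives \<open>1 / (1 - radii n) = n + 2\<close>.\<close>

definition radii :: "nat \<Rightarrow> real" where "radii n = 1 - 1 / real (n + 2)"

lemma radii: "0 < radii n" "0 \<le> radii n" "radii n < 1" "radii \<longlonglongrightarrow> 1"
proof -
  have "(\<lambda>n. 1 - 1 / real (n + 2)) \<longlonglongrightarrow> 1 - 0"
    by (intro tendsto_intros LIMSEQ_ignore_initial_segment[OF lim_1_over_n])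
  then show "radii \<longlonglongrightarrow> 1" by (simp add: radii_def[abs_def])
qed (auto simp: radii_def)

text \<open>In a finite partial sum the radius can tend to 1 term by term.\<close>

lemma coef_sum_le:
  assumes f: "disk_holo f" and C: "\<And>r. 0 \<le> r \<Longrightarrow> r < 1 \<Longrightarrow> (sqint (\<lambda>\<zeta>. f (of_real r * \<zeta>))) \<le> C"
  shows "(\<Sum>n<N. (norm (coef f n))\<^sup>2) \<le> C"
proof (rule LIMSEQ_le_const2)
  have "(\<lambda>k. \<Sum>n<N. (norm (coef f n))\<^sup>2 * ((radii k)\<^sup>2) ^ n) \<longlonglongrightarrow> (\<Sum>n<N. (norm (coef f n))\<^sup>2 * (1\<^sup>2) ^ n)"
    by (intro tendsto_intros radii)
  then show "(\<lambda>k. \<Sum>n<N. (norm (coef f n))\<^sup>2 * ((radii k)\<^sup>2) ^ n) \<longlonglongrightarrow> (\<Sum>n<N. (norm (coef f n))\<^sup>2)" by simp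
  have "(\<Sum>n<N. (norm (coef f n))\<^sup>2 * ((radii k)\<^sup>2) ^ n) \<le> C" for k
  proof -
    have "(\<Sum>n<N. (norm (coef f n))\<^sup>2 * ((radii k)\<^sup>2) ^ n) \<le> (sqint (\<lambda>\<zeta>. f (of_real (radii k) * \<zeta>)))"
      unfolding sums_unique[OF norm_dilate_sums[OF f radii(2,3)]]
      by (intro sum_le_suminf sums_summable[OF norm_dilate_sums[OF f radii(2,3)]]) auto
    also have "\<dots> \<le> C" by (rule C[OF radii(2,3)])
    finally show ?thesis .
  qed
  then show "\<exists>M. \<forall>k\<ge>M. (\<Sum>n<N. (norm (coef f n))\<^sup>2 * ((radii k)\<^sup>2) ^ n) \<le> C" by blast
qed

text \<open>The mean over the circle of radius r is the sum of |a_n|^2 r^(2n), which stays bounded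
  as r tends to 1 exactly when the coefficients are square summable. From here on the space is
  handled through coefficients.\<close>

lemma H2_iff: "f \<in> H2 \<longleftrightarrow> disk_holo f \<and> summable (\<lambda>n. (norm (coef f n))\<^sup>2)"
proof
  assume f: "f \<in> H2"
  then have d: "disk_holo f" by (simp add: H2_def disk_holo_def)
  obtain C where C: "\<forall>r\<in>{0..<1}. (sqint (\<lambda>\<zeta>. f (of_real r * \<zeta>))) \<le> C"
    using f unfolding H2_def by blast
  have "(\<Sum>n<N. (norm (coef f n))\<^sup>2) \<le> C" for N
    by (rule coef_sum_le[OF d]) (use C in simp)
  then show "disk_holo f \<and> summable (\<lambda>n. (norm (coef f n))\<^sup>2)"
    using d suminf_bounded_partial[of "\<lambda>n. (norm (coef f n))\<^sup>2" C] by auto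
next
  assume a: "disk_holo f \<and> summable (\<lambda>n. (norm (coef f n))\<^sup>2)"
  have "(sqint (\<lambda>\<zeta>. f (of_real r * \<zeta>))) \<le> (\<Sum>n. (norm (coef f n))\<^sup>2)" if "r \<in> {0..<1}" for r
  proof -
    have r: "0 \<le> r" "r < 1" using that by auto
    have "(norm (coef f n))\<^sup>2 * (r\<^sup>2) ^ n \<le> (norm (coef f n))\<^sup>2" for n
      using r by (intro mult_right_le_one_le) (auto simp: power_le_one)
    then show ?thesis
      unfolding sums_unique[OF norm_dilate_sums[OF conjunct1[OF a] r]]
      using sums_summable[OF norm_dilate_sums[OF conjunct1[OF a] r]] a by (intro suminf_le) auto
  qed
  then have "\<exists>C. \<forall>r\<in>{0..<1}. (sqint (\<lambda>\<zeta>. f (of_real r * \<zeta>))) \<le> C" by blast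
  then show "f \<in> H2" using a unfolding H2_def disk_holo_def by blast
qed

definition of_coefs :: "(nat \<Rightarrow> complex) \<Rightarrow> complex \<Rightarrow> complex" where
  "of_coefs a z = (if norm z < 1 then \<Sum>n. a n * z ^ n else 0)"

lemma bounded_powser_summable:
  fixes a :: "nat \<Rightarrow> complex"
  assumes "\<And>n. norm (a n) \<le> B" "norm z < 1"
  shows "summable (\<lambda>n. a n * z ^ n)"
proof (rule summable_comparison_test'[of "\<lambda>n. B * norm z ^ n" 0])
  show "norm (a n * z ^ n) \<le> B * norm z ^ n" for n
    using assms(1)[of n] by (simp add: norm_mult norm_power mult_right_mono)
qed (use assms(2) in \<open>auto intro: summable_mult summable_geometric\<close>)

lemma of_coefs_sums:
  assumes "\<And>n. norm (a n) \<le> B" "norm z < 1"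
  shows "(\<lambda>n. a n * z ^ n) sums of_coefs a z"
  using bounded_powser_summable[OF assms] assms(2) by (simp add: of_coefs_def summable_sums)

lemma coef_of_coefs:
  assumes "\<And>n. norm (a n) \<le> B" shows "coef (of_coefs a) = a"
  using of_coefs_sums[of a, OF assms] by (rule coef_eqI)

lemma disk_of_coefs:
  assumes "\<And>n. norm (a n) \<le> B" shows "disk_holo (of_coefs a)"
  unfolding disk_holo_def
proof
  show "of_coefs a holomorphic_on ball 0 1"
    by (rule power_series_holomorphic[of 0 1 a]) (use of_coefs_sums[of a, OF assms] in auto)
qed (auto simp: of_coefs_def)

lemma square_summable_bounded:
  assumes "summable (\<lambda>n. (norm (a n :: complex))\<^sup>2)"
  shows "norm (a n) \<le> sqrt (\<Sum>n. (norm (a n))\<^sup>2)"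
proof -
  have "(norm (a n))\<^sup>2 \<le> (\<Sum>n. (norm (a n))\<^sup>2)"
    using sum_le_suminf[OF assms, of "{n}"] by simp
  then show ?thesis by (rule real_le_rsqrt)
qed

lemma of_coefs_H2:
  assumes "summable (\<lambda>n. (norm (a n))\<^sup>2)"
  shows "of_coefs a \<in> H2" "coef (of_coefs a) = a"
proof -
  note b = square_summable_bounded[OF assms]
  show "coef (of_coefs a) = a" by (rule coef_of_coefs[OF b])
  then show "of_coefs a \<in> H2" using disk_of_coefs[OF b] assms by (simp add: H2_iff)
qed

lemma disk_holo_eqI:
  assumes "disk_holo f" "disk_holo g" "\<And>n. coef f n = coef g n"
  shows "f = g"
proof
  fix z
  show "f z = g z"
  proof (cases "norm z < 1")
    case True
    then show ?thesis
      using coef_sums[of f z] coef_sums[of g z] assms by (auto simp: disk_holo_def intro: sums_unique2)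
  qed (use assms in \<open>auto simp: disk_holo_def\<close>)
qed

lemma disk_holo_lincomb:
  assumes "disk_holo f" "disk_holo g"
  shows "disk_holo (\<lambda>z. c * f z + d * g z)"
  using assms by (auto simp: disk_holo_def intro!: holomorphic_intros)

lemma coef_lincomb:
  assumes "disk_holo f" "disk_holo g"
  shows "coef (\<lambda>z. c * f z + d * g z) = (\<lambda>n. c * coef f n + d * coef g n)"
proof (rule coef_eqI)
  fix z :: complex assume "norm z < 1"
  then have "(\<lambda>n. c * (coef f n * z ^ n) + d * (coef g n * z ^ n)) sums (c * f z + d * g z)"
    using assms by (intro sums_add sums_mult coef_sums) (auto simp: disk_holo_def)
  then show "(\<lambda>n. (c * coef f n + d * coef g n) * z ^ n) sums (c * f z + d * g z)"
    by (simp add: algebra_simps)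
qed

lemma norm_lincomb_square: "(norm (c * x + d * y :: complex))\<^sup>2 \<le> 2 * (norm c)\<^sup>2 * (norm x)\<^sup>2 + 2 * (norm d)\<^sup>2 * (norm y)\<^sup>2"
proof -
  have "(norm (c * x + d * y))\<^sup>2 \<le> (norm (c * x) + norm (d * y))\<^sup>2" by (intro power_mono norm_triangle_ineq) auto
  also have "\<dots> \<le> 2 * (norm (c * x))\<^sup>2 + 2 * (norm (d * y))\<^sup>2"
    using sum_squares_bound[of "norm (c * x)" "norm (d * y)"] by (simp add: power2_eq_square algebra_simps)
  finally show ?thesis by (simp add: norm_mult power_mult_distrib)
qed

lemma H2_lincomb:
  assumes "f \<in> H2" "g \<in> H2"
  shows "(\<lambda>z. c * f z + d * g z) \<in> H2"
proof -
  have d: "disk_holo f" "disk_holo g" using assms by (auto simp: H2_iff)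
  have "summable (\<lambda>n. (norm (c * coef f n + d * coef g n))\<^sup>2)"
    by (rule summable_comparison_test'[of "\<lambda>n. 2 * (norm c)\<^sup>2 * (norm (coef f n))\<^sup>2 + 2 * (norm d)\<^sup>2 * (norm (coef g n))\<^sup>2" 0])
       (use assms norm_lincomb_square in \<open>auto simp: H2_iff intro!: summable_add summable_mult\<close>)
  then show ?thesis using d by (simp add: H2_iff disk_holo_lincomb coef_lincomb)
qed

text \<open>As a type, the space can be an instance of the classes of real inner product and Banach
  spaces, to which the operator theory above applies.\<close>

typedef hardy = H2
  morphisms fn Hardy
proof
  show "(\<lambda>z. 0) \<in> H2" by (auto simp: H2_def)
qed

setup_lifting type_definition_hardy

abbreviation hcoef :: "hardy \<Rightarrow> nat \<Rightarrow> complex" where "hcoef f \<equiv> coef (fn f)"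

lemma fn_H2 [simp]: "fn f \<in> H2" by (rule fn)
lemma fn_disk [simp]: "disk_holo (fn f)" using fn[of f] by (simp add: H2_iff)
lemma hcoef_summable [simp]: "summable (\<lambda>n. (norm (hcoef f n))\<^sup>2)" using fn[of f] by (simp add: H2_iff)

lemma hardy_eqI: "(\<And>n. hcoef f n = hcoef g n) \<Longrightarrow> f = g"
  using disk_holo_eqI[of "fn f" "fn g"] by (simp add: fn_inject)

lift_definition hlin :: "complex \<Rightarrow> hardy \<Rightarrow> complex \<Rightarrow> hardy \<Rightarrow> hardy"
  is "\<lambda>c f d g z. c * f z + d * g z" by (rule H2_lincomb)

lemma hcoef_hlin: "hcoef (hlin c f d g) n = c * hcoef f n + d * hcoef g n"
  by (simp add: hlin.rep_eq coef_lincomb)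

text \<open>Given by coefficients, so that the space laws need no boundary values;
  \<open>L2_inner_bd\<close> identifies it with the integral over the circle.\<close>

definition cinner :: "hardy \<Rightarrow> hardy \<Rightarrow> complex" where
  "cinner f g = (\<Sum>n. hcoef f n * cnj (hcoef g n))"

lemma cinner_summable: "summable (\<lambda>n. norm (hcoef f n * cnj (hcoef g n)))"
proof (rule summable_comparison_test'[of "\<lambda>n. (norm (hcoef f n))\<^sup>2 + (norm (hcoef g n))\<^sup>2" 0])
  show "norm (norm (hcoef f n * cnj (hcoef g n))) \<le> (norm (hcoef f n))\<^sup>2 + (norm (hcoef g n))\<^sup>2" for n
    using sum_squares_bound[of "norm (hcoef f n)" "norm (hcoef g n)"] mult_nonneg_nonneg[OF norm_ge_zero[of "hcoef f n"] norm_ge_zero[of "hcoef g n"]]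
    unfolding norm_mult complex_mod_cnj real_norm_def abs_mult abs_norm_cancel by linarith
qed (intro summable_add hcoef_summable)

lemma cinner_sums: "(\<lambda>n. hcoef f n * cnj (hcoef g n)) sums cinner f g"
  unfolding cinner_def by (rule summable_sums[OF summable_norm_cancel[OF cinner_summable]])

lemma cinner_hlin_left: "cinner (hlin c f d g) h = c * cinner f h + d * cinner g h"
proof (rule sums_unique2[OF cinner_sums])
  have "(\<lambda>n. c * (hcoef f n * cnj (hcoef h n)) + d * (hcoef g n * cnj (hcoef h n))) sums (c * cinner f h + d * cinner g h)"
    by (intro sums_add sums_mult cinner_sums)
  then show "(\<lambda>n. hcoef (hlin c f d g) n * cnj (hcoef h n)) sums (c * cinner f h + d * cinner g h)"
    by (simp add: hcoef_hlin algebra_simps)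
qed

lemma cinner_commute: "cinner f g = cnj (cinner g f)"
proof (rule sums_unique2[OF cinner_sums])
  have "(\<lambda>n. cnj (hcoef g n * cnj (hcoef f n))) sums cnj (cinner g f)"
    by (intro sums_cnj[THEN iffD2] cinner_sums)
  then show "(\<lambda>n. hcoef f n * cnj (hcoef g n)) sums cnj (cinner g f)" by (simp add: mult.commute)
qed

lemma cinner_self: "cinner f f = of_real (\<Sum>n. (norm (hcoef f n))\<^sup>2)"
proof (rule sums_unique2[OF cinner_sums])
  have "(\<lambda>n. complex_of_real ((norm (hcoef f n))\<^sup>2)) sums of_real (\<Sum>n. (norm (hcoef f n))\<^sup>2)"
    by (intro sums_of_real summable_sums hcoef_summable)
  then show "(\<lambda>n. hcoef f n * cnj (hcoef f n)) sums of_real (\<Sum>n. (norm (hcoef f n))\<^sup>2)"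
    by (simp only: complex_norm_square)
qed

instantiation hardy :: real_normed_vector
begin

definition zero_hardy :: hardy where "0 = Hardy (\<lambda>z. 0)"
definition plus_hardy :: "hardy \<Rightarrow> hardy \<Rightarrow> hardy" where "f + g = hlin 1 f 1 g"
definition minus_hardy :: "hardy \<Rightarrow> hardy \<Rightarrow> hardy" where "f - g = hlin 1 f (-1) g"
definition uminus_hardy :: "hardy \<Rightarrow> hardy" where "- f = hlin (-1) f 0 f"
definition scaleR_hardy :: "real \<Rightarrow> hardy \<Rightarrow> hardy" where "r *\<^sub>R f = hlin (of_real r) f 0 f"
definition norm_hardy :: "hardy \<Rightarrow> real" where "norm f = sqrt (\<Sum>n. (norm (hcoef f n))\<^sup>2)"
definition dist_hardy :: "hardy \<Rightarrow> hardy \<Rightarrow> real" where "dist_hardy f g = norm (f - g)"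
definition sgn_hardy :: "hardy \<Rightarrow> hardy" where "sgn_hardy f = inverse (norm f) *\<^sub>R f"
definition uniformity_hardy :: "(hardy \<times> hardy) filter" where
  "uniformity_hardy = (INF e\<in>{0 <..}. principal {(x, y). dist x y < e})"
definition open_hardy :: "hardy set \<Rightarrow> bool" where
  "open_hardy U \<longleftrightarrow> (\<forall>x\<in>U. eventually (\<lambda>(x', y). x' = x \<longrightarrow> y \<in> U) uniformity)"

lemma hcoef_zero: "hcoef 0 n = 0"
proof -
  have "(\<lambda>z. 0) \<in> H2" by (auto simp: H2_def)
  moreover have "coef (\<lambda>z. 0) = (\<lambda>n. 0)" by (rule coef_eqI) simp
  ultimately show ?thesis by (simp add: zero_hardy_def Hardy_inverse)
qed

lemmas hcoef_ops = plus_hardy_def minus_hardy_def uminus_hardy_def scaleR_hardy_def hcoef_hlin hcoef_zero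

instance
proof
  fix f g h :: hardy and r s :: real
  show "dist f g = norm (f - g)" by (simp add: dist_hardy_def)
  show "sgn f = inverse (norm f) *\<^sub>R f" by (simp add: sgn_hardy_def)
  show "f + g + h = f + (g + h)" "f + g = g + f" "0 + f = f" "- f + f = 0" "f - g = f + - g"
    "r *\<^sub>R (f + g) = r *\<^sub>R f + r *\<^sub>R g" "(r + s) *\<^sub>R f = r *\<^sub>R f + s *\<^sub>R f"
    "r *\<^sub>R s *\<^sub>R f = (r * s) *\<^sub>R f" "1 *\<^sub>R f = f"
    by (rule hardy_eqI; simp add: hcoef_ops algebra_simps)+
  show "uniformity = (INF e\<in>{0 <..}. principal {(x, y :: hardy). dist x y < e})" by (rule uniformity_hardy_def)
  show "open U \<longleftrightarrow> (\<forall>x\<in>U. eventually (\<lambda>(x', y). x' = x \<longrightarrow> y \<in> U) uniformity)" for U :: "hardy set" by (rule open_hardy_def)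
  show "norm f = 0 \<longleftrightarrow> f = 0"
  proof
    assume "norm f = 0"
    then have "hcoef f n = 0" for n
      using suminf_eq_zero_iff[OF hcoef_summable[of f]] by (simp add: norm_hardy_def)
    then show "f = 0" by (intro hardy_eqI) (simp add: hcoef_zero)
  qed (simp add: norm_hardy_def hcoef_zero)
  show "norm (r *\<^sub>R f) = \<bar>r\<bar> * norm f"
    by (simp add: norm_hardy_def hcoef_ops norm_mult power_mult_distrib suminf_mult real_sqrt_mult)
  show "norm (f + g) \<le> norm f + norm g"
  proof -
    have "(\<Sum>n<N. (norm (hcoef (f + g) n))\<^sup>2) \<le> (norm f + norm g)\<^sup>2" for N
    proof -
      have L: "L2_set (\<lambda>n. norm (hcoef h n)) {..<N} \<le> norm h" for h
        unfolding L2_set_def norm_hardy_def by (intro real_sqrt_le_mono sum_le_suminf hcoef_summable) auto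
      have "L2_set (\<lambda>n. norm (hcoef (f + g) n)) {..<N} \<le> L2_set (\<lambda>n. norm (hcoef f n) + norm (hcoef g n)) {..<N}"
        by (intro L2_set_mono) (auto simp: hcoef_ops norm_triangle_ineq)
      also have "\<dots> \<le> norm f + norm g"
        by (rule order_trans[OF L2_set_triangle_ineq add_mono[OF L L]])
      finally have "(L2_set (\<lambda>n. norm (hcoef (f + g) n)) {..<N})\<^sup>2 \<le> (norm f + norm g)\<^sup>2"
        by (intro power_mono) (auto simp: L2_set_nonneg)
      then show ?thesis by (simp add: L2_set_def sum_nonneg)
    qed
    then have "(\<Sum>n. (norm (hcoef (f + g) n))\<^sup>2) \<le> (norm f + norm g)\<^sup>2"
      by (intro suminf_bounded_partial) auto
    moreover have "0 \<le> norm f + norm g" by (simp add: norm_hardy_def suminf_nonneg)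
    ultimately show ?thesis unfolding norm_hardy_def[of "f + g"] by (rule real_le_lsqrt[rotated])
  qed
qed

end

instantiation hardy :: real_inner
begin

definition inner_hardy :: "hardy \<Rightarrow> hardy \<Rightarrow> real" where "inner f g = Re (cinner f g)"

instance
proof
  fix f g h :: hardy and r s :: real
  show "inner f g = inner g f" using cinner_commute[of f g] by (simp add: inner_hardy_def)
  show "inner (f + g) h = inner f h + inner g h" by (simp add: inner_hardy_def plus_hardy_def cinner_hlin_left)
  show "inner (r *\<^sub>R f) g = r * inner f g" by (simp add: inner_hardy_def scaleR_hardy_def cinner_hlin_left)
  show "0 \<le> inner f f" by (simp add: inner_hardy_def cinner_self suminf_nonneg)
  show n: "norm f = sqrt (inner f f)" by (simp add: norm_hardy_def inner_hardy_def cinner_self)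
  show "inner f f = 0 \<longleftrightarrow> f = 0" using n by (metis norm_eq_zero real_sqrt_eq_zero_cancel_iff)
qed

end

lemma norm_hardy_sq: "(norm f)\<^sup>2 = (\<Sum>n. (norm (hcoef f n))\<^sup>2)"
  by (simp add: power2_norm_eq_inner inner_hardy_def cinner_self)

lemma cinner_same: "cinner f f = of_real ((norm f)\<^sup>2)"
  by (simp add: norm_hardy_sq cinner_self)

lemma norm_hcoef_le: "norm (hcoef f n) \<le> norm f"
  using square_summable_bounded[OF hcoef_summable[of f], of n] by (simp flip: norm_hardy_sq)

lemma fn_zero [simp]: "fn 0 = (\<lambda>z. 0)"
  unfolding zero_hardy_def by (rule Hardy_inverse) (auto simp: H2_def)
lemma fn_add: "fn (f + g) z = fn f z + fn g z" by (simp add: plus_hardy_def hlin.rep_eq)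
lemma fn_diff: "fn (f - g) z = fn f z - fn g z" by (simp add: minus_hardy_def hlin.rep_eq)
lemma fn_scaleR: "fn (r *\<^sub>R f) z = of_real r * fn f z" by (simp add: scaleR_hardy_def hlin.rep_eq)

definition hscale :: "complex \<Rightarrow> hardy \<Rightarrow> hardy" where "hscale c f = hlin c f 0 f"

lemma fn_hscale: "fn (hscale c f) z = c * fn f z" by (simp add: hscale_def hlin.rep_eq)
lemma hlin_eq: "hlin c f d g = hscale c f + hscale d g"
  by (rule hardy_eqI) (simp add: plus_hardy_def hscale_def hcoef_hlin)

lemma cinner_hscale_left: "cinner (hscale c f) g = c * cinner f g"
  by (simp add: hscale_def cinner_hlin_left)
lemma cinner_hscale_right: "cinner f (hscale c g) = cnj c * cinner f g"
  unfolding cinner_commute[of f "hscale c g"] cinner_commute[of f g] cinner_hscale_left by simp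
lemma cinner_add_left: "cinner (f + g) h = cinner f h + cinner g h"
  by (simp add: plus_hardy_def cinner_hlin_left)
lemma cinner_diff_left: "cinner (f - g) h = cinner f h - cinner g h"
  by (simp add: minus_hardy_def cinner_hlin_left)
lemma cinner_add_right: "cinner f (g + h) = cinner f g + cinner f h"
  unfolding cinner_commute[of f "g + h"] cinner_commute[of f g] cinner_commute[of f h] cinner_add_left by simp

lemma norm_hscale: "norm (hscale c f) = norm c * norm f"
proof -
  have "complex_of_real ((norm (hscale c f))\<^sup>2) = of_real ((norm c * norm f)\<^sup>2)"
    unfolding cinner_same[symmetric] cinner_hscale_left cinner_hscale_right
    by (simp add: cinner_same power_mult_distrib complex_norm_square mult_ac flip: of_real_power)
  then have "(norm (hscale c f))\<^sup>2 = (norm c * norm f)\<^sup>2" by (simp only: of_real_eq_iff)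
  then show ?thesis by (rule power2_eq_imp_eq) auto
qed

text \<open>The bridge from real to complex: identities of real inner products become complex ones
  as soon as the maps involved commute with multiplication by i.\<close>

lemma cinner_eq_inner: "cinner f g = Complex (inner f g) (inner f (hscale \<i> g))"
  by (simp add: complex_eq_iff inner_hardy_def cinner_hscale_right)

lemma norm_cinner_le: "norm (cinner f g) \<le> norm f * norm g"
proof (cases "cinner f g = 0")
  case False
  \<comment> \<open>A rotation that makes the inner product real and nonnegative, so that the real
    Cauchy-Schwarz inequality applies.\<close>
  define c where "c = cinner f g / norm (cinner f g)"
  have c: "norm c = 1" using False by (simp add: c_def norm_divide)
  have "cnj c * cinner f g = of_real (norm (cinner f g))"
    using False by (simp add: c_def field_simps complex_norm_square[symmetric] power2_eq_square)
  then have "norm (cinner f g) = inner f (hscale c g)"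
    unfolding inner_hardy_def cinner_hscale_right by simp
  also have "\<dots> \<le> norm f * norm (hscale c g)" by (rule norm_cauchy_schwarz)
  finally show ?thesis by (simp add: norm_hscale c)
qed simp

lemma hardy_of_coefs:
  assumes "summable (\<lambda>n. (norm (a n))\<^sup>2)" shows "\<exists>f. hcoef f = a"
  using of_coefs_H2[OF assms] by (metis Hardy_inverse)

instance hardy :: banach
proof
  fix X :: "nat \<Rightarrow> hardy" assume X: "Cauchy X"
  have hd: "hcoef (f - g) n = hcoef f n - hcoef g n" for f g n by (simp add: hcoef_ops)
  have "Cauchy (\<lambda>m. hcoef (X m) n)" for n
  proof (rule metric_CauchyI)
    fix e :: real assume "e > 0"
    then obtain M where M: "\<And>p q. p \<ge> M \<Longrightarrow> q \<ge> M \<Longrightarrow> dist (X p) (X q) < e" using metric_CauchyD[OF X] by blast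
    have "dist (hcoef (X p) n) (hcoef (X q) n) < e" if "p \<ge> M" "q \<ge> M" for p q
      using M[OF that] norm_hcoef_le[of "X p - X q" n] by (simp add: hd dist_norm)
    then show "\<exists>M. \<forall>p\<ge>M. \<forall>q\<ge>M. dist (hcoef (X p) n) (hcoef (X q) n) < e" by blast
  qed
  then have "\<forall>n. \<exists>l. (\<lambda>m. hcoef (X m) n) \<longlonglongrightarrow> l" using Cauchy_convergent convergent_def by blast
  then obtain a where a: "\<And>n. (\<lambda>m. hcoef (X m) n) \<longlonglongrightarrow> a n" by metis
  have ps: "(\<Sum>k<K. (norm (hcoef (X m) k - a k))\<^sup>2) \<le> e\<^sup>2"
    if "\<And>q. q \<ge> M \<Longrightarrow> norm (X m - X q) \<le> e" "e \<ge> 0" for m M e K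
  proof (rule LIMSEQ_le_const2)
    show "(\<lambda>q. \<Sum>k<K. (norm (hcoef (X m) k - hcoef (X q) k))\<^sup>2) \<longlonglongrightarrow> (\<Sum>k<K. (norm (hcoef (X m) k - a k))\<^sup>2)"
      by (intro tendsto_intros a)
    have "(\<Sum>k<K. (norm (hcoef (X m) k - hcoef (X q) k))\<^sup>2) \<le> e\<^sup>2" if q: "q \<ge> M" for q
    proof -
      have le: "norm (X m - X q) \<le> e" using \<open>\<And>q. q \<ge> M \<Longrightarrow> norm (X m - X q) \<le> e\<close> q by blast
      have "(\<Sum>k<K. (norm (hcoef (X m - X q) k))\<^sup>2) \<le> (norm (X m - X q))\<^sup>2"
        unfolding norm_hardy_sq by (intro sum_le_suminf hcoef_summable) auto
      also have "\<dots> \<le> e\<^sup>2" by (rule power_mono[OF le norm_ge_zero])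
      finally show ?thesis by (simp add: hd)
    qed
    then show "\<exists>N. \<forall>q\<ge>N. (\<Sum>k<K. (norm (hcoef (X m) k - hcoef (X q) k))\<^sup>2) \<le> e\<^sup>2" by blast
  qed
  have C: "\<exists>M. \<forall>m\<ge>M. \<forall>q\<ge>M. norm (X m - X q) \<le> e" if "e > 0" for e
    using metric_CauchyD[OF X that] unfolding dist_norm by (meson less_imp_le)
  from C[OF zero_less_one] obtain M1 where M1': "\<forall>m\<ge>M1. \<forall>q\<ge>M1. norm (X m - X q) \<le> 1" ..
  then have M1: "\<And>q. q \<ge> M1 \<Longrightarrow> norm (X M1 - X q) \<le> 1" by simp
  \<comment> \<open>Finite partial sums bound only the distance of the limit sequence from a fixed
    \<open>X M1\<close>, so the limit is built as \<open>X M1\<close> minus a square summable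
    sequence.\<close>
  have "summable (\<lambda>n. (norm (hcoef (X M1) n - a n))\<^sup>2)"
  proof (rule suminf_bounded_partial)
    show "(\<Sum>k<K. (norm (hcoef (X M1) k - a k))\<^sup>2) \<le> 1\<^sup>2" for K
      by (rule ps[of M1 M1]) (use M1 in auto)
  qed simp
  from hardy_of_coefs[OF this] obtain g where g: "hcoef g = (\<lambda>n. hcoef (X M1) n - a n)" ..
  define f where "f = X M1 - g"
  have f: "hcoef f = a" by (rule ext) (simp add: f_def hd g)
  have "X \<longlonglongrightarrow> f"
  proof (rule metric_LIMSEQ_I)
    fix e :: real assume e: "e > 0"
    from C[OF half_gt_zero[OF e]] obtain M where M': "\<forall>m\<ge>M. \<forall>q\<ge>M. norm (X m - X q) \<le> e / 2" ..
    then have M: "\<And>m q. m \<ge> M \<Longrightarrow> q \<ge> M \<Longrightarrow> norm (X m - X q) \<le> e / 2" by simp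
    have "dist (X m) f < e" if "m \<ge> M" for m
    proof -
      have "(norm (X m - f))\<^sup>2 \<le> (e/2)\<^sup>2" unfolding norm_hardy_sq hd f
      proof (rule suminf_bounded_partial)
        show "(\<Sum>k<K. (norm (hcoef (X m) k - a k))\<^sup>2) \<le> (e/2)\<^sup>2" for K
          by (rule ps[of M m]) (use M that e in auto)
      qed simp
      then have "norm (X m - f) \<le> e / 2" by (rule power2_le_imp_le) (use e in auto)
      then show ?thesis using e by (simp add: dist_norm)
    qed
    then show "\<exists>M. \<forall>m\<ge>M. dist (X m) f < e" by blast
  qed
  then show "convergent X" by (auto simp: convergent_def)
qed

section \<open>Multiplication by bounded holomorphic functions\<close>

definition bholo :: "real \<Rightarrow> (complex \<Rightarrow> complex) \<Rightarrow> bool" where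
  "bholo B g \<longleftrightarrow> g holomorphic_on ball 0 1 \<and> (\<forall>z. norm z < 1 \<longrightarrow> norm (g z) \<le> B)"

lemma bholo_nonneg: "bholo B g \<Longrightarrow> 0 \<le> B"
  using order_trans[OF norm_ge_zero[of "g 0"], of B] by (simp add: bholo_def)

definition hmul :: "(complex \<Rightarrow> complex) \<Rightarrow> hardy \<Rightarrow> hardy" where
  "hmul g f = Hardy (\<lambda>z. g z * fn f z)"

lemma dilate_integrable:
  assumes "disk_holo f" "0 \<le> r" "r < 1"
  shows "integrable circle_measure (\<lambda>\<zeta>. (norm (f (of_real r * \<zeta>)))\<^sup>2)"
proof -
  note [measurable] = measurable_disk[OF assms(1)]
  obtain B where B: "\<And>\<zeta>. norm \<zeta> = 1 \<Longrightarrow> norm (f (of_real r * \<zeta>)) \<le> B"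
    using powser_dilate_bound[OF coef_sums assms(2,3)] assms(1) unfolding disk_holo_def by blast
  show ?thesis by (rule integrable_circle_bounded[of _ "B\<^sup>2"]) (auto intro!: power_mono B simp: norm_power)
qed

lemma norm_dilate_le: "0 \<le> r \<Longrightarrow> r < 1 \<Longrightarrow> (sqint (\<lambda>\<zeta>. fn f (of_real r * \<zeta>))) \<le> (norm f)\<^sup>2"
proof -
  assume r: "0 \<le> r" "r < 1"
  have "(norm (hcoef f n))\<^sup>2 * (r\<^sup>2) ^ n \<le> (norm (hcoef f n))\<^sup>2" for n
    using r by (intro mult_right_le_one_le) (auto simp: power_le_one)
  then show ?thesis unfolding norm_hardy_sq
    unfolding sums_unique[OF norm_dilate_sums[OF fn_disk r]]
    using sums_summable[OF norm_dilate_sums[OF fn_disk r, of f]] by (intro suminf_le) auto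
qed

lemma H2_norm_bound:
  assumes f: "disk_holo f" and B: "\<And>r. 0 \<le> r \<Longrightarrow> r < 1 \<Longrightarrow> (sqint (\<lambda>\<zeta>. f (of_real r * \<zeta>))) \<le> B\<^sup>2" "0 \<le> B"
  shows "f \<in> H2" "norm (Hardy f) \<le> B"
proof -
  have "\<exists>C. \<forall>r\<in>{0..<1}. (sqint (\<lambda>\<zeta>. f (of_real r * \<zeta>))) \<le> C" using B(1) by force
  then show H: "f \<in> H2" using f unfolding H2_def disk_holo_def by blast
  have "(norm (Hardy f))\<^sup>2 \<le> B\<^sup>2"
    unfolding norm_hardy_sq Hardy_inverse[OF H]
    by (rule suminf_bounded_partial[OF _ coef_sum_le[OF f B(1)]]) auto
  then show "norm (Hardy f) \<le> B" by (rule power2_le_imp_le) (rule B)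
qed

lemma disk_holo_bholo_mult: "bholo B g \<Longrightarrow> disk_holo (\<lambda>z. g z * fn f z)"
  using fn_disk[of f] by (auto simp: bholo_def disk_holo_def intro!: holomorphic_intros)

lemma dilate_mult_le:
  assumes g: "bholo B g" and r: "0 \<le> r" "r < 1"
  shows "(sqint (\<lambda>\<zeta>. g (of_real r * \<zeta>) * fn f (of_real r * \<zeta>))) \<le>
    B\<^sup>2 * (sqint (\<lambda>\<zeta>. fn f (of_real r * \<zeta>)))"
proof -
  have "(sqint (\<lambda>\<zeta>. g (of_real r * \<zeta>) * fn f (of_real r * \<zeta>))) \<le>
    (\<integral>\<zeta>. B\<^sup>2 * (norm (fn f (of_real r * \<zeta>)))\<^sup>2 \<partial>circle_measure)"
  proof (rule integral_mono_AE)
    show "AE \<zeta> in circle_measure. (norm (g (of_real r * \<zeta>) * fn f (of_real r * \<zeta>)))\<^sup>2 \<le> B\<^sup>2 * (norm (fn f (of_real r * \<zeta>)))\<^sup>2"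
      using AE_circle_norm
    proof eventually_elim
      case (elim \<zeta>)
      then have "norm (g (of_real r * \<zeta>)) \<le> B" using g r by (simp add: bholo_def norm_mult)
      then show ?case unfolding norm_mult power_mult_distrib by (intro mult_right_mono power_mono) auto
    qed
  qed (use dilate_integrable[OF disk_holo_bholo_mult[OF g] r] dilate_integrable[OF fn_disk r, of f] in auto)
  then show ?thesis by simp
qed

lemma bholo_mult:
  assumes "bholo B g"
  shows "fn (hmul g f) = (\<lambda>z. g z * fn f z)" "norm (hmul g f) \<le> B * norm f"
proof -
  have le: "(sqint (\<lambda>\<zeta>. g (of_real r * \<zeta>) * fn f (of_real r * \<zeta>))) \<le> (B * norm f)\<^sup>2"
    if r: "0 \<le> r" "r < 1" for r
    using dilate_mult_le[OF assms r, of f] mult_left_mono[OF norm_dilate_le[OF r, of f], of "B\<^sup>2"]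
    by (simp add: power_mult_distrib)
  have B: "0 \<le> B * norm f" using bholo_nonneg[OF assms] by simp
  note H = H2_norm_bound[OF disk_holo_bholo_mult[OF assms] le B]
  show "fn (hmul g f) = (\<lambda>z. g z * fn f z)" "norm (hmul g f) \<le> B * norm f"
    using H by (auto simp: hmul_def Hardy_inverse)
qed

lemma fn_hmul: "bholo B g \<Longrightarrow> fn (hmul g f) z = g z * fn f z"
  by (simp add: bholo_mult)

section \<open>Boundary functions\<close>

lemma L2_measurable: "f \<in> L2_circle \<Longrightarrow> f \<in> borel_measurable borel"
  by (simp add: L2_circle_def measurable_cong_sets[OF circle_measure_measurable refl])

lemma L2_integrable: "f \<in> L2_circle \<Longrightarrow> integrable circle_measure (\<lambda>\<zeta>. (norm (f \<zeta>))\<^sup>2)"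
  by (simp add: L2_circle_def)

lemma L2_I: "f \<in> borel_measurable borel \<Longrightarrow> integrable circle_measure (\<lambda>\<zeta>. (norm (f \<zeta>))\<^sup>2) \<Longrightarrow> f \<in> L2_circle"
  by (simp add: L2_circle_def measurable_cong_sets[OF circle_measure_measurable refl])

lemma L2_norm_prod_integrable:
  assumes "f \<in> L2_circle" "g \<in> L2_circle"
  shows "integrable circle_measure (\<lambda>\<zeta>. norm (f \<zeta>) * norm (g \<zeta>))"
proof (rule Bochner_Integration.integrable_bound)
  note [measurable] = L2_measurable[OF assms(1)] L2_measurable[OF assms(2)]
  show "integrable circle_measure (\<lambda>\<zeta>. (norm (f \<zeta>))\<^sup>2 + (norm (g \<zeta>))\<^sup>2)"
    using assms by (simp add: L2_integrable)
  show "(\<lambda>\<zeta>. norm (f \<zeta>) * norm (g \<zeta>)) \<in> borel_measurable circle_measure" by measurable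
  have "norm (f \<zeta>) * norm (g \<zeta>) \<le> (norm (f \<zeta>))\<^sup>2 + (norm (g \<zeta>))\<^sup>2" for \<zeta>
    using sum_squares_bound[of "norm (f \<zeta>)" "norm (g \<zeta>)"] mult_nonneg_nonneg[OF norm_ge_zero[of "f \<zeta>"] norm_ge_zero[of "g \<zeta>"]]
    by linarith
  then show "AE \<zeta> in circle_measure. norm (norm (f \<zeta>) * norm (g \<zeta>)) \<le> norm ((norm (f \<zeta>))\<^sup>2 + (norm (g \<zeta>))\<^sup>2)"
    by (intro AE_I2) simp
qed

lemma L2_prod_integrable:
  assumes "f \<in> L2_circle" "g \<in> L2_circle"
  shows "integrable circle_measure (\<lambda>\<zeta>. f \<zeta> * cnj (g \<zeta>))"
proof -
  note [measurable] = L2_measurable[OF assms(1)] L2_measurable[OF assms(2)]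
  show ?thesis
    by (rule Bochner_Integration.integrable_bound[OF L2_norm_prod_integrable[OF assms]]) (auto simp: norm_mult)
qed

lemma L2_cauchy_schwarz:
  assumes f: "f \<in> L2_circle" and g: "g \<in> L2_circle"
  shows "norm (\<integral>\<zeta>. f \<zeta> * cnj (g \<zeta>) \<partial>circle_measure) \<le>
    sqrt (sqint (\<lambda>\<zeta>. f \<zeta>)) * sqrt (sqint (\<lambda>\<zeta>. g \<zeta>))"
proof -
  define F G P where "F = (sqint (\<lambda>\<zeta>. f \<zeta>))"
    and "G = (sqint (\<lambda>\<zeta>. g \<zeta>))" and "P = (\<integral>\<zeta>. norm (f \<zeta>) * norm (g \<zeta>) \<partial>circle_measure)"
  have q: "0 \<le> F - 2 * t * P + t\<^sup>2 * G" for t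
  proof -
    have "0 \<le> (\<integral>\<zeta>. (norm (f \<zeta>) - t * norm (g \<zeta>))\<^sup>2 \<partial>circle_measure)" by simp
    also have "\<dots> = (\<integral>\<zeta>. (norm (f \<zeta>))\<^sup>2 - (2 * t) * (norm (f \<zeta>) * norm (g \<zeta>)) + t\<^sup>2 * (norm (g \<zeta>))\<^sup>2 \<partial>circle_measure)"
      by (rule Bochner_Integration.integral_cong) (auto simp: power2_diff power_mult_distrib)
    also have "\<dots> = F - 2 * t * P + t\<^sup>2 * G"
      unfolding F_def G_def P_def using L2_integrable[OF f] L2_integrable[OF g] L2_norm_prod_integrable[OF f g] by simp
    finally show ?thesis .
  qed
  have F0: "0 \<le> F" and G0: "0 \<le> G" and P0: "0 \<le> P" by (simp_all add: F_def G_def P_def)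
  have "P\<^sup>2 \<le> F * G"
  proof (cases "G = 0")
    case True
    have "P = 0"
    proof (rule ccontr)
      assume "P \<noteq> 0"
      then have "P > 0" using P0 by simp
      then show False using q[of "(F + 1) / P"] True F0 by simp
    qed
    then show ?thesis using True by simp
  next
    case False
    then have "0 \<le> F - 2 * (P / G) * P + (P / G)\<^sup>2 * G" "G > 0" using q[of "P / G"] G0 by auto
    then show ?thesis by (simp add: field_simps power2_eq_square)
  qed
  then have "P \<le> sqrt F * sqrt G" by (metis real_le_rsqrt real_sqrt_mult)
  moreover have "norm (\<integral>\<zeta>. f \<zeta> * cnj (g \<zeta>) \<partial>circle_measure) \<le> P"
    unfolding P_def using integral_norm_bound[of circle_measure "\<lambda>\<zeta>. f \<zeta> * cnj (g \<zeta>)"] by (simp add: norm_mult)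
  ultimately show ?thesis unfolding F_def G_def by linarith
qed

lemma L2_lincomb:
  assumes "f \<in> L2_circle" "g \<in> L2_circle" shows "(\<lambda>\<zeta>. c * f \<zeta> + d * g \<zeta>) \<in> L2_circle"
proof (rule L2_I)
  note [measurable] = L2_measurable[OF assms(1)] L2_measurable[OF assms(2)]
  show "(\<lambda>\<zeta>. c * f \<zeta> + d * g \<zeta>) \<in> borel_measurable borel" by measurable
  show "integrable circle_measure (\<lambda>\<zeta>. (norm (c * f \<zeta> + d * g \<zeta>))\<^sup>2)"
    by (rule Bochner_Integration.integrable_bound[of _ "\<lambda>\<zeta>. 2 * (norm c)\<^sup>2 * (norm (f \<zeta>))\<^sup>2 + 2 * (norm d)\<^sup>2 * (norm (g \<zeta>))\<^sup>2"])
       (use assms norm_lincomb_square in \<open>auto simp: L2_integrable intro: order_trans[OF _ abs_ge_self]\<close>)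
qed

lemma L2_diff: "f \<in> L2_circle \<Longrightarrow> g \<in> L2_circle \<Longrightarrow> (\<lambda>\<zeta>. f \<zeta> - g \<zeta>) \<in> L2_circle"
  using L2_lincomb[of f g 1 "-1"] by simp

lemma L2_dilate: "0 \<le> r \<Longrightarrow> r < 1 \<Longrightarrow> (\<lambda>\<zeta>. fn f (of_real r * \<zeta>)) \<in> L2_circle"
  by (rule L2_I) (auto intro: dilate_integrable intro!: measurable_compose[OF _ measurable_disk[OF fn_disk]])

lemma integral_real_le_nn:
  assumes "\<And>x. 0 \<le> h x" "h \<in> borel_measurable M" "(\<integral>\<^sup>+x. ennreal (h x) \<partial>M) \<le> ennreal c" "0 \<le> c"
  shows "integrable M h" "integral\<^sup>L M h \<le> c"
proof -
  show "integrable M h"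
    by (rule integrableI_bounded) (use assms in \<open>auto simp: abs_of_nonneg intro: le_less_trans\<close>)
  show "integral\<^sup>L M h \<le> c" by (rule integral_real_bounded) (use assms in auto)
qed

text \<open>The squared distance in \<open>H2\<close> between f and its dilate z |-> f(rz), whose
  coefficients are those of f times r^n.\<close>

definition dilate_err :: "hardy \<Rightarrow> real \<Rightarrow> real" where
  "dilate_err f r = (\<Sum>n. (norm (hcoef f n))\<^sup>2 * (1 - r ^ n)\<^sup>2)"

lemma dilate_err_summable:
  assumes "0 \<le> r" "r < 1" shows "summable (\<lambda>n. (norm (hcoef f n))\<^sup>2 * (1 - r ^ n)\<^sup>2)"
proof (rule summable_comparison_test'[OF hcoef_summable[of f], of 0])
  show "norm ((norm (hcoef f n))\<^sup>2 * (1 - r ^ n)\<^sup>2) \<le> (norm (hcoef f n))\<^sup>2" for n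
    using assms power_le_one[of r n] by (simp add: mult_right_le_one_le power_le_one abs_mult)
qed

lemma dilate_err_nonneg: "0 \<le> r \<Longrightarrow> r < 1 \<Longrightarrow> 0 \<le> dilate_err f r"
  unfolding dilate_err_def by (intro suminf_nonneg dilate_err_summable) auto

lemma dilate_err_tendsto: "(dilate_err f \<longlongrightarrow> 0) (at_left 1)"
proof -
  have "((\<lambda>r. \<Sum>n. (norm (hcoef f n))\<^sup>2 * (1 - r ^ n)\<^sup>2) \<longlongrightarrow> (\<Sum>n. 0)) (at_left (1::real))"
  proof (rule tannerys_theorem[where M="\<lambda>n. (norm (hcoef f n))\<^sup>2", THEN conjunct2, THEN conjunct2])
    fix n
    have "((\<lambda>r. (norm (hcoef f n))\<^sup>2 * (1 - r ^ n)\<^sup>2) \<longlongrightarrow> (norm (hcoef f n))\<^sup>2 * (1 - 1 ^ n)\<^sup>2) (at_left (1::real))"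
      by (intro tendsto_intros)
    then show "((\<lambda>r. (norm (hcoef f n))\<^sup>2 * (1 - r ^ n)\<^sup>2) \<longlongrightarrow> 0) (at_left (1::real))" by simp
  next
    have "\<forall>\<^sub>F r in at_left (1::real). r \<in> {0<..<1}" by (rule eventually_at_leftI[of 0]) auto
    then have "\<forall>\<^sub>F r in at_left (1::real). \<forall>k. norm ((norm (hcoef f k))\<^sup>2 * (1 - r ^ k)\<^sup>2) \<le> (norm (hcoef f k))\<^sup>2"
    proof eventually_elim
      case (elim r)
      then show ?case using power_le_one[of r]
        by (auto simp: abs_mult intro!: mult_right_le_one_le power_le_one)
    qed
    then have "\<forall>\<^sub>F x in sequentially \<times>\<^sub>F at_left (1::real). \<forall>k. norm ((norm (hcoef f k))\<^sup>2 * (1 - (snd x) ^ k)\<^sup>2) \<le> (norm (hcoef f k))\<^sup>2"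
      by (rule eventually_compose_filterlim[OF _ filterlim_snd])
    then show "\<forall>\<^sub>F (k, r) in sequentially \<times>\<^sub>F at_left (1::real). norm ((norm (hcoef f k))\<^sup>2 * (1 - r ^ k)\<^sup>2) \<le> (norm (hcoef f k))\<^sup>2"
      by eventually_elim auto
  qed auto
  then show ?thesis by (simp add: dilate_err_def[abs_def])
qed

lemma norm_diff_square: "(norm (x - y :: complex))\<^sup>2 = (norm x)\<^sup>2 + (norm y)\<^sup>2 - 2 * Re (x * cnj y)"
  unfolding cmod_power2 by (simp add: power2_eq_square algebra_simps)

lemma dilate_diff_le:
  assumes r: "0 \<le> r" "r < 1" and s: "0 \<le> s" "s < 1"
  shows "(sqint (\<lambda>\<zeta>. fn f (of_real r * \<zeta>) - fn f (of_real s * \<zeta>))) \<le> dilate_err f r + dilate_err f s"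
proof -
  define c where "c n = (norm (hcoef f n))\<^sup>2" for n
  have "(\<lambda>n. complex_of_real (c n * (r * s) ^ n)) sums (\<integral>\<zeta>. fn f (of_real r * \<zeta>) * cnj (fn f (of_real s * \<zeta>)) \<partial>circle_measure)"
    using parseval_dilate[OF fn_disk fn_disk r s, of f f] by (simp add: c_def complex_norm_square[symmetric])
  then have x: "(\<lambda>n. c n * (r * s) ^ n) sums Re (\<integral>\<zeta>. fn f (of_real r * \<zeta>) * cnj (fn f (of_real s * \<zeta>)) \<partial>circle_measure)"
    using sums_Re by fastforce
  define FR FS X where "FR = (sqint (\<lambda>\<zeta>. fn f (of_real r * \<zeta>)))"
    and "FS = (sqint (\<lambda>\<zeta>. fn f (of_real s * \<zeta>)))"
    and "X = Re (\<integral>\<zeta>. fn f (of_real r * \<zeta>) * cnj (fn f (of_real s * \<zeta>)) \<partial>circle_measure)"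
  have i: "integrable circle_measure (\<lambda>\<zeta>. fn f (of_real r * \<zeta>) * cnj (fn f (of_real s * \<zeta>)))"
    by (rule L2_prod_integrable[OF L2_dilate[OF r] L2_dilate[OF s]])
  define h where "h \<zeta> = fn f (of_real r * \<zeta>) * cnj (fn f (of_real s * \<zeta>))" for \<zeta>
  have ih: "integrable circle_measure h" unfolding h_def by (rule i)
  have "(sqint (\<lambda>\<zeta>. fn f (of_real r * \<zeta>) - fn f (of_real s * \<zeta>))) =
    (\<integral>\<zeta>. (norm (fn f (of_real r * \<zeta>)))\<^sup>2 + (norm (fn f (of_real s * \<zeta>)))\<^sup>2 - 2 * Re (h \<zeta>) \<partial>circle_measure)"
    unfolding h_def by (rule Bochner_Integration.integral_cong[OF refl norm_diff_square])
  also have "\<dots> = FR + FS - 2 * (\<integral>\<zeta>. Re (h \<zeta>) \<partial>circle_measure)"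
    unfolding FR_def FS_def
    using integrable_Re[OF ih] L2_integrable[OF L2_dilate[OF r]] L2_integrable[OF L2_dilate[OF s]] by simp
  also have "(\<integral>\<zeta>. Re (h \<zeta>) \<partial>circle_measure) = X"
    unfolding X_def using ih by (simp add: h_def[abs_def] integral_Re del: times_complex.simps)
  finally have eq: "(sqint (\<lambda>\<zeta>. fn f (of_real r * \<zeta>) - fn f (of_real s * \<zeta>))) = FR + FS - 2 * X" .
  have S: "(\<lambda>n. c n * (r\<^sup>2) ^ n + c n * (s\<^sup>2) ^ n - 2 * (c n * (r * s) ^ n)) sums (FR + FS - 2 * X)"
    unfolding FR_def FS_def X_def c_def
    by (intro sums_add sums_diff sums_mult norm_dilate_sums[OF fn_disk r] norm_dilate_sums[OF fn_disk s] x[unfolded c_def])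
  have "FR + FS - 2 * X \<le> dilate_err f r + dilate_err f s"
  proof (rule sums_le[OF _ S])
    show "(\<lambda>n. c n * (1 - r ^ n)\<^sup>2 + c n * (1 - s ^ n)\<^sup>2) sums (dilate_err f r + dilate_err f s)"
      unfolding dilate_err_def c_def
      by (intro sums_add summable_sums dilate_err_summable r s)
    fix n
    \<comment> \<open>Both 1 - r^n and 1 - s^n are nonnegative, so the cross term has the favourable
      sign and the squared errors add without a factor 2.\<close>
    have "(r ^ n - s ^ n)\<^sup>2 \<le> (1 - r ^ n)\<^sup>2 + (1 - s ^ n)\<^sup>2"
    proof -
      have "0 \<le> (1 - r ^ n) * (1 - s ^ n)" using r s by (simp add: power_le_one)
      moreover have "(r ^ n - s ^ n)\<^sup>2 = (1 - r ^ n)\<^sup>2 + (1 - s ^ n)\<^sup>2 - 2 * ((1 - r ^ n) * (1 - s ^ n))"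
        by (simp add: power2_eq_square algebra_simps)
      ultimately show ?thesis by linarith
    qed
    then have "c n * (r ^ n - s ^ n)\<^sup>2 \<le> c n * ((1 - r ^ n)\<^sup>2 + (1 - s ^ n)\<^sup>2)"
      by (intro mult_left_mono) (auto simp: c_def)
    moreover have "c n * (r\<^sup>2) ^ n + c n * (s\<^sup>2) ^ n - 2 * (c n * (r * s) ^ n) = c n * (r ^ n - s ^ n)\<^sup>2"
      by (simp add: power2_eq_square power_mult_distrib algebra_simps)
    ultimately show "c n * (r\<^sup>2) ^ n + c n * (s\<^sup>2) ^ n - 2 * (c n * (r * s) ^ n) \<le> c n * (1 - r ^ n)\<^sup>2 + c n * (1 - s ^ n)\<^sup>2"
      by (simp add: algebra_simps)
  qed
  then show ?thesis using eq by simp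
qed

text \<open>Riesz--Fischer: along a sufficiently fast sequence of radii the dilates converge almost
  everywhere; Fatou's lemma identifies the limit as the limit in mean square.\<close>

lemma ex_bdry:
  "\<exists>g. g \<in> L2_circle \<and> ((\<lambda>r. sqint (\<lambda>\<zeta>. fn f (of_real r * \<zeta>) - g \<zeta>)) \<longlongrightarrow> 0) (at_left (1::real))"
proof -
  have "\<exists>r. 0 \<le> r \<and> r < 1 \<and> dilate_err f r < (1/8)^k" for k :: nat
  proof -
    have "\<forall>\<^sub>F r in at_left (1::real). r \<in> {0<..<1}" by (rule eventually_at_leftI[of 0]) auto
    moreover have "\<forall>\<^sub>F r in at_left (1::real). dilate_err f r < (1/8)^k"
      using order_tendstoD(2)[OF dilate_err_tendsto[of f], of "(1/8)^k"] by simp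
    ultimately have "\<forall>\<^sub>F r in at_left (1::real). r \<in> {0<..<1} \<and> dilate_err f r < (1/8)^k" by eventually_elim simp
    from eventually_happens'[OF trivial_limit_at_left_real this]
    obtain r where "r \<in> {0<..<1} \<and> dilate_err f r < (1/8)^k" ..
    then show ?thesis by (intro exI[of _ r]) auto
  qed
  \<comment> \<open>Errors of size \<open>(1/8) ^ k\<close> survive the weights \<open>2 ^ k\<close>
    used next and leave the summable \<open>(1/4) ^ k\<close>.\<close>
  then obtain r where r: "\<And>k::nat. 0 \<le> r k" "\<And>k. r k < 1" "\<And>k. dilate_err f (r k) < (1/8)^k" by metis
  define u where "u k \<zeta> = fn f (of_real (r k) * \<zeta>)" for k \<zeta>
  have um [measurable]: "u k \<in> borel_measurable borel" for k
    unfolding u_def by (rule measurable_compose[OF _ measurable_disk[OF fn_disk]]) measurable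
  have uL: "u k \<in> L2_circle" for k unfolding u_def using r by (intro L2_dilate) auto
  have inc: "(\<integral>\<^sup>+\<zeta>. ennreal (2^k * (norm (u (Suc k) \<zeta> - u k \<zeta>))\<^sup>2) \<partial>circle_measure) \<le> ennreal (2 * (1/4)^k)" for k
  proof -
    have "(sqint (\<lambda>\<zeta>. u (Suc k) \<zeta> - u k \<zeta>)) \<le> dilate_err f (r (Suc k)) + dilate_err f (r k)"
      unfolding u_def by (rule dilate_diff_le) (use r in auto)
    also have "\<dots> \<le> 2 * (1/8)^k" using r(3)[of k] r(3)[of "Suc k"] zero_le_power[of "1/8::real" k] unfolding power_Suc by linarith
    finally have "2^k * (sqint (\<lambda>\<zeta>. u (Suc k) \<zeta> - u k \<zeta>)) \<le> 2^k * (2 * (1/8)^k)"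
      by (rule mult_left_mono) simp
    also have "\<dots> = 2 * (1/4)^k" by (simp add: power_mult_distrib[symmetric])
    finally show ?thesis
      using L2_integrable[OF L2_diff[OF uL uL]] by (subst nn_integral_eq_integral) (auto intro: ennreal_leI)
  qed
  have "(\<integral>\<^sup>+\<zeta>. (\<Sum>k. ennreal (2^k * (norm (u (Suc k) \<zeta> - u k \<zeta>))\<^sup>2)) \<partial>circle_measure) =
      (\<Sum>k. \<integral>\<^sup>+\<zeta>. ennreal (2^k * (norm (u (Suc k) \<zeta> - u k \<zeta>))\<^sup>2) \<partial>circle_measure)"
    by (rule nn_integral_suminf) measurable
  also have "\<dots> \<le> (\<Sum>k. ennreal (2 * (1/4)^k))" by (rule suminf_le) (use inc in auto)
  also have "\<dots> < \<infinity>"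
    by (subst suminf_ennreal2) (auto intro!: summable_mult summable_geometric)
  finally have fin: "(\<integral>\<^sup>+\<zeta>. (\<Sum>k. ennreal (2^k * (norm (u (Suc k) \<zeta> - u k \<zeta>))\<^sup>2)) \<partial>circle_measure) \<noteq> \<infinity>" by simp
  have "AE \<zeta> in circle_measure. (\<Sum>k. ennreal (2^k * (norm (u (Suc k) \<zeta> - u k \<zeta>))\<^sup>2)) \<noteq> \<infinity>"
    by (rule nn_integral_PInf_AE[OF _ fin]) measurable
  then have conv: "AE \<zeta> in circle_measure. convergent (\<lambda>k. u k \<zeta>)"
  proof eventually_elim
    case (elim \<zeta>)
    have sm: "summable (\<lambda>k. 2^k * (norm (u (Suc k) \<zeta> - u k \<zeta>))\<^sup>2)"
      by (rule summable_suminf_not_top) (use elim in auto)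
    \<comment> \<open>The weights turn finiteness of a sum of squares into geometric decay of the
      single increments, at almost every point.\<close>
    define C where "C = (\<Sum>k. 2^k * (norm (u (Suc k) \<zeta> - u k \<zeta>))\<^sup>2)"
    have "norm (u (Suc k) \<zeta> - u k \<zeta>) \<le> sqrt C * sqrt (1/2) ^ k" for k
    proof -
      have "2^k * (norm (u (Suc k) \<zeta> - u k \<zeta>))\<^sup>2 \<le> C"
        unfolding C_def using sum_le_suminf[OF sm, of "{k}"] by simp
      then have "(norm (u (Suc k) \<zeta> - u k \<zeta>))\<^sup>2 \<le> C * (1/2)^k" by (simp add: field_simps power_divide)
      then have "norm (u (Suc k) \<zeta> - u k \<zeta>) \<le> sqrt (C * (1/2)^k)" by (rule real_le_rsqrt)
      then show ?thesis by (simp add: real_sqrt_mult real_sqrt_power)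
    qed
    note le = this
    have "summable (\<lambda>k. sqrt C * sqrt (1/2) ^ k)" by (intro summable_mult summable_geometric) auto
    then have "summable (\<lambda>k. u (Suc k) \<zeta> - u k \<zeta>)" by (rule summable_comparison_test'[where N=0]) (rule le)
    then obtain l where "(\<lambda>k. \<Sum>j<k. u (Suc j) \<zeta> - u j \<zeta>) \<longlonglongrightarrow> l" unfolding summable_def sums_def ..
    then have "(\<lambda>k. u k \<zeta> - u 0 \<zeta>) \<longlonglongrightarrow> l" unfolding sum_lessThan_telescope[of "\<lambda>j. u j \<zeta>"] .
    then have "(\<lambda>k. u k \<zeta> - u 0 \<zeta> + u 0 \<zeta>) \<longlonglongrightarrow> l + u 0 \<zeta>" by (intro tendsto_intros)
    then show ?case unfolding convergent_def by (intro exI[of _ "l + u 0 \<zeta>"]) simp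
  qed
  define g where "g \<zeta> = lim (\<lambda>k. u k \<zeta>)" for \<zeta>
  have gm [measurable]: "g \<in> borel_measurable borel" unfolding g_def by measurable
  have main: "integrable circle_measure (\<lambda>\<zeta>. (norm (fn f (of_real s * \<zeta>) - g \<zeta>))\<^sup>2)"
    "(sqint (\<lambda>\<zeta>. fn f (of_real s * \<zeta>) - g \<zeta>)) \<le> dilate_err f s" if s: "0 \<le> s" "s < 1" for s
  proof -
    have [measurable]: "(\<lambda>\<zeta>. fn f (of_real s * \<zeta>)) \<in> borel_measurable borel" by (rule L2_measurable[OF L2_dilate[OF s]])
    have "(\<integral>\<^sup>+\<zeta>. ennreal ((norm (fn f (of_real s * \<zeta>) - g \<zeta>))\<^sup>2) \<partial>circle_measure) =
      (\<integral>\<^sup>+\<zeta>. liminf (\<lambda>k. ennreal ((norm (fn f (of_real s * \<zeta>) - u k \<zeta>))\<^sup>2)) \<partial>circle_measure)"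
    proof (rule nn_integral_cong_AE)
      show "AE \<zeta> in circle_measure. ennreal ((norm (fn f (of_real s * \<zeta>) - g \<zeta>))\<^sup>2) = liminf (\<lambda>k. ennreal ((norm (fn f (of_real s * \<zeta>) - u k \<zeta>))\<^sup>2))"
        using conv
      proof eventually_elim
        case (elim \<zeta>)
        then have "(\<lambda>k. u k \<zeta>) \<longlonglongrightarrow> g \<zeta>" by (simp add: g_def convergent_LIMSEQ_iff)
        then have "(\<lambda>k. ennreal ((norm (fn f (of_real s * \<zeta>) - u k \<zeta>))\<^sup>2)) \<longlonglongrightarrow> ennreal ((norm (fn f (of_real s * \<zeta>) - g \<zeta>))\<^sup>2)"
          by (intro tendsto_intros)
        then show ?case by (intro lim_imp_Liminf[symmetric]) auto
      qed
    qed
    also have "\<dots> \<le> liminf (\<lambda>k. \<integral>\<^sup>+\<zeta>. ennreal ((norm (fn f (of_real s * \<zeta>) - u k \<zeta>))\<^sup>2) \<partial>circle_measure)"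
      by (rule nn_integral_liminf) measurable
    also have "\<dots> \<le> liminf (\<lambda>k. ennreal (dilate_err f s + (1/8)^k))"
    proof (rule Liminf_mono, rule always_eventually, rule allI)
      fix k
      have "(sqint (\<lambda>\<zeta>. fn f (of_real s * \<zeta>) - u k \<zeta>)) \<le> dilate_err f s + dilate_err f (r k)"
        unfolding u_def by (rule dilate_diff_le) (use r s in auto)
      also have "\<dots> \<le> dilate_err f s + (1/8)^k" using r(3)[of k] by simp
      finally show "(\<integral>\<^sup>+\<zeta>. ennreal ((norm (fn f (of_real s * \<zeta>) - u k \<zeta>))\<^sup>2) \<partial>circle_measure) \<le> ennreal (dilate_err f s + (1/8)^k)"
        using L2_integrable[OF L2_diff[OF L2_dilate[OF s] uL]] by (subst nn_integral_eq_integral) (auto intro: ennreal_leI)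
    qed
    also have "\<dots> = ennreal (dilate_err f s + 0)"
      by (intro lim_imp_Liminf tendsto_intros LIMSEQ_realpow_zero) auto
    finally have le: "(\<integral>\<^sup>+\<zeta>. ennreal ((norm (fn f (of_real s * \<zeta>) - g \<zeta>))\<^sup>2) \<partial>circle_measure) \<le> ennreal (dilate_err f s)" by simp
    show "integrable circle_measure (\<lambda>\<zeta>. (norm (fn f (of_real s * \<zeta>) - g \<zeta>))\<^sup>2)"
      "(sqint (\<lambda>\<zeta>. fn f (of_real s * \<zeta>) - g \<zeta>)) \<le> dilate_err f s"
      using integral_real_le_nn[OF _ _ le] dilate_err_nonneg[OF s] by auto
  qed
  \<comment> \<open>The limit is a dilate minus its error, both square integrable; the radius 0 is
    an arbitrary choice.\<close>
  have "(\<lambda>\<zeta>. fn f (of_real 0 * \<zeta>) - (fn f (of_real 0 * \<zeta>) - g \<zeta>)) \<in> L2_circle"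
  proof (rule L2_diff[OF L2_dilate L2_I])
    show "integrable circle_measure (\<lambda>\<zeta>. (norm (fn f (of_real 0 * \<zeta>) - g \<zeta>))\<^sup>2)" by (rule main) auto
  qed auto
  then have "g \<in> L2_circle" by simp
  moreover have "((\<lambda>r. sqint (\<lambda>\<zeta>. fn f (of_real r * \<zeta>) - g \<zeta>)) \<longlongrightarrow> 0) (at_left (1::real))"
  proof (rule tendsto_sandwich[OF _ _ tendsto_const dilate_err_tendsto])
    have "\<forall>\<^sub>F r in at_left (1::real). r \<in> {0<..<1}" by (rule eventually_at_leftI[of 0]) auto
    then show "\<forall>\<^sub>F r in at_left (1::real). (sqint (\<lambda>\<zeta>. fn f (of_real r * \<zeta>) - g \<zeta>)) \<le> dilate_err f r"
      by eventually_elim (use main in auto)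
  qed simp
  ultimately show ?thesis by blast
qed

abbreviation bd :: "hardy \<Rightarrow> complex \<Rightarrow> complex" where "bd f \<equiv> bdry (fn f)"

lemma bd_L2: "bd f \<in> L2_circle"
  and bd_tendsto: "((\<lambda>r. sqint (\<lambda>\<zeta>. fn f (of_real r * \<zeta>) - bd f \<zeta>)) \<longlongrightarrow> 0) (at_left (1::real))"
  using someI_ex[OF ex_bdry[of f]] by (auto simp: bdry_def)

text \<open>The given sequence of radii is arbitrary, so that extractions for several functions can
  be nested.\<close>

lemma bd_AE_subseq:
  assumes s: "\<And>n::nat. 0 \<le> s n" "\<And>n. s n < 1" "s \<longlonglongrightarrow> 1"
  shows "\<exists>q::nat\<Rightarrow>nat. strict_mono q \<and> (AE \<zeta> in circle_measure. (\<lambda>n. fn f (of_real (s (q n)) * \<zeta>)) \<longlonglongrightarrow> bd f \<zeta>)"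
proof -
  have sl: "filterlim s (at_left 1) sequentially"
    using s by (auto simp: filterlim_at intro!: always_eventually less_imp_neq)
  have lim: "(\<lambda>n. sqint (\<lambda>\<zeta>. fn f (of_real (s n) * \<zeta>) - bd f \<zeta>)) \<longlonglongrightarrow> 0"
    by (rule filterlim_compose[OF bd_tendsto sl])
  obtain q where q: "strict_mono (q::nat\<Rightarrow>nat)"
    "AE \<zeta> in circle_measure. (\<lambda>n. (norm (fn f (of_real (s (q n)) * \<zeta>) - bd f \<zeta>))\<^sup>2) \<longlonglongrightarrow> 0"
    using tendsto_L1_AE_subseq[of circle_measure "\<lambda>n \<zeta>. (norm (fn f (of_real (s n) * \<zeta>) - bd f \<zeta>))\<^sup>2"]
      L2_integrable[OF L2_diff[OF L2_dilate[OF s(1,2)] bd_L2]] lim by auto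
  have "AE \<zeta> in circle_measure. (\<lambda>n. fn f (of_real (s (q n)) * \<zeta>)) \<longlonglongrightarrow> bd f \<zeta>"
    using q(2)
  proof eventually_elim
    case (elim \<zeta>)
    then have "(\<lambda>n. norm (fn f (of_real (s (q n)) * \<zeta>) - bd f \<zeta>)) \<longlonglongrightarrow> 0"
      using tendsto_real_sqrt[OF elim] by simp
    then show ?case by (simp add: tendsto_norm_zero_iff LIM_zero_iff)
  qed
  then show ?thesis using q(1) by blast
qed

text \<open>\<open>bdry\<close> chooses some mean-square limit of the dilates. Along a subsequence
  it is also a pointwise limit, so it agrees almost everywhere with a radial limit when there is
  one.\<close>

lemma bd_radial:
  assumes "AE \<zeta> in circle_measure. ((\<lambda>r. fn f (of_real r * \<zeta>)) \<longlongrightarrow> g \<zeta>) (at_left 1)"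
  shows "AE \<zeta> in circle_measure. bd f \<zeta> = g \<zeta>"
proof -
  obtain q where q: "strict_mono q" "AE \<zeta> in circle_measure. (\<lambda>n. fn f (of_real (radii (q n)) * \<zeta>)) \<longlonglongrightarrow> bd f \<zeta>"
    using bd_AE_subseq[of radii f] radii by blast
  have sl: "filterlim (\<lambda>n. radii (q n)) (at_left 1) sequentially"
    using radii LIMSEQ_subseq_LIMSEQ[OF radii(4) q(1)]
    by (auto simp: filterlim_at o_def intro!: always_eventually less_imp_neq)
  show ?thesis using q(2) assms
  proof eventually_elim
    case (elim \<zeta>)
    show ?case by (rule LIMSEQ_unique[OF elim(1) filterlim_compose[OF elim(2) sl]])
  qed
qed

text \<open>Mean-square limits do not multiply, pointwise limits do: three successive extractions
  give one sequence of radii that works for f, g and the product.\<close>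

lemma bd_mult:
  assumes "\<And>z. norm z < 1 \<Longrightarrow> fn h z = fn f z * fn g z"
  shows "AE \<zeta> in circle_measure. bd h \<zeta> = bd f \<zeta> * bd g \<zeta>"
proof -
  obtain p where p: "strict_mono p" "AE \<zeta> in circle_measure. (\<lambda>n. fn f (of_real (radii (p n)) * \<zeta>)) \<longlonglongrightarrow> bd f \<zeta>"
    using bd_AE_subseq[of radii f] radii by blast
  have p1: "(\<lambda>n. radii (p n)) \<longlonglongrightarrow> 1" using LIMSEQ_subseq_LIMSEQ[OF radii(4) p(1)] by (simp add: o_def)
  obtain q where q: "strict_mono q" "AE \<zeta> in circle_measure. (\<lambda>n. fn g (of_real (radii (p (q n))) * \<zeta>)) \<longlonglongrightarrow> bd g \<zeta>"
    using bd_AE_subseq[of "\<lambda>n. radii (p n)" g] radii p1 by blast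
  have q1: "(\<lambda>n. radii (p (q n))) \<longlonglongrightarrow> 1" using LIMSEQ_subseq_LIMSEQ[OF p1 q(1)] by (simp add: o_def)
  obtain t where t: "strict_mono t" "AE \<zeta> in circle_measure. (\<lambda>n. fn h (of_real (radii (p (q (t n)))) * \<zeta>)) \<longlonglongrightarrow> bd h \<zeta>"
    using bd_AE_subseq[of "\<lambda>n. radii (p (q n))" h] radii q1 by blast
  show ?thesis using p(2) q(2) t(2) AE_circle_norm
  proof eventually_elim
    case (elim \<zeta>)
    have "(\<lambda>n. fn f (of_real (radii (p (q (t n)))) * \<zeta>)) \<longlonglongrightarrow> bd f \<zeta>"
      using LIMSEQ_subseq_LIMSEQ[OF elim(1) strict_mono_o[OF q(1) t(1)]] by (simp add: o_def)
    moreover have "(\<lambda>n. fn g (of_real (radii (p (q (t n)))) * \<zeta>)) \<longlonglongrightarrow> bd g \<zeta>"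
      using LIMSEQ_subseq_LIMSEQ[OF elim(2) t(1)] by (simp add: o_def)
    ultimately have "(\<lambda>n. fn f (of_real (radii (p (q (t n)))) * \<zeta>) * fn g (of_real (radii (p (q (t n)))) * \<zeta>)) \<longlonglongrightarrow> bd f \<zeta> * bd g \<zeta>"
      by (rule tendsto_mult)
    moreover have "norm (of_real (radii (p (q (t n)))) * \<zeta>) < 1" for n
      using radii(1-3)[of "p (q (t n))"] elim(4) by (simp add: norm_mult)
    ultimately have "(\<lambda>n. fn h (of_real (radii (p (q (t n)))) * \<zeta>)) \<longlonglongrightarrow> bd f \<zeta> * bd g \<zeta>"
      using assms by simp
    then show ?case using elim(3) LIMSEQ_unique by blast
  qed
qed

text \<open>Both sides are limits of the inner products of dilates: Cauchy-Schwarz leads to the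
  boundary functions, dominated convergence of series to the coefficients.\<close>

lemma L2_inner_bd: "L2_inner (bd f) (bd g) = cinner f g"
proof (rule LIMSEQ_unique)
  note rd = radii(2,3)
  let ?f = "\<lambda>n \<zeta>. fn f (of_real (radii n) * \<zeta>)" and ?g = "\<lambda>n \<zeta>. fn g (of_real (radii n) * \<zeta>)"
  have fL: "?f n \<in> L2_circle" and gL: "?g n \<in> L2_circle" for n by (rule L2_dilate[OF rd])+
  have sl: "filterlim radii (at_left 1) sequentially"
    using radii by (auto simp: filterlim_at intro!: always_eventually less_imp_neq)
  have df: "(\<lambda>n. sqrt (sqint (\<lambda>\<zeta>. ?f n \<zeta> - bd f \<zeta>))) \<longlonglongrightarrow> 0"
    and dg: "(\<lambda>n. sqrt (sqint (\<lambda>\<zeta>. ?g n \<zeta> - bd g \<zeta>))) \<longlonglongrightarrow> 0"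
    using tendsto_real_sqrt[OF filterlim_compose[OF bd_tendsto sl]] by auto
  have "(\<lambda>n. (\<integral>\<zeta>. ?f n \<zeta> * cnj (?g n \<zeta>) \<partial>circle_measure) - L2_inner (bd f) (bd g)) \<longlonglongrightarrow> 0"
  proof (rule tendsto_norm_zero_cancel, rule tendsto_sandwich[OF _ _ tendsto_const])
    define G where "G = sqrt (sqint (\<lambda>\<zeta>. bd g \<zeta>))"
    have "norm ((\<integral>\<zeta>. ?f n \<zeta> * cnj (?g n \<zeta>) \<partial>circle_measure) - L2_inner (bd f) (bd g)) \<le>
      norm f * sqrt (sqint (\<lambda>\<zeta>. ?g n \<zeta> - bd g \<zeta>)) + sqrt (sqint (\<lambda>\<zeta>. ?f n \<zeta> - bd f \<zeta>)) * G" for n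
    proof -
      have i: "integrable circle_measure (\<lambda>\<zeta>. ?f n \<zeta> * cnj (?g n \<zeta>))" "integrable circle_measure (\<lambda>\<zeta>. bd f \<zeta> * cnj (bd g \<zeta>))"
         "integrable circle_measure (\<lambda>\<zeta>. ?f n \<zeta> * cnj (?g n \<zeta> - bd g \<zeta>))" "integrable circle_measure (\<lambda>\<zeta>. (?f n \<zeta> - bd f \<zeta>) * cnj (bd g \<zeta>))"
        by (intro L2_prod_integrable fL gL bd_L2 L2_diff)+
      have "(\<integral>\<zeta>. ?f n \<zeta> * cnj (?g n \<zeta>) \<partial>circle_measure) - L2_inner (bd f) (bd g) =
        (\<integral>\<zeta>. ?f n \<zeta> * cnj (?g n \<zeta>) - bd f \<zeta> * cnj (bd g \<zeta>) \<partial>circle_measure)"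
        unfolding L2_inner_def using i by simp
      also have "\<dots> = (\<integral>\<zeta>. ?f n \<zeta> * cnj (?g n \<zeta> - bd g \<zeta>) + (?f n \<zeta> - bd f \<zeta>) * cnj (bd g \<zeta>) \<partial>circle_measure)"
        by (rule Bochner_Integration.integral_cong) (auto simp: algebra_simps)
      also have "\<dots> = (\<integral>\<zeta>. ?f n \<zeta> * cnj (?g n \<zeta> - bd g \<zeta>) \<partial>circle_measure) + (\<integral>\<zeta>. (?f n \<zeta> - bd f \<zeta>) * cnj (bd g \<zeta>) \<partial>circle_measure)"
        by (rule Bochner_Integration.integral_add[OF i(3,4)])
      finally have eq: "(\<integral>\<zeta>. ?f n \<zeta> * cnj (?g n \<zeta>) \<partial>circle_measure) - L2_inner (bd f) (bd g) =
        (\<integral>\<zeta>. ?f n \<zeta> * cnj (?g n \<zeta> - bd g \<zeta>) \<partial>circle_measure) + (\<integral>\<zeta>. (?f n \<zeta> - bd f \<zeta>) * cnj (bd g \<zeta>) \<partial>circle_measure)" .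
      have le: "norm ((\<integral>\<zeta>. ?f n \<zeta> * cnj (?g n \<zeta>) \<partial>circle_measure) - L2_inner (bd f) (bd g)) \<le> sqrt (sqint (\<lambda>\<zeta>. ?f n \<zeta>)) * sqrt (sqint (\<lambda>\<zeta>. ?g n \<zeta> - bd g \<zeta>))
          + sqrt (sqint (\<lambda>\<zeta>. ?f n \<zeta> - bd f \<zeta>)) * G"
        unfolding G_def eq
        by (rule order_trans[OF norm_triangle_ineq add_mono]; rule L2_cauchy_schwarz; intro fL gL bd_L2 L2_diff)
      have "sqrt (sqint (\<lambda>\<zeta>. ?f n \<zeta>)) \<le> norm f"
        by (rule real_le_lsqrt) (use norm_dilate_le[OF rd(1)[of n] rd(2)[of n], of f] in auto)
      then show ?thesis by (intro order_trans[OF le] add_right_mono mult_right_mono) auto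
    qed
    then show "\<forall>\<^sub>F n in sequentially. norm ((\<integral>\<zeta>. ?f n \<zeta> * cnj (?g n \<zeta>) \<partial>circle_measure) - L2_inner (bd f) (bd g)) \<le>
      norm f * sqrt (sqint (\<lambda>\<zeta>. ?g n \<zeta> - bd g \<zeta>)) + sqrt (sqint (\<lambda>\<zeta>. ?f n \<zeta> - bd f \<zeta>)) * G"
      by simp
    have "(\<lambda>n. norm f * sqrt (sqint (\<lambda>\<zeta>. ?g n \<zeta> - bd g \<zeta>)) + sqrt (sqint (\<lambda>\<zeta>. ?f n \<zeta> - bd f \<zeta>)) * G)
       \<longlonglongrightarrow> norm f * 0 + 0 * G" by (intro tendsto_intros df dg)
    then show "(\<lambda>n. norm f * sqrt (sqint (\<lambda>\<zeta>. ?g n \<zeta> - bd g \<zeta>)) + sqrt (sqint (\<lambda>\<zeta>. ?f n \<zeta> - bd f \<zeta>)) * G)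
       \<longlonglongrightarrow> 0" by simp
  qed simp
  then show "(\<lambda>n. \<integral>\<zeta>. ?f n \<zeta> * cnj (?g n \<zeta>) \<partial>circle_measure) \<longlonglongrightarrow> L2_inner (bd f) (bd g)" by (rule LIM_zero_cancel)
  have "(\<lambda>n. \<Sum>k. hcoef f k * cnj (hcoef g k) * of_real (radii n * radii n) ^ k) \<longlonglongrightarrow> (\<Sum>k. hcoef f k * cnj (hcoef g k))"
  proof (rule tannerys_theorem[where M="\<lambda>k. norm (hcoef f k * cnj (hcoef g k))", THEN conjunct2, THEN conjunct2])
    fix k
    have "(\<lambda>n. hcoef f k * cnj (hcoef g k) * of_real (radii n * radii n) ^ k) \<longlonglongrightarrow> hcoef f k * cnj (hcoef g k) * of_real (1 * 1) ^ k"
      by (intro tendsto_intros radii)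
    then show "(\<lambda>n. hcoef f k * cnj (hcoef g k) * of_real (radii n * radii n) ^ k) \<longlonglongrightarrow> hcoef f k * cnj (hcoef g k)" by simp
  next
    have "norm (hcoef f k * cnj (hcoef g k) * of_real (radii n * radii n) ^ k) \<le> norm (hcoef f k * cnj (hcoef g k))" for k n
      using radii(1-3)[of n] unfolding norm_mult[of _ "of_real _ ^ k"] norm_power norm_of_real
      by (intro mult_right_le_one_le) (auto simp: power_le_one mult_le_one abs_mult)
    then show "\<forall>\<^sub>F (k, n) in sequentially \<times>\<^sub>F sequentially. norm (hcoef f k * cnj (hcoef g k) * of_real (radii n * radii n) ^ k) \<le> norm (hcoef f k * cnj (hcoef g k))"
      by (intro always_eventually) auto
  qed (use cinner_summable in auto)
  then show "(\<lambda>n. \<integral>\<zeta>. ?f n \<zeta> * cnj (?g n \<zeta>) \<partial>circle_measure) \<longlonglongrightarrow> cinner f g"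
    unfolding cinner_def using parseval_dilate[OF fn_disk fn_disk rd rd, of f g] by (simp add: sums_iff)
qed

lemma H2_inner_fn: "H2_inner (fn f) (fn g) = cinner f g"
  by (simp add: H2_inner_def L2_inner_bd)

lemma H2_norm_fn: "H2_norm (fn f) = norm f"
  by (simp add: H2_norm_def H2_inner_fn cinner_same)

lemma H2_fn_cases: "f \<in> H2 \<Longrightarrow> \<exists>h. f = fn h"
  by (metis Hardy_inverse)

section \<open>Toeplitz operators and the defect operator\<close>

lemma cinner_eqI:
  assumes "\<And>k. cinner f k = cinner g k" shows "f = g"
proof -
  have "cinner (f - g) (f - g) = 0" using assms by (simp add: cinner_diff_left)
  then show ?thesis by (simp add: cinner_same)
qed

lemma cinner_zero: "cinner 0 g = 0" "cinner f 0 = 0"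
  by (simp_all add: cinner_def hcoef_zero del: fn_zero)

lemma bd_norm: "(sqint (\<lambda>\<zeta>. bd f \<zeta>)) = (norm f)\<^sup>2"
proof -
  have "complex_of_real (sqint (\<lambda>\<zeta>. bd f \<zeta>)) = L2_inner (bd f) (bd f)"
    by (simp only: L2_inner_def complex_norm_square[symmetric] integral_complex_of_real)
  then show ?thesis by (simp only: L2_inner_bd cinner_same of_real_eq_iff)
qed

section \<open>Bounded complex-linear operators and their adjoints\<close>

definition cblin :: "real \<Rightarrow> (hardy \<Rightarrow> hardy) \<Rightarrow> bool" where
  "cblin C R \<longleftrightarrow> 0 \<le> C \<and> (\<forall>c f d g. R (hlin c f d g) = hlin c (R f) d (R g)) \<and> (\<forall>f. norm (R f) \<le> C * norm f)"

lemma cblin_hlin: "cblin C R \<Longrightarrow> R (hlin c f d g) = hlin c (R f) d (R g)"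
  and cblin_norm: "cblin C R \<Longrightarrow> norm (R f) \<le> C * norm f"
  by (auto simp: cblin_def)

lemma cblin_hscale: "cblin C R \<Longrightarrow> R (hscale c f) = hscale c (R f)"
  by (simp add: hscale_def cblin_hlin)

lemma cblin_bounded_linear: assumes "cblin C R" shows "bounded_linear R"
proof (rule bounded_linear_intro[where K=C])
  show "R (x + y) = R x + R y" "R (r *\<^sub>R x) = r *\<^sub>R R x" for x y r
    by (simp_all add: plus_hardy_def scaleR_hardy_def cblin_hlin[OF assms])
  show "norm (R x) \<le> norm x * C" for x using cblin_norm[OF assms] by (simp add: mult.commute)
qed

lemma hardy_fn_eqI: "(\<And>z. fn f z = fn g z) \<Longrightarrow> f = g"
  by (simp add: fn_inject[symmetric] fun_eq_iff)

lemma cblin_hmul: assumes "bholo B g" shows "cblin B (hmul g)"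
proof -
  have "hmul g (hlin c f d h) = hlin c (hmul g f) d (hmul g h)" for c f d h
    by (rule hardy_fn_eqI) (simp add: bholo_mult[OF assms] hlin.rep_eq algebra_simps)
  then show ?thesis using bholo_mult[OF assms] bholo_nonneg[OF assms] by (simp add: cblin_def)
qed

definition hadj :: "(hardy \<Rightarrow> hardy) \<Rightarrow> hardy \<Rightarrow> hardy" where
  "hadj R f = (SOME h. \<forall>k. cinner h k = cinner f (R k))"

text \<open>Riesz representation, as \<open>bounded_functional_range\<close> for the identity, of
  the real functional k |-> <f, R k>; R commutes with multiplication by i, which adds the imaginary
  part. By \<open>cinner_eqI\<close> the choice in \<open>hadj\<close> is unique.\<close>

lemma hadj:
  assumes R: "cblin C R" shows "cinner (hadj R f) k = cinner f (R k)"
proof -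
  note l = bounded_linear.linear[OF cblin_bounded_linear[OF R]]
  have "\<exists>g. \<forall>k. inner f (R k) = inner (id k) g"
  proof (rule bounded_functional_range[where C="norm f * C"])
    show "linear (\<lambda>k. inner f (R k))"
      by (rule linearI) (simp_all add: linear_add[OF l] linear_scale[OF l] inner_add_right)
    fix x
    have "\<bar>inner f (R x)\<bar> \<le> norm f * norm (R x)" by (rule Cauchy_Schwarz_ineq2)
    also have "\<dots> \<le> norm f * (C * norm x)" by (intro mult_left_mono cblin_norm[OF R]) auto
    finally show "\<bar>inner f (R x)\<bar> \<le> norm f * C * norm (id x)" by simp
  qed (simp add: linear_iff)
  then obtain g where g: "\<And>k. inner g k = inner f (R k)" by (metis inner_commute id_apply)
  then have "\<forall>k. cinner g k = cinner f (R k)"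
    by (simp add: cinner_eq_inner cblin_hscale[OF R, symmetric])
  then have "\<forall>k. cinner (hadj R f) k = cinner f (R k)"
    unfolding hadj_def by (rule someI)
  then show ?thesis by blast
qed

lemma cblin_hadj: assumes R: "cblin C R" shows "cblin C (hadj R)"
proof -
  have "hadj R (hlin c f d g) = hlin c (hadj R f) d (hadj R g)" for c f d g
    by (rule cinner_eqI) (simp add: hadj[OF R] cinner_hlin_left)
  moreover have "norm (hadj R f) \<le> C * norm f" for f
  proof (cases "hadj R f = 0")
    case True then show ?thesis using R by (simp add: cblin_def)
  next
    case False
    have "(norm (hadj R f))\<^sup>2 = norm (cinner f (R (hadj R f)))"
      by (simp add: hadj[OF R, symmetric] cinner_same norm_power)
    also have "\<dots> \<le> norm f * norm (R (hadj R f))" by (rule norm_cinner_le)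
    also have "\<dots> \<le> norm f * (C * norm (hadj R f))" by (intro mult_left_mono cblin_norm[OF R]) auto
    finally have "norm (hadj R f) * norm (hadj R f) \<le> (C * norm f) * norm (hadj R f)" by (simp add: power2_eq_square mult_ac)
    then show ?thesis using False by (simp add: mult_right_le_imp_le)
  qed
  ultimately show ?thesis using R by (simp add: cblin_def)
qed

text \<open>Testing against \<open>H2\<close> determines the projection, since a difference of two
  candidates is orthogonal to itself. This reduces Toeplitz operators to weak identities.\<close>

lemma P_plus_eq:
  assumes G: "G \<in> L2_circle" and h: "\<And>k. cinner h k = L2_inner G (bd k)"
  shows "P_plus G = fn h"
proof -
  have d: "L2_inner (\<lambda>\<zeta>. G \<zeta> - bd f \<zeta>) (bd k) = cinner (h - f) k" for f k
  proof -
    have "L2_inner (\<lambda>\<zeta>. G \<zeta> - bd f \<zeta>) (bd k) = L2_inner G (bd k) - L2_inner (bd f) (bd k)"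
      unfolding L2_inner_def left_diff_distrib
      by (rule Bochner_Integration.integral_diff; intro L2_prod_integrable G bd_L2)
    then show ?thesis by (simp add: L2_inner_bd h cinner_diff_left)
  qed
  show ?thesis unfolding P_plus_def
  proof (rule the_equality)
    show "fn h \<in> H2 \<and> (\<forall>k\<in>H2. L2_inner (\<lambda>\<zeta>. G \<zeta> - bd h \<zeta>) (bdry k) = 0)"
    proof (intro conjI ballI)
      fix k :: "complex \<Rightarrow> complex" assume "k \<in> H2"
      then obtain k' where "k = fn k'" using H2_fn_cases by blast
      then show "L2_inner (\<lambda>\<zeta>. G \<zeta> - bd h \<zeta>) (bdry k) = 0" using d[of h k'] by (simp add: cinner_zero)
    qed simp
  next
    fix f assume f: "f \<in> H2 \<and> (\<forall>k\<in>H2. L2_inner (\<lambda>\<zeta>. G \<zeta> - bdry f \<zeta>) (bdry k) = 0)"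
    then obtain f' where f': "f = fn f'" using H2_fn_cases by blast
    have "cinner (h - f') (h - f') = 0" using f fn_H2[of "h - f'"] unfolding f' by (metis d)
    then show "f = fn h" by (simp add: cinner_same f')
  qed
qed

lemma bd_hmul:
  assumes "bholo B (fn g)"
  shows "AE \<zeta> in circle_measure. bd (hmul (fn g) f) \<zeta> = bd g \<zeta> * bd f \<zeta>"
  by (rule bd_mult) (simp add: bholo_mult[OF assms])

text \<open>The product is already the boundary function of an element of \<open>H2\<close>, so the
  projection leaves it alone.\<close>

lemma toeplitz_analytic:
  assumes b: "bholo B (fn b)"
  shows "toeplitz (bd b) (fn f) = fn (hmul (fn b) f)"
  unfolding toeplitz_def
proof (rule P_plus_eq)
  note [measurable] = L2_measurable[OF bd_L2]
  show "(\<lambda>\<zeta>. bd b \<zeta> * bd f \<zeta>) \<in> L2_circle"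
  proof (rule L2_I)
    have "integrable circle_measure (\<lambda>\<zeta>. (norm (bd (hmul (fn b) f) \<zeta>))\<^sup>2)" by (rule L2_integrable[OF bd_L2])
    then show "integrable circle_measure (\<lambda>\<zeta>. (norm (bd b \<zeta> * bd f \<zeta>))\<^sup>2)"
      by (rule integrable_cong_AE_imp) (use bd_hmul[OF b, of f] in \<open>auto elim!: eventually_mono\<close>)
  qed measurable
  fix k
  have "cinner (hmul (fn b) f) k = L2_inner (bd (hmul (fn b) f)) (bd k)" by (simp add: L2_inner_bd)
  also have "\<dots> = L2_inner (\<lambda>\<zeta>. bd b \<zeta> * bd f \<zeta>) (bd k)"
    unfolding L2_inner_def
    by (rule integral_cong_AE) (use bd_hmul[OF b, of f] in \<open>auto elim!: eventually_mono\<close>)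
  finally show "cinner (hmul (fn b) f) k = L2_inner (\<lambda>\<zeta>. bd b \<zeta> * bd f \<zeta>) (bd k)" .
qed

text \<open>On the circle conj b and b have the same modulus, and in a pairing conj b moves to the
  other factor as b; everything reduces to boundary functions of products in
  \<open>H2\<close>.\<close>

lemma coanalytic_L2:
  assumes b: "bholo B (fn b)"
  shows "(\<lambda>\<zeta>. cnj (bd b \<zeta>) * bd f \<zeta>) \<in> L2_circle"
    and "(sqint (\<lambda>\<zeta>. cnj (bd b \<zeta>) * bd f \<zeta>)) = (norm (hmul (fn b) f))\<^sup>2"
    and "L2_inner (\<lambda>\<zeta>. cnj (bd b \<zeta>) * bd f \<zeta>) (bd k) = cinner f (hmul (fn b) k)"
proof -
  note [measurable] = L2_measurable[OF bd_L2]
  have eq: "AE \<zeta> in circle_measure. (norm (bd (hmul (fn b) f) \<zeta>))\<^sup>2 = (norm (cnj (bd b \<zeta>) * bd f \<zeta>))\<^sup>2"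
    using bd_hmul[OF b, of f] by eventually_elim (simp add: norm_mult)
  show "(\<lambda>\<zeta>. cnj (bd b \<zeta>) * bd f \<zeta>) \<in> L2_circle"
    by (rule L2_I[OF _ integrable_cong_AE_imp[OF L2_integrable[OF bd_L2] _ eq]]) measurable
  have "(sqint (\<lambda>\<zeta>. cnj (bd b \<zeta>) * bd f \<zeta>)) = (sqint (\<lambda>\<zeta>. bd (hmul (fn b) f) \<zeta>))"
    by (rule integral_cong_AE) (use eq in \<open>auto elim!: eventually_mono\<close>)
  then show "(sqint (\<lambda>\<zeta>. cnj (bd b \<zeta>) * bd f \<zeta>)) = (norm (hmul (fn b) f))\<^sup>2"
    by (simp only: bd_norm)
  have "L2_inner (\<lambda>\<zeta>. cnj (bd b \<zeta>) * bd f \<zeta>) (bd k) = L2_inner (bd f) (bd (hmul (fn b) k))"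
    unfolding L2_inner_def
    by (rule integral_cong_AE) (use bd_hmul[OF b, of k] in \<open>auto elim!: eventually_mono simp: mult_ac\<close>)
  then show "L2_inner (\<lambda>\<zeta>. cnj (bd b \<zeta>) * bd f \<zeta>) (bd k) = cinner f (hmul (fn b) k)" by (simp add: L2_inner_bd)
qed

lemma toeplitz_coanalytic:
  assumes b: "bholo B (fn b)"
  shows "toeplitz (\<lambda>\<zeta>. cnj (bd b \<zeta>)) (fn f) = fn (hadj (hmul (fn b)) f)"
  unfolding toeplitz_def
  by (rule P_plus_eq) (use coanalytic_L2[OF b] in \<open>simp_all add: hadj[OF cblin_hmul[OF b]]\<close>)

text \<open>Hyponormality of analytic Toeplitz operators: conj b times f has the same norm in mean
  square as b f, and the projection does not increase it.\<close>

lemma norm_hadj_le: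
  assumes b: "bholo B (fn b)"
  shows "norm (hadj (hmul (fn b)) f) \<le> norm (hmul (fn b) f)"
proof (cases "hadj (hmul (fn b)) f = 0")
  case False
  define h where "h = hadj (hmul (fn b)) f"
  have "(norm h)\<^sup>2 = norm (cinner f (hmul (fn b) h))"
    unfolding h_def hadj[OF cblin_hmul[OF b], symmetric] cinner_same by (simp add: norm_power)
  also have "\<dots> = norm (L2_inner (\<lambda>\<zeta>. cnj (bd b \<zeta>) * bd f \<zeta>) (bd h))" by (simp add: coanalytic_L2[OF b])
  also have "\<dots> \<le> norm (hmul (fn b) f) * norm h"
    using L2_cauchy_schwarz[OF coanalytic_L2(1)[OF b, of f] bd_L2[of h]]
    unfolding L2_inner_def coanalytic_L2(2)[OF b] bd_norm by simp
  finally have "norm h * norm h \<le> norm (hmul (fn b) f) * norm h" by (simp add: power2_eq_square)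
  then show ?thesis using False by (simp add: h_def mult_right_le_imp_le)
qed simp

lemma hscale_complex: "hscale c f = Re c *\<^sub>R f + Im c *\<^sub>R hscale \<i> f"
  by (rule hardy_fn_eqI) (simp add: fn_add fn_scaleR fn_hscale complex_eq_iff algebra_simps)

lemma hscale_bounded_linear: "bounded_linear (hscale c)"
  by (rule bounded_linear_intro[where K="norm c"])
     (auto intro!: hardy_fn_eqI simp: fn_add fn_scaleR fn_hscale norm_hscale algebra_simps)

lemma bounded_linear_H2_fn:
  assumes "bounded_linear_H2 S"
  obtains C where "cblin C (\<lambda>f. Hardy (S (fn f)))" "\<And>f. fn (Hardy (S (fn f))) = S (fn f)"
proof -
  have SH: "S (fn f) \<in> H2" for f using assms fn_H2[of f] by (auto simp: bounded_linear_H2_def)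
  then have e: "fn (Hardy (S (fn f))) = S (fn f)" for f by (simp add: Hardy_inverse)
  obtain C where C: "\<forall>f\<in>H2. H2_norm (S f) \<le> C * H2_norm f" using assms by (auto simp: bounded_linear_H2_def)
  have nS: "norm (Hardy (S (fn f))) \<le> C * norm f" for f
    using C fn_H2[of f] by (simp add: H2_norm_fn[symmetric] e)
  have "norm (Hardy (S (fn f))) \<le> max C 0 * norm f" for f
    using nS[of f] by (meson dual_order.trans max.cobounded1 mult_right_mono norm_ge_zero)
  moreover have "Hardy (S (fn (hlin c f d g))) = hlin c (Hardy (S (fn f))) d (Hardy (S (fn g)))" for c f d g
  proof (rule hardy_fn_eqI)
    fix z
    have "fn (hlin c f d g) = (\<lambda>z. c * fn f z + d * fn g z)" by (simp add: hlin.rep_eq)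
    then have "S (fn (hlin c f d g)) = (\<lambda>z. c * S (fn f) z + d * S (fn g) z)"
      using assms fn_H2[of f] fn_H2[of g] by (simp add: bounded_linear_H2_def)
    then have "fn (Hardy (S (fn (hlin c f d g)))) z = c * S (fn f) z + d * S (fn g) z" unfolding e by simp
    also have "\<dots> = fn (hlin c (Hardy (S (fn f))) d (Hardy (S (fn g)))) z" by (simp add: hlin.rep_eq e)
    finally show "fn (Hardy (S (fn (hlin c f d g)))) z = fn (hlin c (Hardy (S (fn f))) d (Hardy (S (fn g)))) z" .
  qed
  ultimately have "cblin (max C 0) (\<lambda>f. Hardy (S (fn f)))" by (simp add: cblin_def)
  then show thesis using that e by blast
qed

text \<open>Polarization: reality of the quadratic form at f + i g yields Re <S f, g> = Re <S g, f>.
  Positivity of an operator on \<open>H2\<close> is stated only through its quadratic form, so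
  symmetry has to be derived.\<close>

lemma psd_of_positive:
  assumes S: "cblin C S" and p: "\<And>f. Im (cinner (S f) f) = 0 \<and> 0 \<le> Re (cinner (S f) f)"
  shows "psd S"
proof -
  note l = linear_add[OF bounded_linear.linear[OF cblin_bounded_linear[OF S]]]
  have "inner (S f) g = inner f (S g)" for f g
  proof -
    have "Im (cinner (S (f + hscale \<i> g)) (f + hscale \<i> g)) = 0" using p by blast
    then have "Im (cinner (S f) (hscale \<i> g)) + Im (cinner (hscale \<i> (S g)) f) = 0"
      using p[of f] p[of "hscale \<i> g"] by (simp add: l cinner_add_left cinner_add_right cblin_hscale[OF S])
    then have "Re (cinner (S f) g) = Re (cinner (S g) f)"
      by (simp add: cinner_hscale_left cinner_hscale_right)
    then show ?thesis by (simp add: inner_hardy_def[symmetric] inner_commute)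
  qed
  then show ?thesis using p by (simp add: psd_def symm_def inner_hardy_def)
qed

text \<open>Resolves the definite description of the square root: the root constructed over the
  reals satisfies it, and any other positive root commutes with this one and hence equals
  it.\<close>

theorem defect_op_exists:
  assumes b: "bholo 1 (fn b)"
  obtains S :: "hardy \<Rightarrow>\<^sub>L hardy"
  where "psd S" "\<And>x. S (S x) = x - hmul (fn b) (hadj (hmul (fn b)) x)" "\<And>x. defect_op (fn b) (fn x) = fn (S x)"
proof -
  define T where "T x = hmul (fn b) (hadj (hmul (fn b)) x)" for x
  note M = cblin_hmul[OF b] and M' = cblin_hadj[OF cblin_hmul[OF b]]
  have cT: "cblin 1 T" unfolding cblin_def
  proof (intro conjI allI)
    show "T (hlin c f d g) = hlin c (T f) d (T g)" for c f d g by (simp add: T_def cblin_hlin[OF M] cblin_hlin[OF M'])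
    show "norm (T f) \<le> 1 * norm f" for f
      using cblin_norm[OF M, of "hadj (hmul (fn b)) f"] cblin_norm[OF M', of f] by (simp add: T_def)
  qed simp
  define TT where "TT = Blinfun T"
  have TT: "blinfun_apply TT = T" unfolding TT_def by (rule bounded_linear_Blinfun_apply[OF cblin_bounded_linear[OF cT]])
  have cT2: "cinner (T x) y = cinner (hadj (hmul (fn b)) x) (hadj (hmul (fn b)) y)" for x y
    unfolding T_def by (subst cinner_commute) (simp add: hadj[OF M, symmetric] cinner_commute[of "hadj _ x"])
  have "symm TT" unfolding symm_def TT
  proof (intro allI)
    fix x y
    have "inner (T x) y = inner (T y) x" unfolding inner_hardy_def cT2
      using cinner_commute[of "hadj (hmul (fn b)) x" "hadj (hmul (fn b)) y"] by simp
    then show "inner (T x) y = inner x (T y)" by (simp add: inner_commute)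
  qed
  moreover have "norm TT \<le> 1" by (rule norm_blinfun_bound) (use cblin_norm[OF cT] in \<open>auto simp: TT\<close>)
  ultimately obtain S :: "hardy \<Rightarrow>\<^sub>L hardy" where S: "psd S" "\<And>x. S (S x) = x - T x"
    and comm: "\<And>R x. bounded_linear R \<Longrightarrow> (\<And>x. R (T x) = T (R x)) \<Longrightarrow> R (S x) = S (R x)"
    using psd_sqrt_exists[of TT] unfolding TT by blast
  \<comment> \<open>The operator T is complex linear, so its commutant contains multiplication by
    i.\<close>
  have Ji: "hscale \<i> (S x) = S (hscale \<i> x)" for x
    by (rule comm[OF hscale_bounded_linear]) (simp add: cblin_hscale[OF cT])
  have Jc: "S (hscale c x) = hscale c (S x)" for c x
    unfolding hscale_complex[of c] by (simp add: blinfun.bilinear_simps Ji)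
  have cS: "cblin (norm S) (blinfun_apply S)"
    by (auto simp: cblin_def hlin_eq blinfun.bilinear_simps Jc norm_blinfun)
  define DS where "DS = restrict (\<lambda>f. fn (S (Hardy f))) H2"
  have DS: "DS (fn x) = fn (S x)" for x by (simp add: DS_def fn_inverse)
  define A where "A = (\<lambda>f z. f z - toeplitz (bdry (fn b)) (toeplitz (\<lambda>\<zeta>. cnj (bdry (fn b) \<zeta>)) f) z)"
  have A: "A (fn x) = fn (x - T x)" for x
    by (rule ext) (simp add: A_def toeplitz_coanalytic[OF b] toeplitz_analytic[OF b] T_def fn_diff)
  have "sqrt_H2 A = DS" unfolding sqrt_H2_def
  proof (rule the_equality)
    have "bounded_linear_H2 DS" unfolding bounded_linear_H2_def
    proof (intro conjI ballI allI)
      show "DS ` H2 \<subseteq> H2" by (auto simp: DS_def)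
      show "DS (\<lambda>z. c * f z + d * g z) = (\<lambda>z. c * DS f z + d * DS g z)" if fg: "f \<in> H2" "g \<in> H2" for f g c d
      proof -
        obtain x y where xy: "f = fn x" "g = fn y" using fg H2_fn_cases by blast
        have "(\<lambda>z. c * f z + d * g z) = fn (hlin c x d y)" by (simp add: xy hlin.rep_eq)
        then have e: "DS (\<lambda>z. c * f z + d * g z) = fn (hlin c (S x) d (S y))" by (simp only: DS cblin_hlin[OF cS])
        show ?thesis unfolding e by (simp add: xy DS hlin.rep_eq)
      qed
      show "\<exists>C. \<forall>f\<in>H2. H2_norm (DS f) \<le> C * H2_norm f"
      proof (intro exI ballI)
        fix f assume "f \<in> H2"
        then obtain x where "f = fn x" using H2_fn_cases by blast
        then show "H2_norm (DS f) \<le> norm S * H2_norm f" by (simp add: DS H2_norm_fn norm_blinfun)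
      qed
    qed
    moreover have "Im (H2_inner (DS f) f) = 0 \<and> 0 \<le> Re (H2_inner (DS f) f)" if fH: "f \<in> H2" for f
    proof -
      obtain x where x: "f = fn x" using fH H2_fn_cases by blast
      have "Im (cinner (S x) x) = inner (S x) (hscale \<i> x)" by (simp add: cinner_eq_inner)
      also have "\<dots> = inner x (hscale \<i> (S x))" using S(1) by (simp add: psd_def symm_def Ji)
      also have "\<dots> = Im (cinner x (S x))" by (simp add: cinner_eq_inner)
      also have "\<dots> = - Im (cinner (S x) x)" using cinner_commute[of x "S x"] by simp
      finally have "Im (cinner (S x) x) = 0" by simp
      moreover have "0 \<le> Re (cinner (S x) x)" using S(1) by (simp add: psd_def inner_hardy_def)
      ultimately show ?thesis by (simp add: x DS H2_inner_fn)
    qed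
    moreover have "DS (DS f) = A f" if fH: "f \<in> H2" for f
    proof -
      obtain x where x: "f = fn x" using fH H2_fn_cases by blast
      show ?thesis by (simp add: x DS S A)
    qed
    ultimately show "DS \<in> extensional H2 \<and> positive_H2 DS \<and> (\<forall>f\<in>H2. DS (DS f) = A f)"
      by (simp add: DS_def positive_H2_def)
  next
    fix S' assume S': "S' \<in> extensional H2 \<and> positive_H2 S' \<and> (\<forall>f\<in>H2. S' (S' f) = A f)"
    then obtain C where C: "cblin C (\<lambda>f. Hardy (S' (fn f)))" "\<And>f. fn (Hardy (S' (fn f))) = S' (fn f)"
      using bounded_linear_H2_fn[of S'] unfolding positive_H2_def by blast
    define s where "s f = Hardy (S' (fn f))" for f
    have s: "cblin C s" "\<And>f. fn (s f) = S' (fn f)" using C by (simp_all add: s_def[abs_def])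
    note sl = bounded_linear.linear[OF cblin_bounded_linear[OF s(1)]]
    have "psd s"
    proof (rule psd_of_positive[OF s(1)])
      show "Im (cinner (s f) f) = 0 \<and> 0 \<le> Re (cinner (s f) f)" for f
        using S' fn_H2[of f] by (simp add: H2_inner_fn[symmetric] s(2) positive_H2_def)
    qed
    have ss: "s (s x) = x - T x" for x
    proof -
      have "fn (s (s x)) = fn (x - T x)" using S' by (simp add: s(2) A)
      then show ?thesis by (simp add: fn_inject)
    qed
    \<comment> \<open>A root s commutes with its own square 1 - T, hence with T, hence with the
      constructed root S.\<close>
    have sT: "s (T x) = T (s x)" for x
    proof -
      have "s (s (s x)) = s (x - T x)" by (simp only: ss[of x])
      moreover have "s (s (s x)) = s x - T (s x)" by (rule ss)
      ultimately show ?thesis by (simp add: linear_diff[OF sl])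
    qed
    have "blinfun_apply S = s"
    proof (rule psd_sqrt_unique[OF S(1) _ \<open>psd s\<close> sl])
      show "linear (blinfun_apply S)" by (rule bounded_linear.linear[OF blinfun.bounded_linear_right])
      show "S (S x) = s (s x)" for x by (simp add: S ss)
      show "S (s x) = s (S x)" for x by (rule comm[OF cblin_bounded_linear[OF s(1)] sT, symmetric])
    qed
    then have e: "S' (fn x) = DS (fn x)" for x by (simp add: DS s(2))
    show "S' = DS"
    proof (rule extensionalityI)
      show "S' \<in> extensional H2" using S' by blast
      show "DS \<in> extensional H2" by (simp add: DS_def)
      fix f assume "f \<in> H2"
      then obtain x where "f = fn x" using H2_fn_cases by blast
      then show "S' f = DS f" by (simp only: e)
    qed
  qed
  then have D: "defect_op (fn b) (fn x) = fn (S x)" for x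
    unfolding defect_op_def A_def[symmetric] by (simp add: DS)
  show thesis by (rule that[OF S(1) S(2)[unfolded T_def] D])
qed

lemma dBR_fn:
  assumes "\<And>x. defect_op b (fn x) = fn (S x)" shows "dBR b = fn ` range S"
proof -
  have H: "H2 = range fn" using H2_fn_cases by auto
  show ?thesis unfolding dBR_def H by (simp add: image_image assms)
qed

text \<open>An injective root has trivial kernel, so the orthogonal complement in the definition is
  all of \<open>H2\<close> and preimages are unique.\<close>

lemma dBR_norm_fn:
  assumes D: "\<And>x. defect_op b (fn x) = fn (S x)" and inj: "\<And>x. S x = 0 \<Longrightarrow> x = 0" and lin: "linear S"
  shows "dBR_norm b (fn (S x)) = norm x"
proof -
  have i: "S x = S y \<Longrightarrow> x = y" for x y using inj[of "x - y"] linear_diff[OF lin] by simp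
  have P: "defect_ker_perp b = H2"
  proof -
    have "H2_inner f k = 0" if fk: "f \<in> H2" "k \<in> H2" "defect_op b k = (\<lambda>z. 0)" for f k
    proof -
      obtain x y where xy: "f = fn x" "k = fn y" using fk H2_fn_cases by blast
      then have "S y = 0" using fk by (simp add: D fn_inject[symmetric])
      then have "y = 0" by (rule inj)
      then show ?thesis by (simp add: xy H2_inner_fn cinner_zero del: fn_zero)
    qed
    then show ?thesis by (auto simp: defect_ker_perp_def)
  qed
  have "dBR_inner b (fn (S x)) (fn (S x)) = cinner x x"
    unfolding dBR_inner_def
  proof (rule the_equality)
    show "\<exists>f\<in>defect_ker_perp b. \<exists>g\<in>defect_ker_perp b. fn (S x) = defect_op b f \<and> fn (S x) = defect_op b g \<and> cinner x x = H2_inner f g"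
      unfolding P by (intro bexI[of _ "fn x"]) (auto simp: D H2_inner_fn)
  next
    fix c assume "\<exists>f\<in>defect_ker_perp b. \<exists>g\<in>defect_ker_perp b. fn (S x) = defect_op b f \<and> fn (S x) = defect_op b g \<and> c = H2_inner f g"
    then obtain f g where fg: "f \<in> H2" "g \<in> H2" "fn (S x) = defect_op b f" "fn (S x) = defect_op b g" "c = H2_inner f g"
      unfolding P by blast
    then obtain u v where uv: "f = fn u" "g = fn v" using H2_fn_cases by blast
    then have "S x = S u" "S x = S v" using fg by (simp_all add: D fn_inject)
    then have "u = x" "v = x" using i by auto
    then show "c = cinner x x" using fg uv by (simp add: H2_inner_fn)
  qed
  then show ?thesis by (simp add: dBR_norm_def cinner_same)
qed

section \<open>Generalized Abel means as coefficient multipliers\<close>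

text \<open>Turns the quotient of Gamma values into a coefficient of Newton's binomial series with
  exponent -1 - \<alpha>.\<close>

lemma abel_binom_gbinomial:
  assumes "\<alpha> > -1" shows "abel_binom \<alpha> n = (-1) ^ n * ((-1 - \<alpha>) gchoose n)"
proof -
  have "\<alpha> + 1 \<notin> \<int>\<^sub>\<le>\<^sub>0" using assms by (auto elim!: nonpos_Ints_cases)
  then have "pochhammer (\<alpha> + 1) n = Gamma (\<alpha> + 1 + real n) / Gamma (\<alpha> + 1)" by (rule pochhammer_Gamma)
  then show ?thesis by (simp add: abel_binom_def gbinomial_pochhammer add_ac power_mult_distrib[symmetric])
qed

lemma abel_binom_nonneg: "\<alpha> > -1 \<Longrightarrow> 0 \<le> abel_binom \<alpha> n"
  by (auto simp: abel_binom_def intro!: divide_nonneg_nonneg mult_nonneg_nonneg less_imp_le Gamma_real_pos)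

lemma abel_binom_sums:
  assumes "\<alpha> > -1" "\<bar>x\<bar> < 1"
  shows "(\<lambda>n. abel_binom \<alpha> n * x ^ n) sums ((1 - x) powr (-1 - \<alpha>))"
proof -
  have "(\<lambda>n. ((-1 - \<alpha>) gchoose n) * (- x) ^ n) sums ((1 + (- x)) powr (-1 - \<alpha>))"
    by (rule gen_binomial_real) (use assms in simp)
  moreover have "((-1 - \<alpha>) gchoose n) * (- x) ^ n = abel_binom \<alpha> n * x ^ n" for n
    by (simp add: abel_binom_gbinomial[OF assms(1)] power_minus[of x])
  ultimately show ?thesis by simp
qed

definition abel_wt :: "real \<Rightarrow> real \<Rightarrow> nat \<Rightarrow> real" where
  "abel_wt \<alpha> r n = (1 - r) powr (1 + \<alpha>) * (abel_binom \<alpha> n * r ^ n)"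

text \<open>The k-th coefficient enters the partial sum of index n exactly when n >= k, so the mean
  multiplies it by the total weight of those n. Since the weights add up to 1, this is 1 minus a
  finite sum.\<close>

definition abel_mult :: "real \<Rightarrow> real \<Rightarrow> nat \<Rightarrow> real" where
  "abel_mult \<alpha> r k = 1 - (\<Sum>n<k. abel_wt \<alpha> r n)"

context
  fixes \<alpha> r :: real
  assumes \<alpha>: "\<alpha> > -1" and r: "0 < r" "r < 1"
begin

lemma abel_wt_nonneg: "0 \<le> abel_wt \<alpha> r n"
  using r abel_binom_nonneg[OF \<alpha>] by (simp add: abel_wt_def)

lemma abel_wt_gen:
  assumes "0 \<le> x" "r * x < 1"
  shows "(\<lambda>n. abel_wt \<alpha> r n * x ^ n) sums (((1 - r) / (1 - r * x)) powr (1 + \<alpha>))"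
proof -
  have "(\<lambda>n. (1 - r) powr (1 + \<alpha>) * (abel_binom \<alpha> n * (r * x) ^ n)) sums
     ((1 - r) powr (1 + \<alpha>) * (1 - r * x) powr (-1 - \<alpha>))"
    by (intro sums_mult abel_binom_sums \<alpha>) (use assms r in auto)
  moreover have "(1 - r * x) powr (-1 - \<alpha>) = inverse ((1 - r * x) powr (1 + \<alpha>))"
    using powr_minus[of "1 - r * x" "1 + \<alpha>"] by simp
  moreover have "((1 - r) / (1 - r * x)) powr (1 + \<alpha>) = (1 - r) powr (1 + \<alpha>) / (1 - r * x) powr (1 + \<alpha>)"
    by (rule powr_divide)
  ultimately show ?thesis
    by (simp add: abel_wt_def power_mult_distrib divide_inverse mult_ac)
qed

lemma abel_wt_sums: "abel_wt \<alpha> r sums 1"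
  using abel_wt_gen[of 1] r by simp

lemma abel_mult_tail: "abel_mult \<alpha> r k = (\<Sum>n. abel_wt \<alpha> r (n + k))"
  using suminf_minus_initial_segment[OF sums_summable[OF abel_wt_sums], of k] sums_unique[OF abel_wt_sums]
  by (simp add: abel_mult_def)

lemma abel_mult_nonneg: "0 \<le> abel_mult \<alpha> r k"
  unfolding abel_mult_tail
  by (intro suminf_nonneg summable_ignore_initial_segment sums_summable[OF abel_wt_sums] abel_wt_nonneg)

lemma abel_mult_le_1: "abel_mult \<alpha> r k \<le> 1"
  by (simp add: abel_mult_def sum_nonneg abel_wt_nonneg)

lemma abel_mult_0: "abel_mult \<alpha> r 0 = 1" by (simp add: abel_mult_def)

lemma abel_mult_Suc: "abel_mult \<alpha> r (Suc k) = abel_mult \<alpha> r k - abel_wt \<alpha> r k"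
  by (simp add: abel_mult_def)

lemma abel_mult_tendsto: "abel_mult \<alpha> r \<longlonglongrightarrow> 0"
proof -
  have "(\<lambda>k. 1 - (\<Sum>n<k. abel_wt \<alpha> r n)) \<longlonglongrightarrow> 1 - 1"
    by (intro tendsto_intros) (use abel_wt_sums in \<open>simp add: sums_def\<close>)
  then show ?thesis by (simp add: abel_mult_def[abs_def])
qed

text \<open>Chernoff-type bound: for n >= k and y = 1 / sqrt r the weight is at most
  \<open>sqrt r ^ k\<close> times its product with y^n. The generating function at y is (1 + sqrt
  r)^(1 + \<alpha>), which is bounded in r, while \<open>sqrt r ^ k\<close> still decays on the
  scale k ~ 1 / (1 - r).\<close>

lemma abel_mult_geometric: "abel_mult \<alpha> r k \<le> 2 powr (1 + \<alpha>) * sqrt r ^ k"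
proof -
  define \<rho> where "\<rho> = sqrt r"
  have \<rho>: "0 < \<rho>" "\<rho> < 1" "r = \<rho> * \<rho>" using r by (auto simp: \<rho>_def)
  define y where "y = 1 / \<rho>"
  have ry: "r * y = \<rho>" using \<rho> by (simp add: y_def)
  have g: "(\<lambda>n. abel_wt \<alpha> r n * y ^ n) sums (((1 - r) / (1 - \<rho>)) powr (1 + \<alpha>))"
    using abel_wt_gen[of y] \<rho> by (simp add: ry) (simp add: y_def)
  have "abel_mult \<alpha> r k \<le> (\<Sum>n. \<rho> ^ k * (abel_wt \<alpha> r (n + k) * y ^ (n + k)))"
    unfolding abel_mult_tail
  proof (rule suminf_le)
    fix n
    have "1 \<le> y ^ n" using \<rho> by (simp add: y_def one_le_power)
    moreover have "\<rho> ^ k * y ^ (n + k) = y ^ n" using \<rho> by (simp add: y_def power_add power_one_over)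
    ultimately show "abel_wt \<alpha> r (n + k) \<le> \<rho> ^ k * (abel_wt \<alpha> r (n + k) * y ^ (n + k))"
      using mult_left_mono[of 1 "y ^ n" "abel_wt \<alpha> r (n + k)"] abel_wt_nonneg[of "n + k"]
      by (simp add: mult.left_commute[of "\<rho> ^ k"])
  next
    show "summable (\<lambda>n. abel_wt \<alpha> r (n + k))" by (intro summable_ignore_initial_segment sums_summable[OF abel_wt_sums])
    show "summable (\<lambda>n. \<rho> ^ k * (abel_wt \<alpha> r (n + k) * y ^ (n + k)))"
      by (intro summable_mult summable_ignore_initial_segment[of "\<lambda>n. abel_wt \<alpha> r n * y ^ n"] sums_summable[OF g])
  qed
  also have "\<dots> = \<rho> ^ k * (\<Sum>n. abel_wt \<alpha> r (n + k) * y ^ (n + k))"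
    by (intro suminf_mult summable_ignore_initial_segment[of "\<lambda>n. abel_wt \<alpha> r n * y ^ n"] sums_summable[OF g])
  also have "\<dots> \<le> \<rho> ^ k * (((1 - r) / (1 - \<rho>)) powr (1 + \<alpha>))"
  proof (rule mult_left_mono)
    have "0 \<le> (\<Sum>n<k. abel_wt \<alpha> r n * y ^ n)" using \<rho> by (intro sum_nonneg mult_nonneg_nonneg abel_wt_nonneg) (simp add: y_def)
    then show "(\<Sum>n. abel_wt \<alpha> r (n + k) * y ^ (n + k)) \<le> ((1 - r) / (1 - \<rho>)) powr (1 + \<alpha>)"
      using suminf_minus_initial_segment[OF sums_summable[OF g], of k] sums_unique[OF g] by simp
  qed (use \<rho> in simp)
  also have "(1 - r) / (1 - \<rho>) = 1 + \<rho>" using \<rho> by (simp add: field_simps)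
  also have "\<rho> ^ k * (1 + \<rho>) powr (1 + \<alpha>) \<le> \<rho> ^ k * 2 powr (1 + \<alpha>)"
    using \<rho> \<alpha> by (intro mult_left_mono powr_mono2) auto
  finally show ?thesis by (simp add: \<rho>_def mult.commute)
qed

text \<open>Summation by parts: consecutive multipliers differ by one weight, so the generating
  function of the multipliers comes from that of the weights.\<close>

lemma abel_mult_gen:
  assumes x: "0 \<le> x" "x < 1"
  shows "summable (\<lambda>k. abel_mult \<alpha> r k * x ^ k)"
    "(1 - x) * (\<Sum>k. abel_mult \<alpha> r k * x ^ k) = 1 - x * ((1 - r) / (1 - r * x)) powr (1 + \<alpha>)"
proof -
  show s: "summable (\<lambda>k. abel_mult \<alpha> r k * x ^ k)"
  proof (rule summable_comparison_test'[of "\<lambda>k. x ^ k" 0])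
    show "norm (abel_mult \<alpha> r k * x ^ k) \<le> x ^ k" for k
      using x abel_mult_nonneg[of k] abel_mult_le_1[of k] by (simp add: abs_mult mult_left_le_one_le)
  qed (use x in \<open>simp add: summable_geometric\<close>)
  have rx: "r * x < 1" using r x mult_strict_mono[of r 1 x 1] by (cases "x = 0") auto
  have g: "(\<lambda>n. abel_wt \<alpha> r n * x ^ n) sums (((1 - r) / (1 - r * x)) powr (1 + \<alpha>))" by (rule abel_wt_gen[OF x(1) rx])
  have "(\<Sum>k. abel_mult \<alpha> r k * x ^ k) = (\<Sum>k. abel_mult \<alpha> r (Suc k) * x ^ Suc k) + 1"
    using suminf_split_head[OF s] by (simp add: abel_mult_0)
  also have "(\<Sum>k. abel_mult \<alpha> r (Suc k) * x ^ Suc k) = (\<Sum>k. x * (abel_mult \<alpha> r k * x ^ k) - x * (abel_wt \<alpha> r k * x ^ k))"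
    by (rule suminf_cong) (simp add: abel_mult_Suc algebra_simps)
  also have "\<dots> = x * (\<Sum>k. abel_mult \<alpha> r k * x ^ k) - x * ((1 - r) / (1 - r * x)) powr (1 + \<alpha>)"
    by (rule sums_unique[symmetric], intro sums_diff sums_mult summable_sums s g)
  finally show "(1 - x) * (\<Sum>k. abel_mult \<alpha> r k * x ^ k) = 1 - x * ((1 - r) / (1 - r * x)) powr (1 + \<alpha>)"
    by (simp add: algebra_simps)
qed

text \<open>The sum is the pairing of the Abel mean of \<open>kern r\<close> with
  \<open>kern r\<close>. At x = r^2 the quotient (1 - r)/(1 - r^3) is 1/(1 + r + r^2), at most 4/7
  for r >= 1/2; this stays away from 1, so a fixed share of 1/(1 - r^2) survives. The division by 2
  comes from 1 - r^2 <= 2 (1 - r).\<close>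

lemma abel_mult_kernel_lower:
  assumes "1/2 \<le> r"
  shows "(1 - (4/7) powr (1 + \<alpha>)) / 2 / (1 - r) \<le> (\<Sum>k. abel_mult \<alpha> r k * (r\<^sup>2) ^ k)"
proof -
  define t where "t = ((1 - r) / (1 - r * r\<^sup>2)) powr (1 + \<alpha>)"
  have r2: "0 \<le> r\<^sup>2" "r\<^sup>2 < 1" using r by (auto simp: power_less_one_iff)
  have "1 - r * r\<^sup>2 = (1 - r) * (1 + r + r\<^sup>2)" by (simp add: algebra_simps power2_eq_square)
  then have q: "(1 - r) / (1 - r * r\<^sup>2) = 1 / (1 + r + r\<^sup>2)" using r by simp
  have "7/4 \<le> 1 + r + r\<^sup>2" using assms power_mono[of "1/2" r 2] by (simp add: power2_eq_square)
  then have "1 / (1 + r + r\<^sup>2) \<le> 4/7" by (simp add: field_simps)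
  then have "t \<le> (4/7) powr (1 + \<alpha>)" unfolding t_def q using r \<alpha> by (intro powr_mono2) auto
  moreover have "r\<^sup>2 * t \<le> t" using r2 by (intro mult_left_le_one_le) (auto simp: t_def)
  ultimately have n: "1 - (4/7) powr (1 + \<alpha>) \<le> (1 - r\<^sup>2) * (\<Sum>k. abel_mult \<alpha> r k * (r\<^sup>2) ^ k)"
    unfolding abel_mult_gen(2)[OF r2] t_def[symmetric] by linarith
  have S0: "0 \<le> (\<Sum>k. abel_mult \<alpha> r k * (r\<^sup>2) ^ k)"
    by (intro suminf_nonneg abel_mult_gen(1)[OF r2] mult_nonneg_nonneg abel_mult_nonneg) auto
  have "1 - r\<^sup>2 = (1 - r) * (1 + r)" by (simp add: algebra_simps power2_eq_square)
  also have "\<dots> \<le> (1 - r) * 2" using r by (intro mult_left_mono) auto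
  finally have "(1 - r\<^sup>2) * (\<Sum>k. abel_mult \<alpha> r k * (r\<^sup>2) ^ k) \<le> ((1 - r) * 2) * (\<Sum>k. abel_mult \<alpha> r k * (r\<^sup>2) ^ k)"
    by (rule mult_right_mono[OF _ S0])
  then show ?thesis using n r by (simp add: field_simps)
qed

definition habel :: "hardy \<Rightarrow> hardy" where
  "habel f = Hardy (of_coefs (\<lambda>k. of_real (abel_mult \<alpha> r k) * hcoef f k))"

lemma habel_coef_le: "norm (of_real (abel_mult \<alpha> r k) * hcoef f k) \<le> norm (hcoef f k)"
  using abel_mult_nonneg[of k] abel_mult_le_1[of k] by (simp add: norm_mult mult_left_le_one_le)

lemma habel_coef: "hcoef (habel f) k = of_real (abel_mult \<alpha> r k) * hcoef f k"
  and habel_fn: "fn (habel f) = of_coefs (\<lambda>k. of_real (abel_mult \<alpha> r k) * hcoef f k)"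
proof -
  have "summable (\<lambda>k. (norm (of_real (abel_mult \<alpha> r k) * hcoef f k))\<^sup>2)"
    by (rule summable_comparison_test'[OF hcoef_summable[of f], of 0])
       (use habel_coef_le[of _ f] in \<open>auto intro!: power_mono\<close>)
  note h = of_coefs_H2[OF this]
  show "fn (habel f) = of_coefs (\<lambda>k. of_real (abel_mult \<alpha> r k) * hcoef f k)"
    using h by (simp add: habel_def Hardy_inverse)
  then show "hcoef (habel f) k = of_real (abel_mult \<alpha> r k) * hcoef f k" using h by simp
qed

lemma cblin_habel: "cblin 1 habel"
proof -
  have "habel (hlin c f d g) = hlin c (habel f) d (habel g)" for c f d g
    by (rule hardy_eqI) (simp add: habel_coef hcoef_hlin algebra_simps)
  moreover have "norm (habel f) \<le> norm f" for f
  proof (rule power2_le_imp_le)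
    show "(norm (habel f))\<^sup>2 \<le> (norm f)\<^sup>2" unfolding norm_hardy_sq
      by (rule suminf_le) (use habel_coef_le[of _ f] in \<open>auto simp: habel_coef intro!: power_mono\<close>,
        use hcoef_summable[of "habel f"] in \<open>simp add: habel_coef\<close>)
  qed simp
  ultimately show ?thesis by (simp add: cblin_def)
qed

text \<open>Abel summation exchanges weighted partial sums for multiplied terms; the boundary term
  vanishes because the multipliers tend to 0 and the partial sums converge.\<close>

lemma abel_mean_fn: "abel_mean \<alpha> r (fn f) = fn (habel f)"
proof
  fix z
  show "abel_mean \<alpha> r (fn f) z = fn (habel f) z"
  proof (cases "norm z < 1")
    case False then show ?thesis by (simp add: abel_mean_def habel_fn of_coefs_def)
  next
    case True
    define a where "a k = hcoef f k * z ^ k" for k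
    define s where "s N = (\<Sum>k<N. a k)" for N
    have aS: "a sums fn f z" unfolding a_def by (rule coef_sums) (use True fn_disk[of f] in \<open>auto simp: disk_holo_def\<close>)
    \<comment> \<open>\<open>taylor_sum n\<close> includes the term of index n, whereas
      \<open>s N\<close> stops before N.\<close>
    have tay: "taylor_sum n (fn f) z = s (Suc n)" for n
      by (simp add: taylor_sum_def s_def a_def coef_def lessThan_Suc_atMost)
    have part: "(\<Sum>n<N. of_real (abel_wt \<alpha> r n) * s (Suc n)) =
        (\<Sum>k<N. of_real (abel_mult \<alpha> r k) * a k) - of_real (abel_mult \<alpha> r N) * s N" for N
    proof (induction N)
      case 0 show ?case by (simp add: s_def)
    next
      case (Suc N)
      have "s (Suc N) = s N + a N" by (simp add: s_def)
      then show ?case using Suc by (simp add: abel_mult_Suc algebra_simps)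
    qed
    have X: "(\<lambda>k. of_real (abel_mult \<alpha> r k) * a k) sums fn (habel f) z"
    proof -
      have "norm (of_real (abel_mult \<alpha> r k) * hcoef f k) \<le> norm (habel f)" for k
        using norm_hcoef_le[of "habel f" k] by (simp only: habel_coef)
      from of_coefs_sums[of "\<lambda>k. of_real (abel_mult \<alpha> r k) * hcoef f k", OF this True]
      show ?thesis by (simp add: habel_fn a_def mult.assoc)
    qed
    have "(\<lambda>N. of_real (abel_mult \<alpha> r N) * s N) \<longlonglongrightarrow> of_real 0 * fn f z"
      by (intro tendsto_intros abel_mult_tendsto) (use aS in \<open>simp add: s_def sums_def\<close>)
    then have W: "(\<lambda>n. of_real (abel_wt \<alpha> r n) * s (Suc n)) sums (fn (habel f) z - 0)"
      unfolding sums_def part using X[unfolded sums_def] by (intro tendsto_diff) auto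
    define c where "c = (1 - r) powr (1 + \<alpha>)"
    have c: "c \<noteq> 0" using r by (simp add: c_def)
    have "(\<lambda>n. of_real (1 / c) * (of_real (abel_wt \<alpha> r n) * s (Suc n))) sums (of_real (1 / c) * (fn (habel f) z - 0))"
      by (rule sums_mult[OF W])
    moreover have "of_real (1 / c) * (of_real (abel_wt \<alpha> r n) * s (Suc n)) =
        of_real (abel_binom \<alpha> n) * taylor_sum n (fn f) z * of_real (r ^ n)" for n
      using c by (simp add: abel_wt_def c_def[symmetric] tay)
    ultimately have "(\<Sum>n. of_real (abel_binom \<alpha> n) * taylor_sum n (fn f) z * of_real (r ^ n)) = of_real (1 / c) * fn (habel f) z"
      by (simp add: sums_iff)
    then show ?thesis using True c by (simp add: abel_mean_def c_def[symmetric])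
  qed
qed

text \<open>The coefficients of \<open>f\<close> and \<open>g\<close> are damped by equal shares of the decay of the multiplier.\<close>

lemma habel_cinner_le:
  defines "R \<equiv> sqrt (sqrt r)"
  shows "norm (cinner (habel f) g) \<le> 2 powr (1 + \<alpha>) *
    (sqrt (sqint (\<lambda>\<zeta>. fn f (of_real R * \<zeta>))) * sqrt (sqint (\<lambda>\<zeta>. fn g (of_real R * \<zeta>))))"
    (is "_ \<le> ?D * (?N f * ?N g)")
proof -
  \<comment> \<open>R is the fourth root of r, so that each of the two functions receives a factor
    \<open>R ^ k\<close> of \<open>sqrt r ^ k\<close>.\<close>
  have R: "0 \<le> R" "R < 1" "R * R = sqrt r" using r by (auto simp: R_def)
  have L: "L2_set (\<lambda>k. norm (hcoef h k) * R ^ k) {..<n} \<le> ?N h" for h n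
  proof -
    have "(\<Sum>k<n. (norm (hcoef h k) * R ^ k)\<^sup>2) = (\<Sum>k<n. (norm (hcoef h k))\<^sup>2 * (R\<^sup>2) ^ k)"
      by (simp add: power_mult_distrib power_mult[symmetric] mult.commute)
    also have "\<dots> \<le> (sqint (\<lambda>\<zeta>. fn h (of_real R * \<zeta>)))"
      unfolding sums_unique[OF norm_dilate_sums[OF fn_disk R(1,2)]]
      by (intro sum_le_suminf sums_summable[OF norm_dilate_sums[OF fn_disk R(1,2)]]) auto
    finally show ?thesis unfolding L2_set_def by (rule real_sqrt_le_mono)
  qed
  have "norm (\<Sum>k<n. hcoef (habel f) k * cnj (hcoef g k)) \<le> ?D * (?N f * ?N g)" for n
  proof -
    have "norm (\<Sum>k<n. hcoef (habel f) k * cnj (hcoef g k)) \<le> (\<Sum>k<n. ?D * ((norm (hcoef f k) * R ^ k) * (norm (hcoef g k) * R ^ k)))"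
    proof (rule sum_norm_le)
      fix k
      have "norm (hcoef (habel f) k * cnj (hcoef g k)) = abel_mult \<alpha> r k * (norm (hcoef f k) * norm (hcoef g k))"
        using abel_mult_nonneg[of k] by (simp add: habel_coef norm_mult)
      also have "\<dots> \<le> (?D * sqrt r ^ k) * (norm (hcoef f k) * norm (hcoef g k))"
        by (intro mult_right_mono abel_mult_geometric) auto
      also have "\<dots> = ?D * ((norm (hcoef f k) * R ^ k) * (norm (hcoef g k) * R ^ k))"
        unfolding R(3)[symmetric] by (simp add: power_mult_distrib mult_ac)
      finally show "norm (hcoef (habel f) k * cnj (hcoef g k)) \<le> \<dots>" .
    qed
    also have "\<dots> = ?D * (\<Sum>k<n. \<bar>norm (hcoef f k) * R ^ k\<bar> * \<bar>norm (hcoef g k) * R ^ k\<bar>)"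
      using R by (simp add: sum_distrib_left abs_mult)
    also have "\<dots> \<le> ?D * (L2_set (\<lambda>k. norm (hcoef f k) * R ^ k) {..<n} * L2_set (\<lambda>k. norm (hcoef g k) * R ^ k) {..<n})"
      by (intro mult_left_mono L2_set_mult_ineq) auto
    also have "\<dots> \<le> ?D * (?N f * ?N g)" by (intro mult_left_mono mult_mono L) (auto simp: L2_set_nonneg)
    finally show ?thesis .
  qed
  then show ?thesis
    using cinner_sums[of "habel f" g] unfolding sums_def
    by (intro Lim_norm_ubound[OF sequentially_bot]) auto
qed

end

section \<open>Bounded functions and reproducing kernels in the Hardy space\<close>

text \<open>Cuts a formula off outside the disk, as members of \<open>H2\<close> must vanish there;
  \<open>bholo\<close> puts no condition outside the disk, so expressions such as \<open>Ei\<close>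
  can be used as they stand.\<close>

definition hol :: "(complex \<Rightarrow> complex) \<Rightarrow> hardy" where
  "hol g = Hardy (\<lambda>z. if norm z < 1 then g z else 0)"

lemma hol:
  assumes "bholo B g"
  shows "fn (hol g) = (\<lambda>z. if norm z < 1 then g z else 0)" "norm (hol g) \<le> B"
proof -
  have d: "disk_holo (\<lambda>z. if norm z < 1 then g z else 0)"
    unfolding disk_holo_def
    by (auto intro: holomorphic_transform[of g] simp: assms[unfolded bholo_def])
  note B = bholo_nonneg[OF assms]
  have le: "(sqint (\<lambda>\<zeta>. if norm (of_real r * \<zeta>) < 1 then g (of_real r * \<zeta>) else 0)) \<le> B\<^sup>2"
    if r: "0 \<le> r" "r < 1" for r :: real
  proof -
    have "(sqint (\<lambda>\<zeta>. if norm (of_real r * \<zeta>) < 1 then g (of_real r * \<zeta>) else 0)) \<le> (\<integral>\<zeta>. B\<^sup>2 \<partial>circle_measure)"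
    proof (rule integral_mono)
      show "integrable circle_measure (\<lambda>\<zeta>. (norm (if norm (of_real r * \<zeta>) < 1 then g (of_real r * \<zeta>) else 0))\<^sup>2)"
        by (rule dilate_integrable[OF d r])
      show "(norm (if norm (of_real r * \<zeta>) < 1 then g (of_real r * \<zeta>) else 0))\<^sup>2 \<le> B\<^sup>2" for \<zeta>
        using assms B by (intro power_mono) (auto simp: bholo_def)
    qed simp
    then show ?thesis by (simp add: circle.prob_space[unfolded space_circle_measure])
  qed
  show "norm (hol g) \<le> B" unfolding hol_def by (rule H2_norm_bound(2)[OF d le B])
  show "fn (hol g) = (\<lambda>z. if norm z < 1 then g z else 0)"
    unfolding hol_def by (rule Hardy_inverse[OF H2_norm_bound(1)[OF d le B]])
qed

lemma fn_outside: "\<not> norm z < 1 \<Longrightarrow> fn f z = 0"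
  using fn_disk[of f] by (simp add: disk_holo_def)

lemma hardy_disk_eqI: "(\<And>z. norm z < 1 \<Longrightarrow> fn f z = fn g z) \<Longrightarrow> f = g"
  by (rule hardy_fn_eqI) (metis fn_outside)

lemma hmul_cong: "(\<And>z. norm z < 1 \<Longrightarrow> g z = h z) \<Longrightarrow> hmul g f = hmul h f"
  unfolding hmul_def by (rule arg_cong[where f=Hardy]) (metis fn_outside mult_zero_right)

lemma hmul_hol: "bholo B g \<Longrightarrow> hmul (fn (hol g)) f = hmul g f"
  by (rule hmul_cong) (simp add: hol)

lemma bholo_hol: "bholo B g \<Longrightarrow> bholo B (fn (hol g))"
  using fn_disk[of "hol g"] by (auto simp: bholo_def disk_holo_def hol[unfolded bholo_def])

text \<open>This is where inner functions act: boundary values of modulus 1 cancel in the inner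
  product over the circle.\<close>

lemma isometry_hmul:
  assumes g: "bholo B g" and u: "AE \<zeta> in circle_measure. norm (bd (hol g) \<zeta>) = 1"
  shows "cinner (hmul g x) (hmul g y) = cinner x y"
proof -
  note [measurable] = L2_measurable[OF bd_L2]
  note m = bd_hmul[OF bholo_hol[OF g], unfolded hmul_hol[OF g]]
  have "L2_inner (bd (hmul g x)) (bd (hmul g y)) = L2_inner (bd x) (bd y)"
    unfolding L2_inner_def
  proof (rule integral_cong_AE)
    show "AE \<zeta> in circle_measure. bd (hmul g x) \<zeta> * cnj (bd (hmul g y) \<zeta>) = bd x \<zeta> * cnj (bd y \<zeta>)"
      using m[of x] m[of y] u
    proof eventually_elim
      case (elim \<zeta>)
      have "bd (hol g) \<zeta> * cnj (bd (hol g) \<zeta>) = 1" using complex_norm_square[of "bd (hol g) \<zeta>"] elim(3) by simp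
      then have "(bd (hol g) \<zeta> * cnj (bd (hol g) \<zeta>)) * (bd x \<zeta> * cnj (bd y \<zeta>)) = bd x \<zeta> * cnj (bd y \<zeta>)" by simp
      then show ?case unfolding elim(1,2) by (simp add: mult_ac)
    qed
  qed measurable
  then show ?thesis by (simp add: L2_inner_bd)
qed

text \<open>Radial limits exist wherever the formula is continuous at the boundary point. For
  \<open>Ei\<close> only the point 1 is lost.\<close>

lemma bd_hol_continuous:
  assumes g: "bholo B g" and c: "AE \<zeta> in circle_measure. isCont h \<zeta>" and e: "\<And>z. norm z < 1 \<Longrightarrow> g z = h z"
  shows "AE \<zeta> in circle_measure. bd (hol g) \<zeta> = h \<zeta>"
proof (rule bd_radial)
  show "AE \<zeta> in circle_measure. ((\<lambda>r. fn (hol g) (of_real r * \<zeta>)) \<longlongrightarrow> h \<zeta>) (at_left 1)"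
    using c AE_circle_norm
  proof eventually_elim
    case (elim \<zeta>)
    have "((\<lambda>r. of_real r * \<zeta>) \<longlongrightarrow> of_real 1 * \<zeta>) (at_left (1::real))" by (intro tendsto_intros)
    then have "((\<lambda>r. h (of_real r * \<zeta>)) \<longlongrightarrow> h \<zeta>) (at_left (1::real))"
      using isCont_tendsto_compose[OF elim(1)] by simp
    moreover have "\<forall>\<^sub>F r in at_left (1::real). h (of_real r * \<zeta>) = fn (hol g) (of_real r * \<zeta>)"
      by (rule eventually_at_leftI[of 0]) (use elim(2) in \<open>auto simp: hol[OF g] norm_mult e\<close>)
    ultimately show ?case by (rule Lim_transform_eventually)
  qed
qed

section \<open>Monomials and Szego kernels\<close>

definition monomial :: "nat \<Rightarrow> hardy" where "monomial n = hol (\<lambda>z. z ^ n)"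

lemma bholo_power: "bholo 1 (\<lambda>z. z ^ n)"
  by (auto simp: bholo_def norm_power power_le_one intro!: holomorphic_intros)

lemma fn_monomial: "norm z < 1 \<Longrightarrow> fn (monomial n) z = z ^ n"
  by (simp add: monomial_def hol[OF bholo_power])

lemma hcoef_monomial: "hcoef (monomial n) = (\<lambda>k. if k = n then 1 else 0)"
proof (rule coef_eqI)
  fix z :: complex assume "norm z < 1"
  then show "(\<lambda>k. (if k = n then 1 else 0) * z ^ k) sums fn (monomial n) z"
    using sums_single[of n "\<lambda>k. z ^ k"] by (simp add: fn_monomial if_distrib[of "\<lambda>x. x * _"] cong: if_cong)
qed

lemma cinner_monomial: "cinner f (monomial n) = hcoef f n"
proof (rule sums_unique2[OF cinner_sums])
  show "(\<lambda>k. hcoef f k * cnj (hcoef (monomial n) k)) sums hcoef f n"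
    using sums_single[of n "hcoef f"] by (simp add: hcoef_monomial if_distrib[of cnj] if_distrib[of "\<lambda>x. _ * x"] cong: if_cong)
qed

definition kern :: "real \<Rightarrow> hardy" where "kern r = hol (\<lambda>z. 1 / (1 - of_real r * z))"

context
  fixes r :: real
  assumes r: "0 \<le> r" "r < 1"
begin

text \<open>The second bound follows from 1 - z = (1 - rz) - (1 - r) z, where the last term is at
  most 1 - r and thus at most |1 - rz|. It compares the kernel with 1/(1 - z) uniformly in r, both
  when a cancels the pole and when E suppresses it.\<close>

lemma kern_denom:
  fixes z :: complex
  assumes "norm z < 1"
  shows "1 - r \<le> norm (1 - of_real r * z)" "norm (1 - z) \<le> 2 * norm (1 - of_real r * z)" "1 - of_real r * z \<noteq> 0"
proof -
  have "norm (of_real r * z) \<le> r" using r assms by (simp add: norm_mult mult_left_le)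
  then show *: "1 - r \<le> norm (1 - of_real r * z)" using norm_triangle_ineq2[of 1 "of_real r * z"] by simp
  have "1 - z = (1 - of_real r * z) - of_real (1 - r) * z" by (simp add: algebra_simps)
  then have "norm (1 - z) \<le> norm (1 - of_real r * z) + norm (of_real (1 - r) * z)"
    by (metis norm_triangle_ineq4)
  also have "norm (of_real (1 - r) * z) \<le> 1 - r"
    unfolding norm_mult norm_of_real using r assms by (simp add: mult_left_le)
  finally show "norm (1 - z) \<le> 2 * norm (1 - of_real r * z)" using * by simp
  show "1 - of_real r * z \<noteq> 0" using * r by auto
qed

lemma bholo_kern: "bholo (1 / (1 - r)) (\<lambda>z. 1 / (1 - of_real r * z))"
  unfolding bholo_def
proof (intro conjI allI impI)
  show "(\<lambda>z. 1 / (1 - of_real r * z)) holomorphic_on ball 0 1"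
    using kern_denom(3) by (auto intro!: holomorphic_intros)
  show "norm (1 / (1 - of_real r * z)) \<le> 1 / (1 - r)" if "norm z < 1" for z :: complex
    using kern_denom(1)[OF that] r by (simp add: norm_divide frac_le)
qed

lemma fn_kern: "norm z < 1 \<Longrightarrow> fn (kern r) z = 1 / (1 - of_real r * z)"
  by (simp add: kern_def hol[OF bholo_kern])

lemma hcoef_kern: "hcoef (kern r) = (\<lambda>n. of_real r ^ n)"
proof (rule coef_eqI)
  fix z :: complex assume z: "norm z < 1"
  have "norm (of_real r * z) < 1" using r z kern_denom
    by (metis abs_of_nonneg mult_left_le_one_le norm_ge_zero norm_mult norm_of_real order_le_less_trans less_imp_le)
  then show "(\<lambda>n. of_real r ^ n * z ^ n) sums fn (kern r) z"
    using geometric_sums[of "of_real r * z"] by (simp add: fn_kern[OF z] power_mult_distrib)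
qed

lemma cinner_kern: "cinner (kern r) f = cnj (fn f (of_real r))"
proof -
  have "(\<lambda>n. hcoef f n * of_real r ^ n) sums fn f (of_real r)"
    by (rule coef_sums) (use fn_disk[of f] r in \<open>auto simp: disk_holo_def\<close>)
  then have "(\<lambda>n. cnj (hcoef f n * of_real r ^ n)) sums cnj (fn f (of_real r))" by (rule sums_cnj[THEN iffD2])
  then show ?thesis
    by (intro sums_unique2[OF cinner_sums]) (simp add: hcoef_kern mult.commute)
qed

lemma norm_kern: "norm (kern r) \<le> 1 / sqrt (1 - r)"
proof -
  have "cinner (kern r) (kern r) = of_real (1 / (1 - r * r))"
    unfolding cinner_kern using r by (simp add: fn_kern)
  then have "(norm (kern r))\<^sup>2 = 1 / (1 - r * r)" unfolding cinner_same of_real_eq_iff .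
  also have "\<dots> \<le> 1 / (1 - r)"
    using r mult_left_le_one_le[of r r] by (intro divide_left_mono mult_pos_pos) (auto simp: mult_less_cancel_right2 le_less_trans)
  also have "\<dots> = (1 / sqrt (1 - r))\<^sup>2" using r by (simp add: power_divide)
  finally show ?thesis by (rule power2_le_imp_le) (use r in simp)
qed

end

section \<open>Pythagorean pairs\<close>

lemma cinner_hlin_right: "cinner h (hlin c f d g) = cnj c * cinner h f + cnj d * cinner h g"
  by (simp add: hlin_eq cinner_add_right cinner_hscale_right)

lemma inner_hadj: "cblin C R \<Longrightarrow> inner (hadj R x) y = inner x (R y)"
  by (simp add: inner_hardy_def hadj)

text \<open>\<open>pyth\<close> is the weak form of |b|^2 + |a|^2 = 1 on the circle: the adjoints of
  the two multiplications, composed with them, add up to the identity. S is the positive root whose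
  range is H(b).\<close>

locale pythagorean_pair =
  fixes b a :: hardy and S :: "hardy \<Rightarrow>\<^sub>L hardy"
  assumes b: "bholo 1 (fn b)" and a: "bholo 1 (fn a)"
    and pyth: "\<And>x y. cinner (hmul (fn b) x) (hmul (fn b) y) + cinner (hmul (fn a) x) (hmul (fn a) y) = cinner x y"
    and psd: "psd S" and SS: "\<And>x. S (S x) = x - hmul (fn b) (hadj (hmul (fn b)) x)"
    and a_nz: "\<And>x. hmul (fn a) x = 0 \<Longrightarrow> x = 0"
begin

abbreviation "M \<equiv> hmul (fn b)"
abbreviation "N \<equiv> hmul (fn a)"

lemmas M = cblin_hmul[OF b] and N = cblin_hmul[OF a]

lemma pyth_inner: "inner (M x) (M y) + inner (N x) (N y) = inner x y"
  using arg_cong[OF pyth, of Re] by (simp add: inner_hardy_def)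

lemma S_sym: "inner (S x) y = inner x (S y)"
  using psd by (simp add: psd_def symm_def)

lemma norm_S_sq: "(norm (S x))\<^sup>2 = (norm x)\<^sup>2 - (norm (hadj M x))\<^sup>2"
proof -
  have "(norm (S x))\<^sup>2 = inner x (S (S x))" by (simp add: power2_norm_eq_inner S_sym)
  also have "\<dots> = inner x x - inner x (M (hadj M x))" by (simp add: SS inner_diff_right)
  also have "inner x (M (hadj M x)) = (norm (hadj M x))\<^sup>2" by (simp add: inner_hadj[OF M, symmetric] power2_norm_eq_inner)
  finally show ?thesis by (simp add: power2_norm_eq_inner)
qed

text \<open>|a x|^2 = |x|^2 - |b x|^2 by \<open>pyth\<close>, and hyponormality replaces b x by the
  image of x under the adjoint, which gives |S x|^2. Injectivity of S and the range inclusion below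
  rest on this.\<close>

lemma norm_N_le: "norm (N x) \<le> norm (S x)"
proof (rule power2_le_imp_le)
  have "(norm (hadj M x))\<^sup>2 \<le> (norm (M x))\<^sup>2" by (intro power_mono norm_hadj_le[OF b]) simp
  then show "(norm (N x))\<^sup>2 \<le> (norm (S x))\<^sup>2"
    using pyth_inner[of x x] unfolding norm_S_sq unfolding power2_norm_eq_inner by linarith
qed simp

lemma S_inj: "S x = 0 \<Longrightarrow> x = 0"
  using norm_N_le[of x] a_nz by simp

text \<open>Substituting \<open>hadj M (M k) = k - hadj N (N k)\<close> leaves |S (b k)|^2 = |a k|^2
  - |\<open>hadj N (N k)\<close>|^2. Since <S g, b k> = <g, S (b k)>, this bounds the functional u
  |-> <u, b k> on H(b).\<close>

lemma norm_S_M_le: "norm (S (M k)) \<le> norm (N k)"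
proof (rule power2_le_imp_le)
  have "hadj M (M k) = k - hadj N (N k)"
  proof -
    have "inner y (hadj M (M k)) = inner y (k - hadj N (N k))" for y
      using pyth_inner[of k y]
      by (simp add: inner_commute[of y] inner_hadj[OF M] inner_hadj[OF N] inner_diff_left)
    then show ?thesis by (metis vector_eq_ldot)
  qed
  then have "(norm (hadj M (M k)))\<^sup>2 = inner (k - hadj N (N k)) (k - hadj N (N k))" by (simp add: power2_norm_eq_inner)
  also have "\<dots> = inner k k - 2 * inner (N k) (N k) + inner (hadj N (N k)) (hadj N (N k))"
    using inner_hadj[OF N, of "N k" k] by (simp add: inner_diff_left inner_diff_right inner_commute)
  finally show "(norm (S (M k)))\<^sup>2 \<le> (norm (N k))\<^sup>2"
    using pyth_inner[of k k] inner_ge_zero[of "hadj N (N k)"] unfolding norm_S_sq unfolding power2_norm_eq_inner by linarith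
qed simp

text \<open>Douglas' argument on \<open>norm_N_le\<close>: the functional x |-> <x,
  \<open>hadj N h\<close>> is bounded by |h| |S x|, hence represented through S. It is the means of
  recognizing members of H(b).\<close>

lemma range_hadj_N: "\<exists>g. S g = hadj N h"
proof -
  have "\<exists>g. \<forall>x. inner x (hadj N h) = inner (S x) g"
  proof (rule bounded_functional_range[where C="norm h"])
    show "linear (blinfun_apply S)" by (rule bounded_linear.linear[OF blinfun.bounded_linear_right])
    show "linear (\<lambda>x. inner x (hadj N h))" by (rule linearI) (auto simp: inner_add_left)
    fix x
    have "inner x (hadj N h) = inner h (N x)" by (simp add: inner_hadj[OF N] inner_commute[of x])
    also have "\<bar>\<dots>\<bar> \<le> norm h * norm (N x)" by (rule Cauchy_Schwarz_ineq2)
    also have "\<dots> \<le> norm h * norm (S x)" by (intro mult_left_mono norm_N_le) simp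
    finally show "\<bar>inner x (hadj N h)\<bar> \<le> norm h * norm (S x)" .
  qed
  then obtain g where "\<And>x. inner x (S g) = inner x (hadj N h)" by (metis S_sym)
  then show ?thesis by (metis vector_eq_ldot)
qed

text \<open>On this kernel S squares to the identity, so S x - x is an eigenvector of S for the
  eigenvalue -1 or zero; positivity leaves zero. Hence the kernel lies isometrically in
  H(b).\<close>

lemma S_eq_self:
  assumes "hadj M x = 0" shows "S x = x"
proof -
  have "S (S x) = x" using SS[of x] linear_0[OF bounded_linear.linear[OF cblin_bounded_linear[OF M]]] by (simp add: assms)
  then have "S (S x - x) = - (S x - x)" by (simp add: blinfun.bilinear_simps)
  moreover have "0 \<le> inner (S (S x - x)) (S x - x)" using psd by (simp add: psd_def)
  ultimately have "inner (S x - x) (S x - x) \<le> 0" by (metis inner_minus_left neg_0_le_iff_le)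
  then show ?thesis by (metis inner_ge_zero inner_eq_zero_iff order_antisym right_minus_eq)
qed

end

section \<open>The inner function and the pair\<close>

definition Ei :: "complex \<Rightarrow> complex" where "Ei z = exp (- ((1 + z) / (1 - z)))"

text \<open>The exponent is minus the Poisson kernel with pole at 1: \<open>Ei\<close> is the
  singular inner function of a unit point mass.\<close>

lemma norm_Ei: "norm (Ei z) = exp (- ((1 - (norm z)\<^sup>2) / (norm (1 - z))\<^sup>2))"
proof -
  have "Re ((1 + z) / (1 - z)) = (1 - (norm z)\<^sup>2) / (norm (1 - z))\<^sup>2"
    by (simp add: Re_divide cmod_power2) (simp add: power2_eq_square algebra_simps)
  then show ?thesis by (simp add: Ei_def)
qed

lemma norm_Ei_le: "norm z < 1 \<Longrightarrow> norm (Ei z) \<le> 1"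
  by (simp add: norm_Ei power_le_one)

lemma holomorphic_Ei [holomorphic_intros]: "Ei holomorphic_on ball 0 1"
  unfolding Ei_def[abs_def] by (auto intro!: holomorphic_intros)

lemma Ei_denom: "norm z < 1 \<Longrightarrow> 1 \<le> norm (2 - Ei z)" "norm z < 1 \<Longrightarrow> 2 - Ei z \<noteq> 0"
  using norm_triangle_ineq2[of 2 "Ei z"] norm_Ei_le[of z] by auto

text \<open>|2 - w|^2 - |2w - 1|^2 = 3 (1 - |w|^2).\<close>

lemma norm_blaschke: "norm (w :: complex) \<le> 1 \<Longrightarrow> norm (2 * w - 1) \<le> norm (2 - w)"
proof (rule power2_le_imp_le)
  assume "norm w \<le> 1"
  then have "(norm w)\<^sup>2 \<le> 1" by (simp add: power_le_one)
  then show "(norm (2 * w - 1))\<^sup>2 \<le> (norm (2 - w))\<^sup>2"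
    by (simp add: cmod_power2) (simp add: power2_eq_square algebra_simps)
qed simp

definition bf :: "complex \<Rightarrow> complex" where "bf z = (1 + z) / 2 * ((2 * Ei z - 1) / (2 - Ei z))"
definition af :: "complex \<Rightarrow> complex" where "af z = (1 - z) / 2"

lemma bholo_Ei: "bholo 1 Ei"
  by (auto simp: bholo_def norm_Ei_le intro!: holomorphic_intros)

lemma bholo_id: "bholo 1 (\<lambda>z. z)"
  by (auto simp: bholo_def intro!: holomorphic_intros)

lemma bholo_B: "bholo 1 (\<lambda>z. (2 * Ei z - 1) / (2 - Ei z))"
  unfolding bholo_def
proof (intro conjI allI impI)
  show "(\<lambda>z. (2 * Ei z - 1) / (2 - Ei z)) holomorphic_on ball 0 1"
    using Ei_denom(2) by (auto intro!: holomorphic_intros)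
  show "norm ((2 * Ei z - 1) / (2 - Ei z)) \<le> 1" if "norm z < 1" for z
    using norm_blaschke[OF norm_Ei_le[OF that]] Ei_denom[OF that] by (simp add: norm_divide divide_le_eq_1)
qed

lemma bholo_inv: "bholo 1 (\<lambda>z. 1 / (2 - Ei z))"
  unfolding bholo_def
proof (intro conjI allI impI)
  show "(\<lambda>z. 1 / (2 - Ei z)) holomorphic_on ball 0 1"
    using Ei_denom(2) by (auto intro!: holomorphic_intros)
  show "norm (1 / (2 - Ei z)) \<le> 1" if "norm z < 1" for z
    using Ei_denom(1)[OF that] by (simp add: norm_divide divide_le_eq)
qed

lemma bholo_weaken: "bholo B g \<Longrightarrow> B \<le> C \<Longrightarrow> bholo C g"
  by (force simp: bholo_def)

lemma bholo_times: "bholo B g \<Longrightarrow> bholo C h \<Longrightarrow> bholo (B * C) (\<lambda>z. g z * h z)"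
  unfolding bholo_def
  by (auto simp: norm_mult intro!: holomorphic_intros mult_mono intro: order_trans[OF norm_ge_zero])

lemma bholo_lin:
  assumes "bholo B g" shows "bholo (norm c + norm d * B) (\<lambda>z. c + d * g z)"
  unfolding bholo_def
proof (intro conjI allI impI)
  show "(\<lambda>z. c + d * g z) holomorphic_on ball 0 1" using assms by (auto simp: bholo_def intro!: holomorphic_intros)
  fix z :: complex assume "norm z < 1"
  then have "norm (d * g z) \<le> norm d * B" using assms by (auto simp: norm_mult bholo_def intro: mult_left_mono)
  then show "norm (c + d * g z) \<le> norm c + norm d * B" using norm_triangle_ineq[of c "d * g z"] by linarith
qed

lemma bholo_1z: "bholo 2 (\<lambda>z. 1 + z)" and bholo_P: "bholo 1 (\<lambda>z. (1 + z) / 2)" and bholo_af: "bholo 1 af"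
proof -
  show "bholo 2 (\<lambda>z. 1 + z)" using bholo_lin[OF bholo_id, of 1 1] by simp
  show "bholo 1 (\<lambda>z. (1 + z) / 2)" using bholo_lin[OF bholo_id, of "1/2" "1/2"] by (simp add: add_divide_distrib)
  show "bholo 1 af" using bholo_lin[OF bholo_id, of "1/2" "-1/2"] by (simp add: af_def[abs_def] diff_divide_distrib)
qed

lemma bf_af: "norm z < 1 \<Longrightarrow> (norm (bf z))\<^sup>2 + (norm (af z))\<^sup>2 \<le> 1"
proof -
  assume z: "norm z < 1"
  have "norm (bf z) \<le> norm ((1 + z) / 2) * 1"
    unfolding bf_def norm_mult using bholo_B z by (intro mult_left_mono) (auto simp: bholo_def)
  then have "(norm (bf z))\<^sup>2 \<le> (norm ((1 + z) / 2))\<^sup>2" by (intro power_mono) auto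
  then have "(norm (bf z))\<^sup>2 + (norm (af z))\<^sup>2 \<le> (norm ((1 + z) / 2))\<^sup>2 + (norm (af z))\<^sup>2" by (rule add_right_mono)
  also have "\<dots> = (1 + (norm z)\<^sup>2) / 2"
    by (simp add: af_def norm_divide power_divide cmod_power2) (simp add: power2_eq_square field_simps)
  also have "\<dots> \<le> 1" using z by (simp add: power_le_one)
  finally show ?thesis .
qed

lemma bholo_bf: "bholo 1 bf"
  using bholo_times[OF bholo_P bholo_B] by (simp add: bf_def[abs_def])

lemma isometry_Ei: "cinner (hmul Ei x) (hmul Ei y) = cinner x y"
proof (rule isometry_hmul[OF bholo_Ei])
  have "AE \<zeta> in circle_measure. isCont Ei \<zeta>"
    using AE_circle_ne[of 1] by eventually_elim (auto simp: Ei_def[abs_def] intro!: continuous_intros)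
  then have "AE \<zeta> in circle_measure. bd (hol Ei) \<zeta> = Ei \<zeta>" by (rule bd_hol_continuous[OF bholo_Ei]) simp
  then show "AE \<zeta> in circle_measure. norm (bd (hol Ei) \<zeta>) = 1"
    using AE_circle_norm by eventually_elim (simp add: norm_Ei)
qed

lemma isometry_id: "cinner (hmul (\<lambda>z. z) x) (hmul (\<lambda>z. z) y) = cinner x y"
proof (rule isometry_hmul[OF bholo_id])
  have "AE \<zeta> in circle_measure. bd (hol (\<lambda>z. z)) \<zeta> = \<zeta>" by (rule bd_hol_continuous[OF bholo_id]) auto
  then show "AE \<zeta> in circle_measure. norm (bd (hol (\<lambda>z. z)) \<zeta>) = 1"
    using AE_circle_norm by eventually_elim simp
qed

text \<open>With q = u / (2 - E) one has B u = 2 E q - q and u = 2 q - E q. Multiplication by E is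
  isometric, so both combinations have the same inner products; boundary values of B itself are
  never computed.\<close>

lemma isometry_B:
  defines "B \<equiv> hmul (\<lambda>z. (2 * Ei z - 1) / (2 - Ei z))"
  shows "cinner (B x) (B y) = cinner x y"
proof -
  define q where "q = hmul (\<lambda>z. 1 / (2 - Ei z))"
  have Bq: "B u = hlin 2 (hmul Ei (q u)) (-1) (q u)" for u
    by (rule hardy_disk_eqI)
       (simp only: B_def q_def hlin.rep_eq fn_hmul[OF bholo_B] fn_hmul[OF bholo_Ei] fn_hmul[OF bholo_inv],
        simp add: diff_divide_distrib left_diff_distrib)
  have uq: "u = hlin 2 (q u) (-1) (hmul Ei (q u))" for u
  proof (rule hardy_disk_eqI)
    fix z :: complex assume z: "norm z < 1"
    define y where "y = 2 - Ei z"
    have y: "Ei z = 2 - y" "y \<noteq> 0" using Ei_denom(2)[OF z] by (simp_all add: y_def)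
    show "fn (u) z = fn (hlin 2 (q u) (-1) (hmul Ei (q u))) z"
      by (simp only: q_def hlin.rep_eq fn_hmul[OF bholo_Ei] fn_hmul[OF bholo_inv] y(1)) (use y(2) in \<open>simp add: field_simps\<close>)
  qed
  have "cinner (B x) (B y) = cinner (hlin 2 (q x) (-1) (hmul Ei (q x))) (hlin 2 (q y) (-1) (hmul Ei (q y)))"
    unfolding Bq cinner_hlin_left cinner_hlin_right isometry_Ei by (simp add: algebra_simps)
  then show ?thesis by (simp only: uq[symmetric])
qed

lemma hmul_bf: "hmul (fn (hol bf)) x = hmul (\<lambda>z. (1 + z) / 2) (hmul (\<lambda>z. (2 * Ei z - 1) / (2 - Ei z)) x)"
  unfolding hmul_hol[OF bholo_bf]
  by (rule hardy_fn_eqI) (simp only: fn_hmul[OF bholo_bf] fn_hmul[OF bholo_P] fn_hmul[OF bholo_B], simp add: bf_def)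

text \<open>For (1 + z)/2 and (1 - z)/2 this is the parallelogram law with the isometry given by
  multiplication by z. The inner factor B is inserted afterwards, as it is isometric and commutes
  with multiplication by a.\<close>

lemma bf_af_pyth:
  "cinner (hmul (fn (hol bf)) x) (hmul (fn (hol bf)) y) + cinner (hmul (fn (hol af)) x) (hmul (fn (hol af)) y) = cinner x y"
proof -
  define B where "B = hmul (\<lambda>z. (2 * Ei z - 1) / (2 - Ei z))"
  define P where "P = hmul (\<lambda>z. (1 + z) / 2)"
  define N where "N = hmul af"
  have Pe: "P u = hlin (1/2) u (1/2) (hmul (\<lambda>z. z) u)" for u
    by (rule hardy_fn_eqI) (simp only: P_def hlin.rep_eq fn_hmul[OF bholo_P] fn_hmul[OF bholo_id], simp add: field_simps)
  have Ne: "N u = hlin (1/2) u (-1/2) (hmul (\<lambda>z. z) u)" for u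
    by (rule hardy_fn_eqI) (simp only: N_def hlin.rep_eq fn_hmul[OF bholo_af] fn_hmul[OF bholo_id], simp add: af_def field_simps)
  have PN: "cinner (P u) (P v) + cinner (N u) (N v) = cinner u v" for u v
    unfolding Pe Ne cinner_hlin_left cinner_hlin_right isometry_id by (simp add: field_simps)
  have NB: "N (B u) = B (N u)" for u
    by (rule hardy_fn_eqI) (simp only: N_def B_def fn_hmul[OF bholo_B] fn_hmul[OF bholo_af] mult.left_commute)
  have "cinner (P (B x)) (P (B y)) + cinner (N x) (N y) = cinner (P (B x)) (P (B y)) + cinner (N (B x)) (N (B y))"
    unfolding NB unfolding B_def isometry_B ..
  also have "\<dots> = cinner x y" unfolding PN unfolding B_def isometry_B ..
  finally show ?thesis unfolding hmul_bf hmul_hol[OF bholo_af] B_def P_def N_def .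
qed

lemma hmul_af_inj: "hmul (fn (hol af)) x = 0 \<Longrightarrow> x = 0"
proof (rule hardy_disk_eqI)
  fix z :: complex assume h: "hmul (fn (hol af)) x = 0" and z: "norm z < 1"
  have "fn (hmul af x) z = 0" using h unfolding hmul_hol[OF bholo_af] by simp
  then show "fn x z = fn 0 z" using z by (auto simp: fn_hmul[OF bholo_af] af_def)
qed

text \<open>The coefficients of a preimage under the coanalytic Toeplitz operator with symbol \<open>(1 - z)/2\<close> are
  twice the tail sums of the coefficients.\<close>

lemma hadj_af_preimage:
  assumes x: "\<And>n. norm (hcoef x n) \<le> C * q ^ n" and q: "0 \<le> q" "q < 1"
  shows "\<exists>h. hadj (hmul (fn (hol af))) h = x"
proof -
  have sC: "summable (\<lambda>n. C * q ^ (n + k))" for k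
    unfolding power_add using q by (intro summable_mult summable_mult2 summable_geometric) auto
  have s: "summable (\<lambda>n. hcoef x (n + k))" for k
    by (rule summable_comparison_test'[OF sC[of k], of 0]) (use x in auto)
  define c where "c k = 2 * (\<Sum>n. hcoef x (n + k))" for k
  have C0: "0 \<le> C" using order_trans[OF norm_ge_zero x[of 0]] by simp
  have cle: "norm (c k) \<le> 2 * (C / (1 - q)) * q ^ k" for k
  proof -
    have ss: "summable (\<lambda>n. norm (hcoef x (n + k)))"
      by (rule summable_comparison_test'[OF sC[of k], of 0]) (use x in auto)
    have "norm (\<Sum>n. hcoef x (n + k)) \<le> (\<Sum>n. norm (hcoef x (n + k)))" by (rule summable_norm[OF ss])
    also have "\<dots> \<le> (\<Sum>n. C * q ^ (n + k))" by (rule suminf_le[OF _ ss sC]) (rule x)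
    also have "\<dots> = (C / (1 - q)) * q ^ k"
    proof -
      have "(\<lambda>n. (C * q ^ k) * q ^ n) sums ((C * q ^ k) * (1 / (1 - q)))"
        by (intro sums_mult geometric_sums) (use q in auto)
      then show ?thesis by (simp add: sums_iff power_add mult_ac)
    qed
    finally show ?thesis by (simp add: c_def norm_mult)
  qed
  have "summable (\<lambda>k. (norm (c k))\<^sup>2)"
  proof (rule summable_comparison_test'[of "\<lambda>k. (2 * (C / (1 - q)))\<^sup>2 * (q\<^sup>2) ^ k" 0])
    show "summable (\<lambda>k. (2 * (C / (1 - q)))\<^sup>2 * (q\<^sup>2) ^ k)"
      using q by (intro summable_mult summable_geometric) (simp add: power_less_one_iff)
    show "norm ((norm (c k))\<^sup>2) \<le> (2 * (C / (1 - q)))\<^sup>2 * (q\<^sup>2) ^ k" for k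
    proof -
      have "(2 * (C / (1 - q)) * q ^ k)\<^sup>2 = (2 * (C / (1 - q)))\<^sup>2 * (q\<^sup>2) ^ k"
        by (simp add: power2_eq_square power_mult_distrib)
      then show ?thesis using power_mono[OF cle[of k] norm_ge_zero, of 2] by (simp only: real_norm_def abs_power2)
    qed
  qed
  then obtain h where h: "hcoef h = c" using hardy_of_coefs by metis
  have "hcoef (hadj (hmul (fn (hol af))) h) n = hcoef x n" for n
  proof -
    \<comment> \<open>So the adjoint acts on coefficients as half the difference h_n - h_(n+1),
      which the doubled tail sums invert.\<close>
    have e: "hmul af (monomial n) = hlin (1/2) (monomial n) (-1/2) (monomial (Suc n))"
      by (rule hardy_disk_eqI) (simp add: fn_hmul[OF bholo_af] hlin.rep_eq fn_monomial, simp add: af_def field_simps)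
    have "hcoef (hadj (hmul (fn (hol af))) h) n = cinner h (hmul af (monomial n))"
      by (simp add: cinner_monomial[symmetric] hadj[OF cblin_hmul[OF bholo_hol[OF bholo_af]]] hmul_hol[OF bholo_af])
    also have "\<dots> = c n / 2 - c (Suc n) / 2" by (simp add: e cinner_hlin_right cinner_monomial h)
    also have "\<dots> = hcoef x n" using suminf_split_head[OF s[of n]] by (simp add: c_def diff_divide_distrib)
    finally show ?thesis .
  qed
  then show ?thesis using hardy_eqI by blast
qed

section \<open>Test functions\<close>

definition dil_norm :: "real \<Rightarrow> hardy \<Rightarrow> real" where
  "dil_norm R f = sqrt (sqint (\<lambda>\<zeta>. fn f (of_real R * \<zeta>)))"

lemma dil_norm_le: "0 \<le> R \<Longrightarrow> R < 1 \<Longrightarrow> dil_norm R f \<le> norm f"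
  unfolding dil_norm_def by (rule real_le_lsqrt) (use norm_dilate_le[of R f] in auto)

lemma dil_norm_hmul:
  assumes g: "bholo B g" and R: "0 \<le> R" "R < 1"
  shows "dil_norm R (hmul g f) \<le> B * dil_norm R f"
  using real_sqrt_le_mono[OF dilate_mult_le[OF g R, of f]] bholo_nonneg[OF g]
  by (simp add: dil_norm_def fn_hmul[OF g] real_sqrt_mult)

definition eps :: "real \<Rightarrow> real" where "eps r = exp (- ((1 + r) / (1 - r)))"

lemma Ei_of_real: "Ei (of_real r) = of_real (eps r)"
  by (simp add: Ei_def eps_def flip: exp_of_real)

text \<open>The reproducing kernel at r of the orthogonal complement of E H^2, divided by 2 - E.
  Here \<open>eps r\<close> is E(r), a real number, which is why no conjugate appears.\<close>

definition test_f :: "real \<Rightarrow> hardy" where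
  "test_f r = hmul (\<lambda>z. (1 - of_real (eps r) * Ei z) * (1 / (2 - Ei z))) (kern r)"
definition test_k :: "real \<Rightarrow> hardy" where "test_k r = hmul (\<lambda>z. 2 - Ei z) (kern r)"
definition Ekern :: "real \<Rightarrow> hardy" where "Ekern r = hmul Ei (kern r)"

context
  fixes r :: real
  assumes r: "0 \<le> r" "r < 1"
begin

lemma eps_01: "0 \<le> eps r" "eps r \<le> 1"
  using r by (auto simp: eps_def)

lemma bholo_test_f: "bholo 2 (\<lambda>z. (1 - of_real (eps r) * Ei z) * (1 / (2 - Ei z)))"
proof -
  have "bholo 2 (\<lambda>z. 1 + (- of_real (eps r)) * Ei z)"
    by (rule bholo_weaken[OF bholo_lin[OF bholo_Ei]]) (use eps_01 in simp)
  from bholo_times[OF this bholo_inv] show ?thesis by simp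
qed

lemma bholo_2E: "bholo 3 (\<lambda>z. 2 - Ei z)"
  using bholo_lin[OF bholo_Ei, of 2 "-1"] by simp

lemma norm_test_f: "norm (test_f r) \<le> 2 * (1 / sqrt (1 - r))"
proof -
  have "norm (test_f r) \<le> 2 * norm (kern r)" unfolding test_f_def by (rule bholo_mult(2)[OF bholo_test_f])
  then show ?thesis using norm_kern[OF r] by linarith
qed

text \<open>With q = (1 + z) g / (2 (2 - E)) one has b g = 2 E q - q, and isometry of E turns <f, b
  g> into <(2 - E) f, E q>. As (2 - E) f is K - E(r) E K for the kernel K at r, the two reproducing
  values E(r) q(r) cancel.\<close>

lemma hadj_test_f: "hadj (hmul (fn (hol bf))) (test_f r) = 0"
proof (rule cinner_eqI)
  fix g
  note M = cblin_hmul[OF bholo_hol[OF bholo_bf]]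
  define q where "q = hmul (\<lambda>z. (1 + z) / 2 * (1 / (2 - Ei z))) g"
  have bq: "bholo 1 (\<lambda>z. (1 + z) / 2 * (1 / (2 - Ei z)))" using bholo_times[OF bholo_P bholo_inv] by simp
  have "hmul (fn (hol bf)) g = hlin 2 (hmul Ei q) (-1) q"
    unfolding hmul_hol[OF bholo_bf]
  proof (rule hardy_disk_eqI)
    fix z :: complex assume z: "norm z < 1"
    define y where "y = 2 - Ei z"
    have y: "Ei z = 2 - y" "y \<noteq> 0" using Ei_denom(2)[OF z] by (simp_all add: y_def)
    show "fn (hmul bf g) z = fn (hlin 2 (hmul Ei q) (-1) q) z"
      by (simp only: fn_hmul[OF bholo_bf] hlin.rep_eq fn_hmul[OF bholo_Ei] q_def fn_hmul[OF bq] bf_def y(1)) (use y(2) in \<open>simp add: field_simps\<close>)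
  qed
  then have "cinner (hadj (hmul (fn (hol bf))) (test_f r)) g = 2 * cinner (test_f r) (hmul Ei q) - cinner (hmul Ei (test_f r)) (hmul Ei q)"
    by (simp add: hadj[OF M] cinner_hlin_right isometry_Ei)
  also have "\<dots> = cinner (hlin 2 (test_f r) (-1) (hmul Ei (test_f r))) (hmul Ei q)" by (simp add: cinner_hlin_left)
  also have "hlin 2 (test_f r) (-1) (hmul Ei (test_f r)) = hlin 1 (kern r) (- of_real (eps r)) (hmul Ei (kern r))"
  proof (rule hardy_disk_eqI)
    fix z :: complex assume z: "norm z < 1"
    define y where "y = 2 - Ei z"
    have y: "Ei z = 2 - y" "y \<noteq> 0" using Ei_denom(2)[OF z] by (simp_all add: y_def)
    show "fn (hlin 2 (test_f r) (-1) (hmul Ei (test_f r))) z = fn (hlin 1 (kern r) (- of_real (eps r)) (hmul Ei (kern r))) z"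
      by (simp only: hlin.rep_eq test_f_def fn_hmul[OF bholo_Ei] fn_hmul[OF bholo_test_f] y(1)) (use y(2) in \<open>simp add: field_simps\<close>)
  qed
  also have "cinner \<dots> (hmul Ei q) = cinner (kern r) (hmul Ei q) - of_real (eps r) * cinner (kern r) q"
    by (simp add: cinner_hlin_left isometry_Ei)
  also have "\<dots> = 0" by (simp add: cinner_kern[OF r] fn_hmul[OF bholo_Ei] Ei_of_real)
  finally show "cinner (hadj (hmul (fn (hol bf))) (test_f r)) g = cinner 0 g" by (simp add: cinner_zero)
qed

text \<open>The zero of a meets the pole of the kernel: (1 - z) / (2 (1 - rz)) is at most 1 in
  modulus uniformly in r, and 3 bounds 2 - E.\<close>

lemma norm_af_test_k: "norm (hmul (fn (hol af)) (test_k r)) \<le> 3"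
proof -
  define g where "g z = af z * ((2 - Ei z) * (1 / (1 - of_real r * z)))" for z
  have g: "bholo 3 g" unfolding bholo_def
  proof (intro conjI allI impI)
    show "g holomorphic_on ball 0 1" using bholo_af bholo_2E bholo_kern[OF r]
      unfolding g_def bholo_def by (intro holomorphic_on_mult) auto
    fix z :: complex assume z: "norm z < 1"
    have k: "norm (1 - z) \<le> 2 * norm (1 - of_real r * z)" "1 - of_real r * z \<noteq> 0" using kern_denom[OF r z] by auto
    have "norm (g z) = norm (2 - Ei z) * (norm (1 - z) / (2 * norm (1 - of_real r * z)))"
      unfolding g_def af_def norm_mult norm_divide by simp
    also have "\<dots> \<le> 3 * 1"
      using k bholo_2E z by (intro mult_mono) (auto simp: bholo_def divide_le_eq_1)
    finally show "norm (g z) \<le> 3" by simp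
  qed
  have "hmul (fn (hol af)) (test_k r) = hol g"
    unfolding hmul_hol[OF bholo_af] test_k_def
    by (rule hardy_disk_eqI) (simp add: fn_hmul[OF bholo_af] fn_hmul[OF bholo_2E] fn_kern[OF r] hol(1)[OF g], simp add: g_def)
  then show ?thesis using hol(2)[OF g] by simp
qed

end

text \<open>Both functions are split as a multiple of a kernel plus a remainder with the factor E: f
  = K/2 + X and b k = -P/2 + Y. The pairing of the kernels gives the negative main term of order
  s^2; each of the other three pairings contains X or Y and so a factor d, the norm of E K on the
  damped circle.\<close>

lemma test_estimate:
  assumes \<alpha>: "\<alpha> > -1" and r: "1/2 \<le> r" "r < 1"
  defines "\<kappa> \<equiv> (1 - (4/7) powr (1 + \<alpha>)) / 2" and "D \<equiv> 2 powr (1 + \<alpha>)"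
    and "s \<equiv> 1 / sqrt (1 - r)" and "d \<equiv> dil_norm (sqrt (sqrt r)) (Ekern r)"
  shows "inner (habel \<alpha> r (test_f r)) (hmul (fn (hol bf)) (test_k r)) \<le> - (\<kappa> * s\<^sup>2) / 4 + 2 * D * (s * d + d\<^sup>2)"
proof -
  have r': "0 \<le> r" "0 < r" "r < 1" using r by auto
  note A = cblin_habel[OF \<alpha> r'(2,3)]
  define R where "R = sqrt (sqrt r)"
  have R: "0 \<le> R" "R < 1" using r' by (auto simp: R_def)
  define K where "K = kern r"
  define P where "P = hmul (\<lambda>z. 1 + z) K"
  define Y where "Y = hmul (\<lambda>z. 1 + z) (Ekern r)"
  \<comment> \<open>The remainder of (1 - eps E)/(2 - E) after subtracting its value 1/2 at E = 0
    equals E times this function.\<close>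
  have gX: "bholo 1 (\<lambda>z. ((1 - 2 * of_real (eps r)) / 2) * (1 / (2 - Ei z)))"
  proof -
    have "norm (1 - 2 * complex_of_real (eps r)) = \<bar>1 - 2 * eps r\<bar>"
    proof -
      have "1 - 2 * complex_of_real (eps r) = of_real (1 - 2 * eps r)" by simp
      then show ?thesis by (simp only: norm_of_real)
    qed
    then have "norm ((1 - 2 * complex_of_real (eps r)) / 2) \<le> 1" using eps_01[OF r'(1,3)] by (simp add: norm_divide)
    then show ?thesis
      using bholo_lin[OF bholo_inv, of 0 "(1 - 2 * of_real (eps r)) / 2"] by (auto intro: bholo_weaken)
  qed
  define X where "X = hmul (\<lambda>z. ((1 - 2 * of_real (eps r)) / 2) * (1 / (2 - Ei z))) (Ekern r)"
  have f: "test_f r = hlin (1/2) K 1 X"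
  proof (rule hardy_disk_eqI)
    fix z :: complex assume z: "norm z < 1"
    define y where "y = 2 - Ei z"
    have y: "Ei z = 2 - y" "y \<noteq> 0" using Ei_denom(2)[OF z] by (simp_all add: y_def)
    show "fn (test_f r) z = fn (hlin (1/2) K 1 X) z"
      by (simp only: test_f_def fn_hmul[OF bholo_test_f[OF r'(1,3)]] hlin.rep_eq X_def fn_hmul[OF gX] Ekern_def fn_hmul[OF bholo_Ei] K_def y(1)) (use y(2) in \<open>simp add: field_simps\<close>)
  qed
  have F: "hmul (fn (hol bf)) (test_k r) = hlin (-1/2) P 1 Y"
    unfolding hmul_hol[OF bholo_bf]
  proof (rule hardy_disk_eqI)
    fix z :: complex assume z: "norm z < 1"
    define y where "y = 2 - Ei z"
    have y: "Ei z = 2 - y" "y \<noteq> 0" using Ei_denom(2)[OF z] by (simp_all add: y_def)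
    show "fn (hmul bf (test_k r)) z = fn (hlin (-1/2) P 1 Y) z"
      by (simp only: test_k_def fn_hmul[OF bholo_bf] fn_hmul[OF bholo_2E[OF r'(1,3)]] hlin.rep_eq P_def Y_def fn_hmul[OF bholo_1z] Ekern_def fn_hmul[OF bholo_Ei] K_def bf_def y(1)) (use y(2) in \<open>simp add: field_simps\<close>)
  qed
  have nK: "dil_norm R K \<le> s" unfolding K_def s_def by (rule order_trans[OF dil_norm_le[OF R] norm_kern[OF r'(1,3)]])
  have nP: "dil_norm R P \<le> 2 * s" unfolding P_def using dil_norm_hmul[OF bholo_1z R, of K] nK by linarith
  have nY: "dil_norm R Y \<le> 2 * d" unfolding Y_def d_def R_def[symmetric] by (rule dil_norm_hmul[OF bholo_1z R])
  have nX: "dil_norm R X \<le> d" using dil_norm_hmul[OF gX R, of "Ekern r"] by (simp add: X_def d_def R_def[symmetric])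
  have s0: "0 \<le> s" using r' by (simp add: s_def)
  have d0: "0 \<le> d" by (simp add: d_def dil_norm_def)
  have D0: "0 \<le> D" by (simp add: D_def)
  have le: "norm (cinner (habel \<alpha> r u) v) \<le> D * (p * q)" if "dil_norm R u \<le> p" "dil_norm R v \<le> q" for u v p q
  proof -
    have "norm (cinner (habel \<alpha> r u) v) \<le> D * (dil_norm R u * dil_norm R v)"
      unfolding D_def dil_norm_def R_def by (rule habel_cinner_le[OF \<alpha> r'(2,3)])
    also have "\<dots> \<le> D * (p * q)"
    proof (intro mult_left_mono mult_mono that D0)
      show "0 \<le> dil_norm R v" by (simp add: dil_norm_def)
      have "0 \<le> dil_norm R u" by (simp add: dil_norm_def)
      then show "0 \<le> p" using that(1) by linarith
    qed
    finally show ?thesis .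
  qed
  have e1: "norm (cinner (habel \<alpha> r K) Y) \<le> D * (s * (2 * d))" by (rule le[OF nK nY])
  have e2: "norm (cinner (habel \<alpha> r X) P) \<le> D * (d * (2 * s))" by (rule le[OF nX nP])
  have e3: "norm (cinner (habel \<alpha> r X) Y) \<le> D * (d * (2 * d))" by (rule le[OF nX nY])
  define T where "T = (\<Sum>k. abel_mult \<alpha> r k * (r\<^sup>2) ^ k)"
  have r2: "0 \<le> r\<^sup>2" "r\<^sup>2 < 1" using r' by (auto simp: power_less_one_iff)
  note gen = abel_mult_gen(1)[OF \<alpha> r'(2,3) r2]
  have T1: "1 \<le> T"
    using sum_le_suminf[OF gen, of "{0}"] abel_mult_nonneg[OF \<alpha> r'(2,3)] abel_mult_0[OF \<alpha> r'(2,3)] by (simp add: T_def)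
  have main: "Re (cinner (habel \<alpha> r K) P) \<ge> \<kappa> * s\<^sup>2"
  proof -
    \<comment> \<open>Writing (1 + z)/(1 - rz) as (1 + 1/r)/(1 - rz) - 1/r gives the pairing the
      value T + (T - 1)/r, which is at least T since T >= 1.\<close>
    have P: "P = hlin (of_real (1 + 1 / r)) K (of_real (- 1 / r)) (monomial 0)"
    proof (rule hardy_disk_eqI)
      fix z :: complex assume z: "norm z < 1"
      have "1 - of_real r * z \<noteq> 0" "complex_of_real r \<noteq> 0" using kern_denom(3)[OF r'(1,3) z] r' by auto
      then show "fn P z = fn (hlin (of_real (1 + 1 / r)) K (of_real (- 1 / r)) (monomial 0)) z"
        using z by (simp add: P_def K_def fn_hmul[OF bholo_1z] hlin.rep_eq fn_monomial fn_kern[OF r'(1,3)]) (simp add: field_simps)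
    qed
    have "cinner (habel \<alpha> r K) K = of_real T"
    proof (rule sums_unique2[OF cinner_sums])
      have "(\<lambda>k. complex_of_real (abel_mult \<alpha> r k * (r\<^sup>2) ^ k)) sums of_real T"
        unfolding T_def by (intro sums_of_real summable_sums gen)
      moreover have "hcoef (habel \<alpha> r K) k * cnj (hcoef K k) = of_real (abel_mult \<alpha> r k * (r\<^sup>2) ^ k)" for k
        by (simp add: habel_coef[OF \<alpha> r'(2,3)] K_def hcoef_kern[OF r'(1,3)] power2_eq_square power_mult_distrib)
      ultimately show "(\<lambda>k. hcoef (habel \<alpha> r K) k * cnj (hcoef K k)) sums of_real T" by simp
    qed
    moreover have "cinner (habel \<alpha> r K) (monomial 0) = 1"
      by (simp add: cinner_monomial habel_coef[OF \<alpha> r'(2,3)] K_def hcoef_kern[OF r'(1,3)] abel_mult_0[OF \<alpha> r'(2,3)])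
    ultimately have "cinner (habel \<alpha> r K) P = of_real ((1 + 1 / r) * T - 1 / r)"
      unfolding P cinner_hlin_right by simp
    then have "Re (cinner (habel \<alpha> r K) P) = (1 + 1 / r) * T - 1 / r" by (simp only: Re_complex_of_real)
    then have "Re (cinner (habel \<alpha> r K) P) = T + (T - 1) / r" by (simp add: distrib_right diff_divide_distrib)
    moreover have "0 \<le> (T - 1) / r" using T1 r' by simp
    moreover have "\<kappa> * s\<^sup>2 \<le> T"
      using abel_mult_kernel_lower[OF \<alpha> r'(2,3) r(1)] r' by (simp add: T_def \<kappa>_def s_def power_divide)
    ultimately show ?thesis by linarith
  qed
  have "cinner (habel \<alpha> r (test_f r)) (hmul (fn (hol bf)) (test_k r)) =
     - (cinner (habel \<alpha> r K) P / 4) + cinner (habel \<alpha> r K) Y / 2 - cinner (habel \<alpha> r X) P / 2 + cinner (habel \<alpha> r X) Y"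
    unfolding f F cblin_hlin[OF A] cinner_hlin_left cinner_hlin_right by (simp add: field_simps)
  then have "inner (habel \<alpha> r (test_f r)) (hmul (fn (hol bf)) (test_k r)) =
     - (Re (cinner (habel \<alpha> r K) P) / 4) + Re (cinner (habel \<alpha> r K) Y) / 2 - Re (cinner (habel \<alpha> r X) P) / 2 + Re (cinner (habel \<alpha> r X) Y)"
    unfolding inner_hardy_def by simp
  moreover have "Re (cinner (habel \<alpha> r K) Y) \<le> D * (s * (2 * d))" using e1 complex_Re_le_cmod order_trans by blast
  moreover have "- Re (cinner (habel \<alpha> r X) P) \<le> D * (d * (2 * s))"
    using e2 abs_Re_le_cmod[of "cinner (habel \<alpha> r X) P"] by linarith
  moreover have "Re (cinner (habel \<alpha> r X) Y) \<le> D * (d * (2 * d))" using e3 complex_Re_le_cmod order_trans by blast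
  ultimately have "inner (habel \<alpha> r (test_f r)) (hmul (fn (hol bf)) (test_k r)) \<le>
     - (\<kappa> * s\<^sup>2 / 4) + D * (s * (2 * d)) / 2 + D * (d * (2 * s)) / 2 + D * (d * (2 * d))"
    using main by linarith
  also have "\<dots> = - (\<kappa> * s\<^sup>2) / 4 + 2 * D * (s * d + d\<^sup>2)" by (simp add: power2_eq_square algebra_simps)
  finally show ?thesis .
qed

text \<open>Near the singular point \<open>1\<close> the inner function is small on the circle of radius \<open>R\<close>; away from it the
  kernel stays bounded. Hence the mass of \<open>Ekern r\<close> is negligible against \<open>1 / (1 - r)\<close>.\<close>

lemma Ekern_negligible:
  "(\<lambda>j. (1 - radii j) * (dil_norm (sqrt (sqrt (radii j))) (Ekern (radii j)))\<^sup>2) \<longlonglongrightarrow> 0"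
proof -
  define R where "R j = sqrt (sqrt (radii j))" for j
  have R: "0 \<le> R j" "R j < 1" "(R j)\<^sup>2 = sqrt (radii j)" for j using radii(1-3)[of j] by (auto simp: R_def)
  have Rl: "R \<longlonglongrightarrow> 1" unfolding R_def using tendsto_real_sqrt[OF tendsto_real_sqrt[OF radii(4)]] by simp
  define u where "u j \<zeta> = (1 - radii j) * (norm (fn (Ekern (radii j)) (of_real (R j) * \<zeta>)))\<^sup>2" for j \<zeta>
  \<comment> \<open>With t = (1 - r)/|1 - v|^2 the kernel contributes 4 t and the inner function at
    most exp(-t). The product is bounded near \<zeta> = 1, where t may be large, and small
    elsewhere, where t tends to 0.\<close>
  have bnd: "u j \<zeta> \<le> 4 * ((1 - radii j) / (norm (1 - of_real (R j) * \<zeta>))\<^sup>2) * exp (- ((1 - radii j) / (norm (1 - of_real (R j) * \<zeta>))\<^sup>2))"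
    if z: "norm \<zeta> = 1" for j \<zeta>
  proof -
    define v where "v = of_real (R j) * \<zeta>"
    have nv: "norm v = R j" using R[of j] z by (simp add: v_def norm_mult)
    then have v: "norm v < 1" using R by simp
    define t where "t = (1 - radii j) / (norm (1 - v))\<^sup>2"
    have v1: "norm (1 - v) > 0" using v by auto
    have rj: "0 \<le> radii j" "radii j < 1" using radii by auto
    \<comment> \<open>Squaring doubles the Poisson exponent, and this factor 2 absorbs the
      replacement of 1 - |v|^2 = 1 - sqrt r by 1 - r.\<close>
    have "(norm (Ei v))\<^sup>2 \<le> exp (- t)"
    proof -
      have "(norm (Ei v))\<^sup>2 = exp (- (2 * (1 - sqrt (radii j)) / (norm (1 - v))\<^sup>2))"
        unfolding norm_Ei nv R(3) exp_double[symmetric] by simp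
      also have "\<dots> \<le> exp (- t)"
      proof -
        have "1 - radii j = (1 - sqrt (radii j)) * (1 + sqrt (radii j))" using rj by (simp add: algebra_simps)
        also have "\<dots> \<le> (1 - sqrt (radii j)) * 2" using rj by (intro mult_left_mono) auto
        finally have "1 - radii j \<le> 2 * (1 - sqrt (radii j))" by simp
        then have "t \<le> 2 * (1 - sqrt (radii j)) / (norm (1 - v))\<^sup>2" unfolding t_def by (rule divide_right_mono) simp
        then show ?thesis by simp
      qed
      finally show ?thesis .
    qed
    moreover have "(norm (fn (kern (radii j)) v))\<^sup>2 \<le> 4 / (norm (1 - v))\<^sup>2"
    proof -
      have k: "norm (1 - v) \<le> 2 * norm (1 - of_real (radii j) * v)" by (rule kern_denom(2)[OF rj v])
      then have "(norm (1 - v))\<^sup>2 \<le> (2 * norm (1 - of_real (radii j) * v))\<^sup>2" by (intro power_mono) auto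
      moreover have "norm (1 - of_real (radii j) * v) > 0" using kern_denom(3)[OF rj v] by simp
      ultimately show ?thesis using v1 by (simp add: fn_kern[OF rj v] norm_divide power_divide power_mult_distrib field_simps)
    qed
    ultimately have "(norm (fn (Ekern (radii j)) v))\<^sup>2 \<le> exp (- t) * (4 / (norm (1 - v))\<^sup>2)"
      unfolding Ekern_def fn_hmul[OF bholo_Ei] norm_mult power_mult_distrib by (intro mult_mono) auto
    then have "u j \<zeta> \<le> (1 - radii j) * (exp (- t) * (4 / (norm (1 - v))\<^sup>2))"
      unfolding u_def v_def[symmetric] using rj by (intro mult_left_mono) auto
    also have "\<dots> = 4 * t * exp (- t)" by (simp add: t_def)
    finally show ?thesis by (simp add: t_def v_def)
  qed
  have te: "t * exp (- t) \<le> 1" for t :: real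
  proof -
    have "t \<le> exp t" using exp_ge_add_one_self[of t] by linarith
    then show ?thesis by (simp add: exp_minus divide_inverse[symmetric] divide_le_eq_1)
  qed
  have m [measurable]: "u j \<in> borel_measurable borel" for j
  proof -
    note [measurable] = L2_measurable[OF L2_dilate[OF R(1,2)[of j]]]
    show ?thesis unfolding u_def by measurable
  qed
  have "(\<lambda>j. integral\<^sup>L circle_measure (u j)) \<longlonglongrightarrow> integral\<^sup>L circle_measure (\<lambda>\<zeta>. 0 :: real)"
  proof (rule integral_dominated_convergence[where w="\<lambda>_. 4"])
    show "AE \<zeta> in circle_measure. norm (u j \<zeta>) \<le> 4" for j
      using AE_circle_norm
    proof eventually_elim
      case (elim \<zeta>)
      have "0 \<le> u j \<zeta>" using radii(3)[of j] by (simp add: u_def less_imp_le)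
      moreover have "u j \<zeta> \<le> 4 * 1"
        using bnd[OF elim, of j] te[of "(1 - radii j) / (norm (1 - of_real (R j) * \<zeta>))\<^sup>2"] by linarith
      ultimately show ?case by simp
    qed
    show "AE \<zeta> in circle_measure. (\<lambda>j. u j \<zeta>) \<longlonglongrightarrow> 0"
      using AE_circle_norm AE_circle_ne[of 1]
    proof eventually_elim
      case (elim \<zeta>)
      have nz: "norm (1 - of_real 1 * \<zeta>) \<noteq> 0" using elim(2) by simp
      show ?case
      proof (rule tendsto_sandwich[OF _ _ tendsto_const])
        show "\<forall>\<^sub>F j in sequentially. 0 \<le> u j \<zeta>" using radii(3) by (simp add: u_def less_imp_le)
        show "\<forall>\<^sub>F j in sequentially. u j \<zeta> \<le> 4 * ((1 - radii j) / (norm (1 - of_real (R j) * \<zeta>))\<^sup>2)"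
        proof (rule always_eventually, rule allI)
          fix j
          define X where "X = (1 - radii j) / (norm (1 - of_real (R j) * \<zeta>))\<^sup>2"
          have "0 \<le> X" using radii(3)[of j] by (simp add: X_def less_imp_le)
          then have "4 * X * exp (- X) \<le> 4 * X * 1" by (intro mult_left_mono) auto
          then show "u j \<zeta> \<le> 4 * ((1 - radii j) / (norm (1 - of_real (R j) * \<zeta>))\<^sup>2)"
            using bnd[OF elim(1), of j] unfolding X_def by linarith
        qed
        have "(\<lambda>j. 4 * ((1 - radii j) / (norm (1 - of_real (R j) * \<zeta>))\<^sup>2)) \<longlonglongrightarrow> 4 * ((1 - 1) / (norm (1 - of_real 1 * \<zeta>))\<^sup>2)"
          using nz by (intro tendsto_intros radii(4) Rl) auto
        then show "(\<lambda>j. 4 * ((1 - radii j) / (norm (1 - of_real (R j) * \<zeta>))\<^sup>2)) \<longlonglongrightarrow> 0" by simp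
      qed
    qed
  qed auto
  moreover have "integral\<^sup>L circle_measure (u j) = (1 - radii j) * (dil_norm (R j) (Ekern (radii j)))\<^sup>2" for j
    unfolding u_def dil_norm_def by simp
  ultimately show ?thesis by (simp add: R_def)
qed

section \<open>Failure of convergence\<close>

lemma H_infty_ball_hol: "bholo 1 g \<Longrightarrow> fn (hol g) \<in> H_infty_unit_ball"
proof -
  assume g: "bholo 1 g"
  have n: "norm (fn (hol g) z) \<le> 1" if "z \<in> ball 0 1" for z using that bholo_hol[OF g] by (simp add: bholo_def)
  have "fn (hol g) \<in> H_infty"
    unfolding H_infty_def using fn_disk[of "hol g"] n by (auto simp: disk_holo_def intro!: boundedI)
  moreover have "H_infty_norm (fn (hol g)) \<le> 1"
    unfolding H_infty_norm_def by (rule cSUP_least) (use n in auto)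
  ultimately show ?thesis by (simp add: H_infty_unit_ball_def)
qed

text \<open>b is the midpoint of b + a^2/2 and b - a^2/2. Both are in the unit ball because |a|^2 <=
  1 - |b|^2 and |b| + (1 - |b|^2)/2 = 1 - (1 - |b|)^2/2; they differ at 0, where a is 1/2.\<close>

lemma not_extreme_bf: "\<not> extreme (fn (hol bf))"
proof -
  have b: "bholo 1 (\<lambda>z. bf z + c * (af z)\<^sup>2)" if c: "norm c = 1/2" for c
    unfolding bholo_def
  proof (intro conjI allI impI)
    show "(\<lambda>z. bf z + c * (af z)\<^sup>2) holomorphic_on ball 0 1"
      using bholo_bf bholo_af by (auto simp: bholo_def intro!: holomorphic_intros)
    fix z :: complex assume z: "norm z < 1"
    have "norm (bf z + c * (af z)\<^sup>2) \<le> norm (bf z) + (norm (af z))\<^sup>2 / 2"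
      using norm_triangle_ineq[of "bf z" "c * (af z)\<^sup>2"] c by (simp add: norm_mult norm_power)
    also have "\<dots> \<le> norm (bf z) + (1 - (norm (bf z))\<^sup>2) / 2" using bf_af[OF z] by simp
    also have "\<dots> = 1 - (1 - norm (bf z))\<^sup>2 / 2" by (simp add: power2_eq_square field_simps)
    also have "\<dots> \<le> 1" by simp
    finally show "norm (bf z + c * (af z)\<^sup>2) \<le> 1" .
  qed
  define f where "f = fn (hol (\<lambda>z. bf z + (1/2) * (af z)\<^sup>2))"
  define g where "g = fn (hol (\<lambda>z. bf z + (-1/2) * (af z)\<^sup>2))"
  have b1: "bholo 1 (\<lambda>z. bf z + (1/2) * (af z)\<^sup>2)" and b2: "bholo 1 (\<lambda>z. bf z + (-1/2) * (af z)\<^sup>2)"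
    by (rule b, simp)+
  have fg: "f \<in> H_infty_unit_ball" "g \<in> H_infty_unit_ball"
    unfolding f_def g_def by (rule H_infty_ball_hol[OF b1], rule H_infty_ball_hol[OF b2])
  have "f 0 \<noteq> g 0" by (simp only: f_def g_def hol(1)[OF b1] hol(1)[OF b2]) (simp add: af_def)
  then have "f \<noteq> g" by auto
  moreover have "fn (hol bf) = (\<lambda>z. of_real (1 - 1/2) * f z + of_real (1/2) * g z)"
    by (rule ext) (simp only: f_def g_def hol(1)[OF b1] hol(1)[OF b2] hol(1)[OF bholo_bf], simp add: field_simps)
  ultimately show ?thesis unfolding extreme_def using fg
    by (metis half_gt_zero_iff zero_less_one less_divide_eq_1_pos field_sum_of_halves less_add_same_cancel1)
qed

theorem corollary1p2:
  fixes \<alpha> :: real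
  assumes "\<alpha> > -1"
  shows "\<exists>b f. b \<in> H_infty_unit_ball \<and> \<not> extreme b \<and> f \<in> dBR b \<and>
    \<not> ((\<lambda>r. dBR_norm b (\<lambda>z. abel_mean \<alpha> r f z - f z)) \<longlongrightarrow> 0) (at_left (1::real))"
proof (rule ccontr)
  assume contra: "\<not> ?thesis"
  define b where "b = hol bf"
  obtain S where S: "psd (blinfun_apply S)" "\<And>x. S (S x) = x - hmul (fn b) (hadj (hmul (fn b)) x)"
    and def: "\<And>x. defect_op (fn b) (fn x) = fn (S x)"
    using defect_op_exists[OF bholo_hol[OF bholo_bf], folded b_def] by blast
  interpret pythagorean_pair b "hol af" S
    by unfold_locales
       (use bholo_hol[OF bholo_bf] bholo_hol[OF bholo_af] bf_af_pyth S hmul_af_inj in \<open>auto simp: b_def\<close>)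
  \<comment> \<open>The assumption for contradiction, specialized to this single b: the Abel means
    converge for every function in the space.\<close>
  have conv: "((\<lambda>r. dBR_norm (fn b) (\<lambda>z. abel_mean \<alpha> r (fn x) z - fn x z)) \<longlongrightarrow> 0) (at_left (1::real))"
    if "fn x \<in> dBR (fn b)" for x
    using contra that H_infty_ball_hol[OF bholo_bf] not_extreme_bf unfolding b_def by blast
  have nrm: "dBR_norm (fn b) (fn (S x)) = norm x" for x
    by (rule dBR_norm_fn[OF def S_inj bounded_linear.linear[OF blinfun.bounded_linear_right]])
  define A where "A j = habel \<alpha> (radii j)" for j
  note cA = cblin_habel[OF assms radii(1,3)]
  \<comment> \<open>The norm of H(b) is a definite description, meaningful only for members of the
    space. Geometric decay of the coefficients provides a preimage under the coanalytic operator,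
    whose range lies in H(b).\<close>
  have Arange: "\<exists>g. S g = A j x" for j x
  proof -
    have "norm (hcoef (A j x) n) \<le> (2 powr (1 + \<alpha>) * norm x) * sqrt (radii j) ^ n" for n
    proof -
      have "norm (hcoef (A j x) n) = abel_mult \<alpha> (radii j) n * norm (hcoef x n)"
        using abel_mult_nonneg[OF assms radii(1,3)] by (simp add: A_def habel_coef[OF assms radii(1,3)] norm_mult)
      also have "\<dots> \<le> (2 powr (1 + \<alpha>) * sqrt (radii j) ^ n) * norm x"
        by (intro mult_mono abel_mult_geometric[OF assms radii(1,3)] norm_hcoef_le) (use radii(2)[of j] in auto)
      finally show ?thesis by (simp add: mult_ac)
    qed
    then obtain h where "hadj (hmul (fn (hol af))) h = A j x"
      using hadj_af_preimage[of "A j x" _ "sqrt (radii j)"] radii(2,3)[of j] by (metis real_sqrt_ge_0_iff real_sqrt_lt_1_iff)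
    then show ?thesis using range_hadj_N[of h] by simp
  qed
  define F where "F j = M (test_k (radii j))" for j
  have SF: "norm (S (F j)) \<le> 3" for j
    unfolding F_def using norm_S_M_le[of "test_k (radii j)"] norm_af_test_k[OF radii(2,3), of j] by linarith
  \<comment> \<open>These functionals are continuous on \<open>H2\<close>, and the assumed
    convergence bounds them pointwise on the kernel of \<open>hadj M\<close>, so uniform boundedness
    applies there.\<close>
  define T where "T j x = inner (A j x) (F j)" for j x
  have "\<exists>C. \<forall>j. \<forall>x\<in>{x. hadj M x = 0}. norm (T j x) \<le> C * norm x"
  proof (rule uniform_boundedness)
    note hM = cblin_bounded_linear[OF cblin_hadj[OF M]]
    show "bounded_linear (T j)" for j
      unfolding T_def[abs_def] A_def by (rule bounded_linear_compose[OF bounded_linear_inner_left cblin_bounded_linear[OF cA]])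
    show "subspace {x. hadj M x = 0}"
      using bounded_linear.linear[OF hM] by (auto simp: subspace_def linear_0 linear_add linear_scale)
    show "closed {x. hadj M x = 0}"
      by (intro closed_Collect_eq continuous_on_const linear_continuous_on hM)
  next
    fix x assume "x \<in> {x. hadj M x = 0}"
    then have Sx: "S x = x" by (simp add: S_eq_self)
    then have "fn x \<in> dBR (fn b)" unfolding dBR_fn[OF def] by (metis imageI rangeI)
    from conv[OF this]
    have "(\<lambda>j. dBR_norm (fn b) (\<lambda>z. abel_mean \<alpha> (radii j) (fn x) z - fn x z)) \<longlonglongrightarrow> 0"
      by (rule filterlim_compose) (use radii in \<open>auto simp: filterlim_at intro!: always_eventually less_imp_neq\<close>)
    then have "Bseq (\<lambda>j. dBR_norm (fn b) (\<lambda>z. abel_mean \<alpha> (radii j) (fn x) z - fn x z))"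
      by (intro convergent_imp_Bseq) (auto simp: convergent_def)
    then obtain B where B: "\<And>j. norm (dBR_norm (fn b) (\<lambda>z. abel_mean \<alpha> (radii j) (fn x) z - fn x z)) \<le> B"
      by (auto simp: Bseq_def)
    have "norm (T j x) \<le> (B + norm x) * 3" for j
    proof -
      obtain g where g: "S g = A j x" using Arange by blast
      have "(\<lambda>z. abel_mean \<alpha> (radii j) (fn x) z - fn x z) = fn (S (g - x))"
        by (rule ext) (simp add: abel_mean_fn[OF assms radii(1,3)] blinfun.bilinear_simps g Sx fn_diff A_def)
      then have "norm (g - x) \<le> B" using B[of j] by (simp add: nrm)
      then have "norm g \<le> B + norm x" using norm_triangle_ineq2[of g x] by linarith
      moreover have "norm (T j x) \<le> norm g * norm (S (F j))"
        unfolding T_def g[symmetric] S_sym real_norm_def by (rule Cauchy_Schwarz_ineq2)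
      ultimately show ?thesis using SF[of j] by (meson mult_mono norm_ge_zero order_trans)
    qed
    then show "\<exists>B. \<forall>j. norm (T j x) \<le> B" by blast
  qed
  then obtain C where C: "\<And>j x. hadj M x = 0 \<Longrightarrow> norm (T j x) \<le> C * norm x" by auto
  define \<kappa> where "\<kappa> = (1 - (4/7) powr (1 + \<alpha>)) / 2"
  define D where "D = 2 powr (1 + \<alpha>)"
  define s where "s j = 1 / sqrt (1 - radii j)" for j
  define d where "d j = dil_norm (sqrt (sqrt (radii j))) (Ekern (radii j))" for j
  \<comment> \<open>The ratio of d to s. It tends to 0 by \<open>Ekern_negligible\<close>, so in
    \<open>test_estimate\<close> the error terms are of smaller order than s^2.\<close>
  define e where "e j = sqrt (1 - radii j) * d j" for j
  have \<kappa>: "\<kappa> > 0"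
  proof -
    have "(4/7) powr (1 + \<alpha>) < 1 powr (1 + \<alpha>)" by (rule powr_less_mono2) (use assms in auto)
    then show ?thesis by (simp add: \<kappa>_def)
  qed
  have D: "D > 0" by (simp add: D_def)
  have s: "s j > 0" "d j = e j * s j" "s j = sqrt (real (j + 2))" for j
    using radii(3)[of j] by (auto simp: s_def e_def radii_def real_sqrt_divide)
  have d0: "0 \<le> d j" for j by (simp add: d_def dil_norm_def)
  have e0: "0 \<le> e j" for j using d0 radii(3)[of j] by (simp add: e_def)
  have "(\<lambda>j. sqrt ((1 - radii j) * (d j)\<^sup>2)) \<longlonglongrightarrow> sqrt 0"
    by (rule tendsto_real_sqrt) (use Ekern_negligible in \<open>simp add: d_def\<close>)
  then have el: "e \<longlonglongrightarrow> 0" using d0 by (simp add: e_def[abs_def] real_sqrt_mult)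
  \<comment> \<open>The pairing is of order s^2 while the norm of \<open>test_f\<close> is only of
    order s; one factor s is divided out.\<close>
  have low: "s j * (\<kappa> / 4 - 2 * D * (e j + (e j)\<^sup>2)) \<le> 2 * \<bar>C\<bar>" for j
  proof -
    have "1/2 \<le> radii j" by (simp add: radii_def field_simps)
    from test_estimate[OF assms this radii(3)]
    have "T j (test_f (radii j)) \<le> - (\<kappa> * (s j)\<^sup>2) / 4 + 2 * D * (s j * d j + (d j)\<^sup>2)"
      unfolding T_def A_def F_def b_def \<kappa>_def D_def s_def d_def .
    also have "\<dots> = - (s j * (s j * (\<kappa> / 4 - 2 * D * (e j + (e j)\<^sup>2))))"
      unfolding s(2)[of j] by (simp add: power2_eq_square algebra_simps)
    finally have "s j * (s j * (\<kappa> / 4 - 2 * D * (e j + (e j)\<^sup>2))) \<le> norm (T j (test_f (radii j)))" by simp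
    also have "\<dots> \<le> C * norm (test_f (radii j))"
      by (rule C) (use hadj_test_f[OF radii(2,3), of j] in \<open>simp add: b_def\<close>)
    also have "\<dots> \<le> \<bar>C\<bar> * (2 * s j)"
      using norm_test_f[OF radii(2,3), of j] by (intro mult_mono) (auto simp: s_def)
    finally have "s j * (s j * (\<kappa> / 4 - 2 * D * (e j + (e j)\<^sup>2))) \<le> s j * (2 * \<bar>C\<bar>)" by (simp add: mult_ac)
    then show ?thesis using s(1)[of j] by (simp add: mult_le_cancel_left_pos)
  qed
  have "(\<lambda>j. 2 * D * (e j + (e j)\<^sup>2)) \<longlonglongrightarrow> 2 * D * (0 + 0\<^sup>2)" by (intro tendsto_intros el)
  then have "\<forall>\<^sub>F j in sequentially. 2 * D * (e j + (e j)\<^sup>2) < \<kappa> / 8"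
    by (rule order_tendstoD) (use \<kappa> in simp)
  then obtain J where J: "\<And>j. j \<ge> J \<Longrightarrow> 2 * D * (e j + (e j)\<^sup>2) < \<kappa> / 8" by (auto simp: eventually_sequentially)
  \<comment> \<open>An error below half of \<open>\<kappa> / 4\<close> leaves a fixed positive
    factor, so s would be bounded, although its square is j + 2.\<close>
  have sb: "s j \<le> 16 * \<bar>C\<bar> / \<kappa>" if "j \<ge> J" for j
  proof -
    have "s j * (\<kappa> / 8) \<le> s j * (\<kappa> / 4 - 2 * D * (e j + (e j)\<^sup>2))" using J[OF that] s(1)[of j] by (intro mult_left_mono) auto
    then have "s j * (\<kappa> / 8) \<le> 2 * \<bar>C\<bar>" using low[of j] by linarith
    then show ?thesis using \<kappa> by (simp add: field_simps)
  qed
  obtain n :: nat where n: "real n > (16 * \<bar>C\<bar> / \<kappa>)\<^sup>2" using reals_Archimedean2 by blast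
  have "real (J + n + 2) = (s (J + n))\<^sup>2" by (simp add: s(3))
  also have "\<dots> \<le> (16 * \<bar>C\<bar> / \<kappa>)\<^sup>2" by (rule power_mono[OF sb less_imp_le[OF s(1)]]) simp
  finally show False using n by simp
qed

end
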